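(* Let $n>p$, let $c\in\mathbb R^n$ be a known unit vector, and consider the rank-1 spiked covariance model $Y\sim N_{n\times p}(0,\Sigma\otimes\Psi)$ with $\Psi=\omega cc^T+I_n$, where $\Sigma\in\mathcal S_p^+$ and $\omega\ge 0$ are unknown. Let $U=Y(Y^TY)^{-1/2}$. For $\alpha\in(0,1)$, the uniformly most powerful invariant level-$\alpha$ test of $H:\omega=0$ versus $K:\omega>0$ (invariance being with respect to the group $\mathcal G_L$ of transformations $g(Y)=YA^T$, $A\in\mathbb R^{p\times p}$ nonsingular) is given by $$\phi(Y)=1\left(c^TUU^Tc>b_{1-\alpha}\right),$$ where $b_{1-\alpha}$ is the $1-\alpha$ quantile of a $\mathrm{beta}(p/2,(n-p)/2)$ distribution. The power of this test is given by $$\Pr\left(\frac{1+\omega}{1+b\omega}\,b>b_{1-\alpha}\right)=\Pr\left(b>\frac{b_{1-\alpha}}{1+\omega(1-b_{1-\alpha})}\right),$$ where $b\sim\mathrm{beta}(p/2,(n-p)/2)$.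
   Context: $\mathcal S_p^+$ is the set of $p\times p$ symmetric positive definite matrices. $Y\sim N_{n\times p}(0,\Sigma\otimes\Psi)$ means $Y$ has the distribution of $\Psi^{1/2}Z\Sigma^{1/2}$, where $Z$ is an $n\times p$ matrix of i.i.d. standard normal entries and square roots are symmetric. The matrix $Y^TY$ is nonsingular with probability one, and $(Y^TY)^{-1/2}$ is the symmetric inverse square root. $1(\cdot)$ is the indicator function. A test is a measurable function $\phi:\mathbb R^{n\times p}\to[0,1]$; it is invariant if $\phi(YA^T)=\phi(Y)$ for all $Y$ and all nonsingular $A$. The distribution of an invariant test does not depend on $\Sigma$; an invariant test has level $\alpha$ if its expectation under $\omega=0$ is $\alpha$. Uniformly most powerful invariant means that for every $\omega>0$ its power (expectation) is at least that of any other invariant level-$\alpha$ test. *)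

theory Defs
  imports "HOL-Probability.Probability"
begin

definition sym_pos_def :: "real^'k^'k \<Rightarrow> bool" where
  "sym_pos_def A \<longleftrightarrow> transpose A = A \<and> (\<forall>x. x \<noteq> 0 \<longrightarrow> 0 < x \<bullet> (A *v x))"

text \<open>The symmetric square root is the positive definite one, as usual;
  it is only meaningful for symmetric positive definite arguments.\<close>

definition matrix_sqrt :: "real^'k^'k \<Rightarrow> real^'k^'k" where
  "matrix_sqrt A = (THE B. sym_pos_def B \<and> B ** B = A)"

text \<open>An $n \times p$ matrix has type \<open>real^'p^'n\<close>, with $n$ rows and $p$ columns.\<close>

definition std_normal_matrix :: "(real^'p^'n) measure" where
  "std_normal_matrix =
     distr (Pi\<^sub>M (UNIV :: ('n \<times> 'p) set) (\<lambda>_. std_normal_distribution)) borel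
       (\<lambda>z. \<chi> i j. z (i, j))"

definition matrix_normal :: "real^'p^'p \<Rightarrow> real^'n^'n \<Rightarrow> (real^'p^'n) measure" where
  "matrix_normal \<Sigma> \<Psi> =
     distr std_normal_matrix borel (\<lambda>Z. matrix_sqrt \<Psi> ** Z ** matrix_sqrt \<Sigma>)"

definition spiked_cov :: "real^'n \<Rightarrow> real \<Rightarrow> real^'n^'n" where
  "spiked_cov c \<omega> = \<omega> *\<^sub>R (\<chi> i j. c $ i * c $ j) + mat 1"

definition spiked_model :: "real^'n \<Rightarrow> real^'p^'p \<Rightarrow> real \<Rightarrow> (real^'p^'n) measure" where
  "spiked_model c \<Sigma> \<omega> = matrix_normal \<Sigma> (spiked_cov c \<omega>)"

text \<open>$U = Y (Y^T Y)^{-1/2}$. The value 0 on the set of rank-deficient $Y$, which is null under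
  the model when $p \<le> n$, is a convention. It makes statistics of the form
  $1(c^T U U^T c > b)$ total, and invariant at every $Y$ rather than almost every $Y$.\<close>

definition orth_factor :: "real^'p^'n \<Rightarrow> real^'p^'n" where
  "orth_factor Y =
     (let S = transpose Y ** Y in if invertible S then Y ** matrix_inv (matrix_sqrt S) else 0)"

definition invariant_test :: "(real^'p^'n \<Rightarrow> real) \<Rightarrow> bool" where
  "invariant_test \<phi> \<longleftrightarrow>
     \<phi> \<in> borel_measurable borel \<and>
     (\<forall>Y. 0 \<le> \<phi> Y \<and> \<phi> Y \<le> 1) \<and>
     (\<forall>Y A. invertible A \<longrightarrow> \<phi> (Y ** transpose A) = \<phi> Y)"

definition power_fun ::
    "real^'n \<Rightarrow> (real^'p^'n \<Rightarrow> real) \<Rightarrow> real^'p^'p \<Rightarrow> real \<Rightarrow> real" where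
  "power_fun c \<phi> \<Sigma> \<omega> = (\<integral>Y. \<phi> Y \<partial>(spiked_model c \<Sigma> \<omega>))"

text \<open>The power of an invariant test does not depend on $\Sigma$, so quantifying over all
  $\Sigma$ is no more restrictive than fixing one.\<close>

definition invariant_level_test :: "real^'n \<Rightarrow> real \<Rightarrow> (real^'p^'n \<Rightarrow> real) \<Rightarrow> bool" where
  "invariant_level_test c \<alpha> \<phi> \<longleftrightarrow>
     invariant_test \<phi> \<and> (\<forall>\<Sigma>. sym_pos_def \<Sigma> \<longrightarrow> power_fun c \<phi> \<Sigma> 0 = \<alpha>)"

definition UMP_invariant :: "real^'n \<Rightarrow> real \<Rightarrow> (real^'p^'n \<Rightarrow> real) \<Rightarrow> bool" where
  "UMP_invariant c \<alpha> \<phi> \<longleftrightarrow>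
     invariant_level_test c \<alpha> \<phi> \<and>
     (\<forall>\<psi>. invariant_level_test c \<alpha> \<psi> \<longrightarrow>
        (\<forall>\<Sigma> \<omega>. sym_pos_def \<Sigma> \<longrightarrow> 0 < \<omega> \<longrightarrow> power_fun c \<psi> \<Sigma> \<omega> \<le> power_fun c \<phi> \<Sigma> \<omega>))"

definition beta_distribution :: "real \<Rightarrow> real \<Rightarrow> real measure" where
  "beta_distribution a b = density lborel
     (\<lambda>x. ennreal (indicator {0<..<1} x * x powr (a - 1) * (1 - x) powr (b - 1) / Beta a b))"

definition quantile :: "real measure \<Rightarrow> real \<Rightarrow> real" where
  "quantile M t = Inf {x. t \<le> cdf M x}"

end

theory Submission
  imports Defs
begin

text \<open>Write $t(Y) = c^T U U^T c$. An invariant test sees only the orbit of $Y$ under right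
  multiplication by invertible matrices. Averaging the Gaussian density of $Y$ over the orbit with
  Haar measure $|\det A|^{-p}\,dA$ leaves $(\det \Psi)^{-p/2} \det(Y^T \Psi^{-1} Y)^{-n/2}$ up to a
  factor not involving $\omega$, so the likelihood ratio of the orbit for $a = 1 + \omega$ against $\omega = 0$ is
  $a^{-p/2} (1 - t + t/a)^{-n/2}$, by the determinant formula for rank-one updates. It increases
  with $t$, and the Neyman--Pearson argument applies.

  Under $\omega$ the statistic is distributed as $a t / (1 - t + a t)$ with $t$ taken under
  $\omega = 0$. Together with the likelihood ratio this says that the null law of the logit of $t$
  is translated with an explicit density; integrating over all translations identifies the null law
  of $t$ as $\mathrm{beta}(p/2, (n-p)/2)$ without any further distribution theory.\<close>

subsection \<open>Spectral theorem and square roots\<close>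

text \<open>No quotient space or disintegration is built. Averaging over orbits enters as an
  exchange identity: under a measure invariant under the group, two weights \<open>h\<close> and
  \<open>g\<close> trade places, one evaluated at \<open>Y\<close> and the other averaged over Haar
  measure. Taking for \<open>g\<close> a weighted indicator of the unit ball makes every Gaussian
  integral comparable with an integral over the ball. The group is not compact, so the constants
  need care: the ball constant is proved positive and finite and is the only one cancelled; the
  Gaussian one is common to two identities and is never evaluated. The Jacobians of left and right
  matrix multiplication come from the singular value decomposition, which leaves only isometries and
  entrywise scalings. Square roots are definite descriptions, so both existence and uniqueness are
  needed, and the spectral theorem supplies them. \<Sigma> disappears at once, because right
  multiplication by its root belongs to the group. Integrals stay in \<open>ennreal\<close> up to
  the power function, so that Fubini asks only for measurability and sigma-finiteness.\<close>

lemma inner_transpose_mult: "(transpose A *v x) \<bullet> y = x \<bullet> (A *v y)" for A :: "real^'p^'n"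
  by (simp only: transpose_matrix_vector dot_lmul_matrix)

lemma matrix_mult_diff_distrib:
  fixes A B :: "real^'k^'m" and C :: "real^'q^'k"
  shows "(A - B) ** C = A ** C - B ** C" "D ** (A - B) = D ** A - D ** B"
  by (simp_all add: matrix_matrix_mult_def vec_eq_iff algebra_simps sum_subtractf)

text \<open>The maximizer \<open>v\<close> of the quadratic form on the unit sphere of
  \<open>S\<close> is an eigenvector: the residual \<open>w = f v - m v\<close> lies in
  \<open>S\<close> and is orthogonal to \<open>v\<close>, and a first variation in its direction
  would increase the form unless \<open>w = 0\<close>.\<close>

lemma selfadjoint_eigenvector_exists:
  fixes f :: "'a::euclidean_space \<Rightarrow> 'a"
  assumes f: "linear f" and sym: "\<And>x y. f x \<bullet> y = x \<bullet> f y"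
    and S: "subspace S" "f ` S \<subseteq> S" "S \<noteq> {0}"
  obtains v l where "v \<in> S" "norm v = 1" "f v = l *\<^sub>R v"
proof -
  interpret f: linear f by fact
  let ?K = "sphere 0 1 \<inter> S"
  obtain z where z: "z \<in> S" "z \<noteq> 0" using S subspace_0 by blast
  have "z /\<^sub>R norm z \<in> ?K" using z S(1) by (simp add: subspace_scale)
  then have ne: "?K \<noteq> {}" by blast
  have "compact ?K" using S(1) by (simp add: closed_subspace compact_Int_closed)
  moreover have "continuous_on ?K (\<lambda>x. x \<bullet> f x)"
    by (intro continuous_intros linear_continuous_on linear_linear[THEN iffD2] f)
  ultimately obtain v where v: "v \<in> ?K" and vmax: "\<And>x. x \<in> ?K \<Longrightarrow> x \<bullet> f x \<le> v \<bullet> f v"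
    using continuous_attains_sup[OF _ ne] by blast
  define m where "m = v \<bullet> f v"
  have vS: "v \<in> S" and vn: "norm v = 1" using v by auto
  have vv: "v \<bullet> v = 1" using vn by (simp add: dot_square_norm)
  have le: "x \<bullet> f x \<le> m * (x \<bullet> x)" if "x \<in> S" for x
  proof (cases "x = 0")
    case False
    have "x /\<^sub>R norm x \<in> ?K" using False that S(1) by (simp add: subspace_scale)
    from vmax[OF this] have "(x \<bullet> f x) / (norm x)\<^sup>2 \<le> m"
      by (simp add: f.scaleR m_def power2_eq_square divide_simps)
    then show ?thesis using False by (simp add: divide_simps dot_square_norm mult.commute)
  qed (simp add: f.zero)
  define w where "w = f v - m *\<^sub>R v"
  have fvS: "f v \<in> S" using vS S(2) by blast
  have wS: "w \<in> S" unfolding w_def using vS fvS S(1) by (simp add: subspace_diff subspace_scale)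
  have wv: "w \<bullet> v = 0" by (simp add: w_def inner_diff_left vv) (simp add: m_def inner_commute)
  have ww: "w \<bullet> f v = w \<bullet> w" using wv by (simp add: w_def inner_diff_right)
  have wfv: "v \<bullet> f w = w \<bullet> w" using ww sym[of v w] by (simp add: inner_commute)
  \<comment> \<open>Maximality at \<open>v + s w\<close>, expanded: the gain is linear in
    \<open>s\<close>, while everything else is quadratic.\<close>
  have q: "2 * s * (w \<bullet> w) \<le> s\<^sup>2 * (m * (w \<bullet> w) - w \<bullet> f w)" for s
  proof -
    have "v + s *\<^sub>R w \<in> S" using vS wS S(1) by (simp add: subspace_add subspace_scale)
    from le[OF this] show ?thesis
      using wv ww wfv vv
      by (simp add: f.add f.scaleR inner_add_left inner_add_right inner_commute[of v w] power2_eq_square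
          algebra_simps flip: m_def)
  qed
  have "w \<bullet> w = 0"
  proof (rule ccontr)
    assume n0: "w \<bullet> w \<noteq> 0"
    then have pos: "w \<bullet> w > 0" by (simp add: order_less_le)
    define k where "k = m * (w \<bullet> w) - w \<bullet> f w"
    \<comment> \<open>Small enough that \<open>s * k\<close> stays below
      \<open>w \<bullet> w\<close>, half of what \<open>q\<close> demands; the summand 1 covers
      \<open>k = 0\<close>.\<close>
    define s where "s = (w \<bullet> w) / (\<bar>k\<bar> + 1)"
    have s: "s > 0" unfolding s_def using pos by (simp add: add_nonneg_pos)
    have "s * (2 * (w \<bullet> w)) \<le> s * (s * k)" using q[of s] by (simp add: k_def power2_eq_square algebra_simps)
    then have "2 * (w \<bullet> w) \<le> s * k" using s by simp
    also have "\<dots> \<le> s * (\<bar>k\<bar> + 1)" using s by (intro mult_left_mono) auto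
    also have "\<dots> = w \<bullet> w" by (simp add: s_def add_nonneg_eq_0_iff)
    finally show False using pos by simp
  qed
  then have "f v = m *\<^sub>R v" by (simp add: w_def)
  with vS vn that show thesis by blast
qed

text \<open>Induction on dimension: self-adjointness keeps the orthogonal complement of an
  eigenvector invariant. The statement is about invariant subspaces so that the induction hypothesis
  applies to that complement.\<close>

lemma selfadjoint_eigenbasis_subspace:
  fixes f :: "'a::euclidean_space \<Rightarrow> 'a"
  assumes f: "linear f" and sym: "\<And>x y. f x \<bullet> y = x \<bullet> f y"
    and "subspace S" "f ` S \<subseteq> S"
  shows "\<exists>B. B \<subseteq> S \<and> pairwise orthogonal B \<and> (\<forall>b\<in>B. norm b = 1 \<and> (\<exists>l. f b = l *\<^sub>R b)) \<and> S \<subseteq> span B"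
  using assms(3,4)
proof (induction "dim S" arbitrary: S rule: less_induct)
  case less
  show ?case
  proof (cases "S = {0}")
    case True
    then show ?thesis by (intro exI[of _ "{}"]) auto
  next
    case False
    obtain v l where v: "v \<in> S" "norm v = 1" "f v = l *\<^sub>R v"
      using selfadjoint_eigenvector_exists[OF f sym less.prems False] by blast
    define T where "T = {x \<in> S. v \<bullet> x = 0}"
    have "T = S \<inter> {x. v \<bullet> x = 0}" by (auto simp: T_def)
    then have T: "subspace T" using less.prems(1) by (simp add: subspace_inter subspace_hyperplane)
    have fT: "f ` T \<subseteq> T"
    proof -
      have "f x \<in> T" if "x \<in> T" for x
      proof -
        have x: "x \<in> S" "v \<bullet> x = 0" using that by (simp_all add: T_def)
        have "v \<bullet> f x = l * (v \<bullet> x)" using sym[of v x] v(3) by simp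
        moreover have "f x \<in> S" using x less.prems(2) by blast
        ultimately show ?thesis using x by (simp add: T_def)
      qed
      then show ?thesis by blast
    qed
    have "v \<notin> T" using v by (simp add: T_def dot_square_norm)
    then have "T \<noteq> S" using v by blast
    moreover have "T \<subseteq> S" by (auto simp: T_def)
    ultimately have "dim T < dim S"
      using subspace_dim_equal[OF T less.prems(1)] dim_subset[of T S] by fastforce
    from less.hyps[OF this T fT] obtain B where
      B: "B \<subseteq> T" "pairwise orthogonal B" "\<forall>b\<in>B. norm b = 1 \<and> (\<exists>l. f b = l *\<^sub>R b)" "T \<subseteq> span B" by blast
    have "S \<subseteq> span (insert v B)"
    proof
      fix x assume x: "x \<in> S"
      have "x - (v \<bullet> x) *\<^sub>R v \<in> T"
        using x v less.prems(1) by (simp add: T_def subspace_diff subspace_scale inner_diff_right dot_square_norm)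
      then show "x \<in> span (insert v B)" using B(4) span_breakdown_eq by blast
    qed
    moreover have "pairwise orthogonal (insert v B)"
      using B(1,2) by (auto simp: pairwise_insert orthogonal_def T_def inner_commute)
    ultimately show ?thesis
      using B v \<open>T \<subseteq> S\<close> by (intro exI[of _ "insert v B"]) auto
  qed
qed

section \<open>Diagonal matrices and diagonalization\<close>

definition diag_matrix :: "('n \<Rightarrow> real) \<Rightarrow> real^'n^'n" where
  "diag_matrix d = (\<chi> i j. if i = j then d i else 0)"

lemma diag_matrix_mult [simp]: "diag_matrix d ** diag_matrix e = diag_matrix (\<lambda>i. d i * e i)"
  by (simp add: diag_matrix_def matrix_matrix_mult_def vec_eq_iff if_distrib[of "\<lambda>x. x * _"]
      if_distrib[of "\<lambda>x. _ * x"] cong: if_cong)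

lemma transpose_diag_matrix [simp]: "transpose (diag_matrix d) = diag_matrix d"
  by (auto simp: diag_matrix_def transpose_def vec_eq_iff)

lemma diag_matrix_vector_mult: "diag_matrix d *v x = (\<chi> i. d i * x $ i)"
  by (simp add: diag_matrix_def matrix_vector_mult_def vec_eq_iff if_distrib[of "\<lambda>x. x * _"] cong: if_cong)

lemma det_diag_matrix: "det (diag_matrix d) = (\<Prod>i\<in>UNIV. d i)"
  by (subst det_diagonal) (auto simp: diag_matrix_def)

lemma orthogonal_matrix_cancel:
  assumes "orthogonal_matrix Q"
  shows "transpose Q ** Q = mat 1" "Q ** transpose Q = mat 1"
  using assms by (auto simp: orthogonal_matrix_def)

text \<open>The columns of \<open>Q\<close> are an orthonormal eigenbasis. It has as many elements
  as the index type, so an arbitrary bijection \<open>h\<close> can number its vectors by matrix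
  indices.\<close>

lemma symmetric_matrix_diagonalizable:
  fixes A :: "real^'n^'n"
  assumes A: "transpose A = A"
  obtains Q d where "orthogonal_matrix Q" "A = Q ** diag_matrix d ** transpose Q"
proof -
  have sym: "(A *v x) \<bullet> y = x \<bullet> (A *v y)" for x y
    using inner_transpose_mult[of A x y] A by simp
  obtain B where B: "pairwise orthogonal B" "\<And>b. b \<in> B \<Longrightarrow> norm b = 1"
      "\<And>b. b \<in> B \<Longrightarrow> \<exists>l. A *v b = l *\<^sub>R b" "span B = UNIV"
    using selfadjoint_eigenbasis_subspace[of "(*v) A" UNIV] sym
    by (metis matrix_vector_mul_linear subspace_UNIV subset_UNIV top.extremum_uniqueI)
  have ind: "independent B"
    using B(1,2) by (intro pairwise_orthogonal_independent) force+
  have card: "card B = CARD('n)"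
    using ind B(4) by (metis basis_card_eq_dim dim_UNIV DIM_cart DIM_real mult.right_neutral subset_UNIV)
  have fin: "finite B" using ind independent_imp_finite by blast
  obtain h :: "'n \<Rightarrow> real^'n" where h: "bij_betw h UNIV B"
    using finite_same_card_bij[OF finite_class.finite_UNIV fin] card by auto
  have hB: "h i \<in> B" for i using h by (auto simp: bij_betw_def)
  have "\<forall>i. \<exists>l. A *v h i = l *\<^sub>R h i" using B(3) hB by blast
  from choice[OF this] obtain d where d: "\<And>i. A *v h i = d i *\<^sub>R h i" by blast
  define Q where "Q = (\<chi> i j. h j $ i)"
  have inner: "h i \<bullet> h j = (if i = j then 1 else 0)" for i j
  proof (cases "i = j")
    case True
    then show ?thesis using B(2)[OF hB[of i]] by (simp add: dot_square_norm)
  next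
    case False
    then have "h i \<noteq> h j" using h by (metis UNIV_I bij_betw_inv_into_left)
    then show ?thesis using B(1) hB False by (auto simp: pairwise_def orthogonal_def)
  qed
  have Q: "orthogonal_matrix Q"
    using inner by (simp add: orthogonal_matrix Q_def transpose_def matrix_matrix_mult_def vec_eq_iff
        mat_def inner_vec_def)
  have "A ** Q = Q ** diag_matrix d"
  proof -
    have "(A ** Q) $ i $ j = (A *v h j) $ i" for i j
      by (simp add: matrix_matrix_mult_def matrix_vector_mult_def Q_def)
    moreover have "(Q ** diag_matrix d) $ i $ j = d j * h j $ i" for i j
      by (simp add: matrix_matrix_mult_def diag_matrix_def Q_def if_distrib[of "\<lambda>x. _ * x"] mult.commute cong: if_cong)
    ultimately show ?thesis by (simp add: vec_eq_iff d)
  qed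
  then have "A = Q ** diag_matrix d ** transpose Q"
    by (metis Q matrix_mul_assoc matrix_mul_rid orthogonal_matrix_cancel(2))
  with Q that show thesis by blast
qed

text \<open>Each \<open>d i\<close> is the value of the quadratic form at the \<open>i\<close>-th
  column of \<open>Q\<close>, hence positive.\<close>

lemma sym_pos_def_diagonalizable:
  fixes A :: "real^'n^'n"
  assumes A: "sym_pos_def A"
  obtains Q d where "orthogonal_matrix Q" "A = Q ** diag_matrix d ** transpose Q" "\<And>i. d i > 0"
proof -
  obtain Q d where Q: "orthogonal_matrix Q" and AQ: "A = Q ** diag_matrix d ** transpose Q"
    using symmetric_matrix_diagonalizable A by (metis sym_pos_def_def)
  have "d i > 0" for i
  proof -
    let ?x = "Q *v axis i 1"
    have tx: "transpose Q *v ?x = axis i 1"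
      by (simp add: matrix_vector_mul_assoc orthogonal_matrix_cancel[OF Q])
    then have "?x \<noteq> 0" by (metis axis_eq_0_iff matrix_vector_mult_0_right zero_neq_one)
    then have "0 < ?x \<bullet> (A *v ?x)" using A by (simp add: sym_pos_def_def)
    also have "\<dots> = ?x \<bullet> (Q *v (diag_matrix d *v axis i 1))"
      unfolding AQ matrix_vector_mul_assoc[symmetric] tx by simp
    also have "\<dots> = (transpose Q *v ?x) \<bullet> (diag_matrix d *v axis i 1)"
      by (simp only: inner_transpose_mult)
    also have "\<dots> = d i" unfolding tx
      by (simp add: inner_axis' diag_matrix_vector_mult)
    finally show ?thesis .
  qed
  with Q AQ that show thesis by blast
qed

lemma sym_pos_def_orthogonal_conj:
  assumes Q: "orthogonal_matrix Q" and d: "\<And>i. d i > 0"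
  shows "sym_pos_def (Q ** diag_matrix d ** transpose Q)"
proof -
  have "0 < x \<bullet> ((Q ** diag_matrix d ** transpose Q) *v x)" if "x \<noteq> 0" for x
  proof -
    let ?y = "transpose Q *v x"
    have "Q *v ?y = x"
      by (metis matrix_vector_mul_assoc matrix_vector_mul_lid orthogonal_matrix_cancel(2)[OF Q])
    then have "?y \<noteq> 0" using that by (metis matrix_vector_mult_0_right)
    then obtain k where k: "?y $ k \<noteq> 0" by (auto simp: vec_eq_iff)
    have "x \<bullet> ((Q ** diag_matrix d ** transpose Q) *v x) = x \<bullet> (Q *v (diag_matrix d *v ?y))"
      by (simp only: matrix_vector_mul_assoc matrix_mul_assoc)
    also have "\<dots> = ?y \<bullet> (diag_matrix d *v ?y)"
      by (simp only: inner_transpose_mult)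
    also have "\<dots> = (\<Sum>i\<in>UNIV. d i * (?y $ i)\<^sup>2)"
      by (simp add: inner_vec_def diag_matrix_vector_mult power2_eq_square algebra_simps)
    also have "\<dots> > 0" using d k
      by (intro sum_pos2[of _ k]) (auto simp: less_imp_le)
    finally show ?thesis .
  qed
  then show ?thesis by (simp add: sym_pos_def_def matrix_transpose_mul matrix_mul_assoc)
qed

lemma sym_pos_def_sqrt_exists:
  assumes "sym_pos_def A"
  shows "\<exists>B. sym_pos_def B \<and> B ** B = A"
proof -
  obtain Q d where Q: "orthogonal_matrix Q" and A: "A = Q ** diag_matrix d ** transpose Q"
    and d: "\<And>i. d i > 0" using sym_pos_def_diagonalizable[OF assms] by blast
  let ?B = "Q ** diag_matrix (\<lambda>i. sqrt (d i)) ** transpose Q"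
  have "?B ** ?B = Q ** diag_matrix (\<lambda>i. sqrt (d i)) ** (transpose Q ** Q) ** diag_matrix (\<lambda>i. sqrt (d i)) ** transpose Q"
    by (simp only: matrix_mul_assoc)
  also have "\<dots> = Q ** (diag_matrix (\<lambda>i. sqrt (d i)) ** diag_matrix (\<lambda>i. sqrt (d i))) ** transpose Q"
    by (simp only: orthogonal_matrix_cancel[OF Q] matrix_mul_rid matrix_mul_assoc)
  also have "\<dots> = A" using d by (simp add: A less_imp_le)
  finally show ?thesis using sym_pos_def_orthogonal_conj[OF Q, of "\<lambda>i. sqrt (d i)"] d by auto
qed

text \<open>If \<open>B\<^sup>2 = C\<^sup>2\<close> and \<open>D = B - C\<close>, then \<open>B D + D C = 0\<close>; testing this on an eigenvector of \<open>D\<close>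
  shows that the eigenvalue vanishes.\<close>

lemma sym_pos_def_sqrt_unique:
  fixes B C :: "real^'n^'n"
  assumes B: "sym_pos_def B" and C: "sym_pos_def C" and eq: "B ** B = C ** C"
  shows "B = C"
proof -
  define D where "D = B - C"
  have D: "transpose D = D" using B C by (simp add: D_def sym_pos_def_def transpose_def vec_eq_iff)
  have BD: "B ** D + D ** C = 0"
    using eq by (simp add: D_def matrix_mult_diff_distrib)
  obtain Q d where Q: "orthogonal_matrix Q" and DQ: "D = Q ** diag_matrix d ** transpose Q"
    using symmetric_matrix_diagonalizable[OF D] by blast
  have "d i = 0" for i
  proof -
    let ?x = "Q *v axis i 1"
    have tx: "transpose Q *v ?x = axis i 1"
      by (simp add: matrix_vector_mul_assoc orthogonal_matrix_cancel[OF Q])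
    then have x0: "?x \<noteq> 0" by (metis axis_eq_0_iff matrix_vector_mult_0_right zero_neq_one)
    have "diag_matrix d *v axis i 1 = d i *\<^sub>R axis i 1"
      by (auto simp: diag_matrix_vector_mult vec_eq_iff axis_def)
    then have Dx: "D *v ?x = d i *\<^sub>R ?x"
      unfolding DQ matrix_vector_mul_assoc[symmetric] tx by (simp add: matrix_vector_mult_scaleR)
    have "0 = ?x \<bullet> ((B ** D + D ** C) *v ?x)" by (simp add: BD)
    also have "\<dots> = ?x \<bullet> (B *v (D *v ?x)) + ?x \<bullet> (D *v (C *v ?x))"
      by (simp only: matrix_vector_mult_add_rdistrib matrix_vector_mul_assoc[symmetric] inner_add_right)
    also have "?x \<bullet> (D *v (C *v ?x)) = (D *v ?x) \<bullet> (C *v ?x)"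
      using inner_transpose_mult[of D ?x "C *v ?x"] D by simp
    finally have "d i * (?x \<bullet> (B *v ?x) + ?x \<bullet> (C *v ?x)) = 0"
      by (simp add: Dx matrix_vector_mult_scaleR algebra_simps)
    moreover have "?x \<bullet> (B *v ?x) + ?x \<bullet> (C *v ?x) > 0"
      using B C x0 by (simp add: sym_pos_def_def add_pos_pos)
    ultimately show "d i = 0" by simp
  qed
  then have "diag_matrix d = 0" by (simp add: diag_matrix_def vec_eq_iff)
  then have "D = 0" using DQ by (simp add: matrix_matrix_mult_def vec_eq_iff)
  then show ?thesis by (simp add: D_def)
qed

lemma matrix_sqrt_unique:
  assumes "sym_pos_def B" "B ** B = A"
  shows "matrix_sqrt A = B"
  unfolding matrix_sqrt_def using assms sym_pos_def_sqrt_unique by (intro the_equality) auto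

lemma matrix_sqrt:
  assumes "sym_pos_def A"
  shows "sym_pos_def (matrix_sqrt A)" "matrix_sqrt A ** matrix_sqrt A = A"
  using sym_pos_def_sqrt_exists[OF assms] matrix_sqrt_unique by metis+

lemma sym_pos_def_det_pos:
  fixes A :: "real^'n^'n"
  assumes "sym_pos_def A"
  shows "det A > 0"
proof -
  obtain Q d where Q: "orthogonal_matrix Q" and A: "A = Q ** diag_matrix d ** transpose Q"
    and d: "\<And>i. d i > 0" using sym_pos_def_diagonalizable[OF assms] by blast
  have "det A = (det Q)\<^sup>2 * (\<Prod>i\<in>UNIV. d i)"
    by (simp add: A det_mul det_diag_matrix power2_eq_square)
  moreover have "(det Q)\<^sup>2 = 1" using det_orthogonal_matrix[OF Q] by auto
  ultimately show ?thesis using d by (simp add: prod_pos)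
qed

lemma sym_pos_def_invertible:
  fixes A :: "real^'n^'n"
  shows "sym_pos_def A \<Longrightarrow> invertible A"
  using sym_pos_def_det_pos[of A] by (simp add: invertible_det_nz)

lemma gram_eq:
  fixes Y :: "real^'p^'n"
  shows "x \<bullet> ((transpose Y ** Y) *v y) = (Y *v x) \<bullet> (Y *v y)"
  using inner_transpose_mult[of "transpose Y" x "Y *v y"] by (simp only: transpose_transpose matrix_vector_mul_assoc)

text \<open>The quadratic form at \<open>x\<close> is the squared length of \<open>Y x\<close>, and
  a nonzero determinant rules out a kernel. Thus one determinant condition decides everywhere below
  whether the root of the Gram matrix is meaningful.\<close>

lemma sym_pos_def_gram:
  fixes Y :: "real^'p^'n"
  assumes "det (transpose Y ** Y) \<noteq> 0"
  shows "sym_pos_def (transpose Y ** Y)"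
proof -
  have "0 < (Y *v x) \<bullet> (Y *v x)" if "x \<noteq> 0" for x
  proof -
    obtain B where B: "B ** (transpose Y ** Y) = mat 1"
      using assms invertible_det_nz invertible_def by metis
    have "Y *v x \<noteq> 0"
    proof
      assume "Y *v x = 0"
      then have "(B ** (transpose Y ** Y)) *v x = 0"
        by (simp only: matrix_vector_mul_assoc[symmetric] matrix_vector_mult_0_right)
      then show False using that by (simp add: B)
    qed
    then show ?thesis by simp
  qed
  then show ?thesis by (simp only: sym_pos_def_def matrix_transpose_mul gram_eq transpose_transpose simp_thms) simp
qed

text \<open>Polar decomposition \<open>A = (A R\<^sup>-\<^sup>1) R\<close> with \<open>R = (A\<^sup>T A)\<^sup>1\<^sup>/\<^sup>2\<close>, and then diagonalization of \<open>R\<close>.\<close>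

lemma singular_value_decomposition:
  fixes A :: "real^'n^'n"
  assumes "invertible A"
  obtains P Q d where "orthogonal_matrix P" "orthogonal_matrix Q" "\<And>i. d i > 0"
    "A = P ** diag_matrix d ** Q"
proof -
  have "det (transpose A ** A) \<noteq> 0" using assms by (simp add: det_mul invertible_det_nz)
  then have S: "sym_pos_def (transpose A ** A)" by (rule sym_pos_def_gram)
  define R where "R = matrix_sqrt (transpose A ** A)"
  have R: "sym_pos_def R" "R ** R = transpose A ** A" using matrix_sqrt[OF S] by (auto simp: R_def)
  have tR: "transpose R = R" using R by (simp add: sym_pos_def_def)
  obtain R' where R': "R ** R' = mat 1" "R' ** R = mat 1"
    using sym_pos_def_invertible[OF R(1)] by (auto simp: invertible_def)
  have tR': "transpose R' = R'"
    by (metis R' matrix_mul_assoc matrix_mul_lid matrix_mul_rid matrix_transpose_mul tR transpose_mat)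
  have "transpose (A ** R') ** (A ** R') = R' ** (R ** R) ** R'"
    by (simp add: matrix_transpose_mul tR' R matrix_mul_assoc)
  also have "\<dots> = mat 1" by (metis R' matrix_mul_assoc matrix_mul_lid)
  finally have O: "orthogonal_matrix (A ** R')" by (simp add: orthogonal_matrix)
  obtain Q d where Q: "orthogonal_matrix Q" and RQ: "R = Q ** diag_matrix d ** transpose Q"
    and d: "\<And>i. d i > 0" using sym_pos_def_diagonalizable[OF R(1)] by blast
  have "A = A ** R' ** R" by (metis R'(2) matrix_mul_assoc matrix_mul_rid)
  also have "\<dots> = (A ** R' ** Q) ** diag_matrix d ** transpose Q"
    by (simp add: RQ matrix_mul_assoc)
  finally show thesis
    using that[of "A ** R' ** Q" "transpose Q" d] O Q d
    by (simp add: orthogonal_matrix_mul orthogonal_matrix_transpose)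
qed

subsection \<open>Linear substitutions in Lebesgue integrals over matrices\<close>

lemma nn_integral_lborel_translate:
  fixes f :: "'a::euclidean_space \<Rightarrow> ennreal"
  assumes [measurable]: "f \<in> borel_measurable borel"
  shows "(\<integral>\<^sup>+x. f (a + x) \<partial>lborel) = (\<integral>\<^sup>+x. f x \<partial>lborel)"
proof -
  have "(\<integral>\<^sup>+x. f x \<partial>lborel) = (\<integral>\<^sup>+x. f x \<partial>distr lborel borel ((+) a))"
    by (simp add: lborel_distr_plus)
  also have "\<dots> = (\<integral>\<^sup>+x. f (a + x) \<partial>lborel)" by (rule nn_integral_distr) auto
  finally show ?thesis by simp
qed

text \<open>Both \<open>lborel\<close> and its image under \<open>L\<close> are translation invariant, so Fubini shows that
  they are proportional; they agree on the unit ball.\<close>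

lemma nn_integral_lborel_isometry:
  fixes L :: "'a::euclidean_space \<Rightarrow> 'a" and f :: "'a \<Rightarrow> ennreal"
  assumes L: "linear L" and norm: "\<And>x. norm (L x) = norm x"
    and [measurable]: "f \<in> borel_measurable borel"
  shows "(\<integral>\<^sup>+x. f (L x) \<partial>lborel) = (\<integral>\<^sup>+x. f x \<partial>lborel)"
proof -
  interpret L: linear L by fact
  have "inj L" using norm L.inj_iff_eq_0 by (metis norm_eq_zero)
  then have "surj L" using L linear_injective_imp_surjective by blast
  then obtain M where M: "\<And>x. L (M x) = x" by (metis surj_def)
  have [measurable]: "L \<in> borel_measurable borel"
    using L by (intro borel_measurable_continuous_onI linear_continuous_on) (simp add: linear_conv_bounded_linear)
  \<comment> \<open>A weight that sees only the norm and has finite positive integral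
    \<open>U\<close>, so that \<open>U\<close> can be cancelled at the end.\<close>
  define u where "u = (indicator (cball 0 1) :: 'a \<Rightarrow> ennreal)"
  have [measurable]: "u \<in> borel_measurable borel" unfolding u_def by (intro borel_measurable_indicator) simp
  have u_norm: "u x = u y" if "norm x = norm y" for x y using that by (simp add: u_def indicator_def)
  define U where "U = (\<integral>\<^sup>+x. u x \<partial>lborel)"
  have U: "U = emeasure lborel (cball 0 1 :: 'a set)" by (simp add: U_def u_def)
  have "U \<noteq> \<infinity>" unfolding U using emeasure_lborel_cball_finite[of "0::'a" 1] by auto
  moreover have "U \<noteq> 0"
  proof
    assume "U = 0"
    then have "measure lborel (cball 0 1 :: 'a set) = 0" by (simp add: U measure_def)
    then show False by (simp add: content_cball_eq_0_iff)
  qed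
  moreover have "U * (\<integral>\<^sup>+x. f (L x) \<partial>lborel) = U * (\<integral>\<^sup>+x. f x \<partial>lborel)"
  proof -
    have "U * (\<integral>\<^sup>+y. f (L y) \<partial>lborel) = (\<integral>\<^sup>+x. (\<integral>\<^sup>+y. u x * f (L y) \<partial>lborel) \<partial>lborel)"
      by (simp add: U_def nn_integral_cmult nn_integral_multc)
    also have "\<dots> = (\<integral>\<^sup>+x. (\<integral>\<^sup>+y. u x * f (L (M x + y)) \<partial>lborel) \<partial>lborel)"
      by (intro nn_integral_cong nn_integral_lborel_translate[symmetric]) simp
    also have "\<dots> = (\<integral>\<^sup>+x. (\<integral>\<^sup>+y. u x * f (x + L y) \<partial>lborel) \<partial>lborel)"
      by (simp add: L.add M)
    also have "\<dots> = (\<integral>\<^sup>+y. (\<integral>\<^sup>+x. u x * f (x + L y) \<partial>lborel) \<partial>lborel)"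
      by (rule lborel_pair.Fubini') simp
    also have "\<dots> = (\<integral>\<^sup>+y. (\<integral>\<^sup>+x. u (- L y + x) * f ((- L y + x) + L y) \<partial>lborel) \<partial>lborel)"
      by (intro nn_integral_cong nn_integral_lborel_translate[symmetric]) simp
    also have "\<dots> = (\<integral>\<^sup>+y. (\<integral>\<^sup>+x. u (- L y + x) * f x \<partial>lborel) \<partial>lborel)" by simp
    also have "\<dots> = (\<integral>\<^sup>+x. (\<integral>\<^sup>+y. u (- L y + x) * f x \<partial>lborel) \<partial>lborel)"
      by (rule lborel_pair.Fubini') simp
    \<comment> \<open>Norms are preserved, so \<open>u\<close> agrees at
      \<open>x - L y = L (M x - y)\<close> and at \<open>y - M x\<close>; the latter is a mere
      translate in \<open>y\<close>, with integral \<open>U\<close>.\<close>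
    also have "\<dots> = (\<integral>\<^sup>+x. (\<integral>\<^sup>+y. u (- M x + y) * f x \<partial>lborel) \<partial>lborel)"
    proof -
      have "norm (- L y + x) = norm (- M x + y)" for x y
      proof -
        have "- L y + x = L (M x - y)" by (simp add: L.diff M)
        then show ?thesis using norm by (simp add: norm_minus_commute)
      qed
      then have "u (- L y + x) = u (- M x + y)" for x y by (rule u_norm)
      then show ?thesis by simp
    qed
    also have "\<dots> = (\<integral>\<^sup>+x. U * f x \<partial>lborel)"
    proof (rule nn_integral_cong)
      fix x
      have "(\<integral>\<^sup>+y. u (- M x + y) * f x \<partial>lborel) = (\<integral>\<^sup>+y. u (- M x + y) \<partial>lborel) * f x"
        by (rule nn_integral_multc) simp
      also have "(\<integral>\<^sup>+y. u (- M x + y) \<partial>lborel) = U"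
        unfolding U_def by (rule nn_integral_lborel_translate) simp
      finally show "(\<integral>\<^sup>+y. u (- M x + y) * f x \<partial>lborel) = U * f x" .
    qed
    also have "\<dots> = U * (\<integral>\<^sup>+x. f x \<partial>lborel)" by (simp add: nn_integral_cmult)
    finally show ?thesis .
  qed
  ultimately show ?thesis by (simp add: ennreal_mult_cancel_left)
qed

section \<open>Measurability of matrix operations\<close>

lemma continuous_on_matrix_mult:
  "continuous_on S (\<lambda>x. fst x ** snd x :: real^'q^'m)"
  unfolding matrix_matrix_mult_def by (intro continuous_intros continuous_on_fst continuous_on_snd)

lemma borel_measurable_matrix_mult [measurable (raw)]:
  fixes f :: "'a \<Rightarrow> real^'k^'m" and g :: "'a \<Rightarrow> real^'q^'k"
  assumes "f \<in> borel_measurable M" "g \<in> borel_measurable M"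
  shows "(\<lambda>x. f x ** g x) \<in> borel_measurable M"
  by (rule borel_measurable_continuous_Pair[OF assms continuous_on_matrix_mult])

lemma borel_measurable_transpose [measurable (raw)]:
  fixes f :: "'a \<Rightarrow> real^'k^'m"
  assumes "f \<in> borel_measurable M"
  shows "(\<lambda>x. transpose (f x)) \<in> borel_measurable M"
proof -
  have "continuous_on UNIV (transpose :: real^'k^'m \<Rightarrow> _)"
    unfolding transpose_def by (intro continuous_intros)
  from borel_measurable_continuous_on[OF this assms] show ?thesis .
qed

lemma borel_measurable_matrix_vector_mult [measurable (raw)]:
  fixes f :: "'a \<Rightarrow> real^'k^'m" and g :: "'a \<Rightarrow> real^'k"
  assumes "f \<in> borel_measurable M" "g \<in> borel_measurable M"
  shows "(\<lambda>x. f x *v g x) \<in> borel_measurable M"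
proof -
  have "continuous_on UNIV (\<lambda>x. fst x *v snd x :: real^'m)"
    unfolding matrix_vector_mult_def by (intro continuous_intros continuous_on_fst continuous_on_snd)
  from borel_measurable_continuous_Pair[OF assms this] show ?thesis .
qed

lemma borel_measurable_vec_nth [measurable (raw)]:
  fixes f :: "'a \<Rightarrow> 'b::second_countable_topology^'m"
  assumes "f \<in> borel_measurable M"
  shows "(\<lambda>x. f x $ i) \<in> borel_measurable M"
  by (rule borel_measurable_continuous_on[OF _ assms]) (intro continuous_intros)

lemma continuous_on_det: "continuous_on S (det :: real^'k^'k \<Rightarrow> real)"
  unfolding det_def by (intro continuous_intros)

lemma borel_measurable_det [measurable (raw)]:
  fixes f :: "'a \<Rightarrow> real^'k^'k"
  assumes "f \<in> borel_measurable M"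
  shows "(\<lambda>x. det (f x)) \<in> borel_measurable M"
  by (rule borel_measurable_continuous_on[OF continuous_on_det assms])

section \<open>Jacobians of matrix multiplication\<close>

lemma bij_betw_matrix_Basis:
  "bij_betw (\<lambda>(i, j). axis i (axis j 1)) (UNIV :: ('n \<times> 'p) set) (Basis :: (real^'p^'n) set)"
proof (rule bij_betwI')
  show "(\<lambda>(i, j). axis i (axis j 1)) x = (\<lambda>(i, j). axis i (axis j (1::real))) y \<longleftrightarrow> x = y" for x y :: "'n \<times> 'p"
    by (cases x; cases y) (auto simp: axis_eq_axis axis_eq_0_iff)
  show "(\<lambda>(i, j). axis i (axis j (1::real))) x \<in> Basis" for x :: "'n \<times> 'p"
    by (cases x) (auto simp: axis_in_Basis_iff)
  show "\<exists>x\<in>UNIV. b = (\<lambda>(i, j). axis i (axis j (1::real))) x" if "b \<in> Basis" for b :: "real^'p^'n"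
    using that by (auto simp: Basis_vec_def)
qed

lemma prod_matrix_Basis:
  fixes F :: "real^'p^'n \<Rightarrow> 'a::comm_monoid_mult"
  shows "(\<Prod>b\<in>Basis. F b) = (\<Prod>i\<in>UNIV. \<Prod>j\<in>UNIV. F (axis i (axis j 1)))"
proof -
  have "(\<Prod>b\<in>Basis. F b) = (\<Prod>x\<in>UNIV. F ((\<lambda>(i, j). axis i (axis j 1)) x))"
    by (rule prod.reindex_bij_betw[OF bij_betw_matrix_Basis, symmetric])
  also have "\<dots> = (\<Prod>(i, j)\<in>UNIV \<times> UNIV. F (axis i (axis j 1)))" by (simp add: split_def)
  finally show ?thesis by (simp add: prod.cartesian_product)
qed

lemma inner_matrix_Basis: "Y \<bullet> axis i (axis j 1) = Y $ i $ j" for Y :: "real^'p^'n"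
  by (simp add: inner_axis)

lemma nn_integral_lborel_matrix_scale:
  fixes f :: "real^'p^'n \<Rightarrow> ennreal"
  assumes [measurable]: "f \<in> borel_measurable borel" and c: "\<And>i j. c i j \<noteq> 0"
  shows "(\<integral>\<^sup>+Y. f Y \<partial>lborel)
    = ennreal (\<Prod>i\<in>UNIV. \<Prod>j\<in>UNIV. \<bar>c i j\<bar>) * (\<integral>\<^sup>+Y. f (\<chi> i j. c i j * Y $ i $ j) \<partial>lborel)"
proof -
  \<comment> \<open>\<open>lborel_affine_euclidean\<close> indexes its factors by basis vectors;
    \<open>k\<close> recovers \<open>c i j\<close> from the matrix whose only nonzero entry is a 1
    at \<open>(i, j)\<close>.\<close>
  define k :: "real^'p^'n \<Rightarrow> real" where "k b = (\<Sum>i\<in>UNIV. \<Sum>j\<in>UNIV. c i j * b $ i $ j)" for b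
  have k: "k (axis i (axis j 1)) = c i j" for i j
  proof -
    have "c i' j' * axis i (axis j 1) $ i' $ j' = (if i' = i then if j' = j then c i' j' else 0 else 0)" for i' j'
      by (simp add: axis_def)
    then have "k (axis i (axis j 1)) = (\<Sum>i'\<in>UNIV. if i' = i then (\<Sum>j'\<in>UNIV. if j' = j then c i' j' else 0) else 0)"
      unfolding k_def by (intro sum.cong) auto
    then show ?thesis by simp
  qed
  have kn: "k b \<noteq> 0" if "b \<in> Basis" for b
  proof -
    from that obtain i j where "b = axis i (axis j 1)" by (auto simp: Basis_vec_def)
    then show ?thesis using k c by simp
  qed
  define T where "T Y = (\<chi> i j. c i j * Y $ i $ j)" for Y :: "real^'p^'n"
  have T: "0 + (\<Sum>b\<in>Basis. (k b * (Y \<bullet> b)) *\<^sub>R b) = T Y" for Y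
  proof (rule euclidean_eqI)
    fix b :: "real^'p^'n" assume b: "b \<in> Basis"
    then obtain i j where ij: "b = axis i (axis j 1)" by (auto simp: Basis_vec_def)
    show "(0 + (\<Sum>b\<in>Basis. (k b * (Y \<bullet> b)) *\<^sub>R b)) \<bullet> b = T Y \<bullet> b"
      using b k by (simp add: inner_add_left) (simp add: ij inner_matrix_Basis T_def)
  qed
  have [measurable]: "T \<in> borel_measurable borel"
    unfolding T_def by (intro borel_measurable_continuous_onI continuous_intros)
  have "lborel = density (distr lborel borel T) (\<lambda>_. ennreal (\<Prod>b\<in>Basis. \<bar>k b\<bar>))"
    by (rule lborel_affine_euclidean[where c = k and t = 0, unfolded T]) (rule kn)
  from arg_cong[OF this, of "\<lambda>M. integral\<^sup>N M f"]
  have "(\<integral>\<^sup>+Y. f Y \<partial>lborel) = (\<integral>\<^sup>+Y. f Y \<partial>density (distr lborel borel T) (\<lambda>_. \<Prod>b\<in>Basis. \<bar>k b\<bar>))" .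
  also have "\<dots> = (\<integral>\<^sup>+Y. ennreal (\<Prod>b\<in>Basis. \<bar>k b\<bar>) * f (T Y) \<partial>lborel)"
    by (simp add: nn_integral_density nn_integral_distr)
  also have "\<dots> = ennreal (\<Prod>b\<in>Basis. \<bar>k b\<bar>) * (\<integral>\<^sup>+Y. f (T Y) \<partial>lborel)"
    by (rule nn_integral_cmult) simp
  also have "(\<Prod>b\<in>Basis. \<bar>k b\<bar>) = (\<Prod>i\<in>UNIV. \<Prod>j\<in>UNIV. \<bar>c i j\<bar>)"
    by (simp add: prod_matrix_Basis k)
  finally show ?thesis by (simp add: T_def)
qed

lemma norm_matrix_sq: "(norm Y)\<^sup>2 = (\<Sum>i\<in>UNIV. (norm (Y $ i))\<^sup>2)" for Y :: "real^'p^'n"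
  by (simp add: norm_vec_def L2_set_def sum_nonneg)

lemma norm_matrix_transpose: "norm (transpose Y) = norm Y" for Y :: "real^'p^'n"
proof -
  have "(norm (transpose Y))\<^sup>2 = (\<Sum>i\<in>UNIV. \<Sum>j\<in>UNIV. (Y $ j $ i)\<^sup>2)"
    by (simp add: norm_vec_def L2_set_def sum_nonneg transpose_def)
  also have "\<dots> = (\<Sum>j\<in>UNIV. \<Sum>i\<in>UNIV. (Y $ j $ i)\<^sup>2)" by (rule sum.swap)
  also have "\<dots> = (norm Y)\<^sup>2" by (simp add: norm_vec_def L2_set_def sum_nonneg)
  finally show ?thesis by simp
qed

text \<open>The norm on this type is the Frobenius norm, and \<open>P\<close> acts on each column
  separately; the columns become accessible as rows of the transpose.\<close>

lemma norm_matrix_mult_orthogonal_left: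
  fixes Y :: "real^'p^'n"
  assumes "orthogonal_matrix P"
  shows "norm (P ** Y) = norm Y"
proof -
  have "transpose (P ** Y) $ i = P *v (transpose Y $ i)" for i
    by (simp add: matrix_matrix_mult_def matrix_vector_mult_def transpose_def vec_eq_iff)
  moreover have "norm (P *v x) = norm x" for x
    using assms orthogonal_transformation_matrix[of "(*v) P"] orthogonal_transformation_norm[of "(*v) P"] by simp
  ultimately have "(norm (transpose (P ** Y)))\<^sup>2 = (norm (transpose Y))\<^sup>2" by (simp add: norm_matrix_sq)
  then show ?thesis by (simp add: norm_matrix_transpose)
qed

lemma norm_matrix_mult_orthogonal_right:
  fixes Y :: "real^'p^'n"
  assumes "orthogonal_matrix P"
  shows "norm (Y ** P) = norm Y"
  using norm_matrix_mult_orthogonal_left[of "transpose P" "transpose Y"] assms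
  by (metis matrix_transpose_mul norm_matrix_transpose orthogonal_matrix_transpose)

lemma linear_matrix_mult_left: "linear (\<lambda>Y. A ** Y :: real^'p^'n)"
  by (simp add: linear_iff vec_eq_iff matrix_matrix_mult_def sum_distrib_left algebra_simps sum.distrib)

lemma linear_matrix_mult_right: "linear (\<lambda>Y. Y ** A :: real^'p^'n)"
  by (simp add: linear_iff vec_eq_iff matrix_matrix_mult_def sum_distrib_left algebra_simps sum.distrib)

lemma abs_det_svd:
  assumes "orthogonal_matrix P" "orthogonal_matrix Q" "\<And>i. d i > 0"
  shows "\<bar>det (P ** diag_matrix d ** Q)\<bar> = (\<Prod>i\<in>UNIV. \<bar>d i\<bar>)"
proof -
  have "\<bar>det P\<bar> = 1" "\<bar>det Q\<bar> = 1" using det_orthogonal_matrix assms by fastforce+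
  then show ?thesis by (simp add: det_mul abs_mult det_diag_matrix abs_prod)
qed

text \<open>The orthogonal factors of the singular value decomposition act as isometries. The
  diagonal one scales column \<open>j\<close> by \<open>d j\<close> in each of the
  \<open>CARD('n)\<close> rows, which is where the exponent comes from; for left multiplication it
  is the number of columns instead.\<close>

lemma nn_integral_lborel_matrix_mult_right:
  fixes f :: "real^'p^'n \<Rightarrow> ennreal"
  assumes A: "invertible A" and [measurable]: "f \<in> borel_measurable borel"
  shows "(\<integral>\<^sup>+Y. f Y \<partial>lborel) = ennreal (\<bar>det A\<bar> ^ CARD('n)) * (\<integral>\<^sup>+Y. f (Y ** A) \<partial>lborel)"
proof -
  obtain P Q d where P: "orthogonal_matrix P" and Q: "orthogonal_matrix Q" and d: "\<And>i. d i > 0"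
    and AP: "A = P ** diag_matrix d ** Q" using singular_value_decomposition[OF A] by blast
  have diag: "Y ** diag_matrix d = (\<chi> i j. d j * Y $ i $ j)" for Y :: "real^'p^'n"
    by (simp add: diag_matrix_def matrix_matrix_mult_def vec_eq_iff if_distrib[of "\<lambda>x. _ * x"] mult.commute cong: if_cong)
  have "(\<integral>\<^sup>+Y. f (Y ** A) \<partial>lborel) = (\<integral>\<^sup>+Y. f (Y ** P ** diag_matrix d ** Q) \<partial>lborel)"
    by (simp add: AP matrix_mul_assoc)
  also have "\<dots> = (\<integral>\<^sup>+Y. f (Y ** diag_matrix d ** Q) \<partial>lborel)"
    by (rule nn_integral_lborel_isometry[where f = "\<lambda>Y. f (Y ** diag_matrix d ** Q)"
      and L = "\<lambda>Y. Y ** P", OF linear_matrix_mult_right norm_matrix_mult_orthogonal_right[OF P]]) simp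
  finally have 1: "(\<integral>\<^sup>+Y. f (Y ** A) \<partial>lborel) = (\<integral>\<^sup>+Y. f (Y ** diag_matrix d ** Q) \<partial>lborel)" .
  have "(\<integral>\<^sup>+Y. f Y \<partial>lborel) = (\<integral>\<^sup>+Y. f (Y ** Q) \<partial>lborel)"
    by (rule nn_integral_lborel_isometry[where f = f and L = "\<lambda>Y. Y ** Q", symmetric,
      OF linear_matrix_mult_right norm_matrix_mult_orthogonal_right[OF Q]]) simp
  also have "\<dots> = ennreal (\<Prod>i\<in>(UNIV::'n set). \<Prod>j\<in>UNIV. \<bar>d j\<bar>) * (\<integral>\<^sup>+Y. f ((\<chi> i j. d j * Y $ i $ j) ** Q) \<partial>lborel)"
    using d by (intro nn_integral_lborel_matrix_scale[where f = "\<lambda>Y. f (Y ** Q)" and c = "\<lambda>i j. d j"]) (auto simp: less_imp_neq[symmetric])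
  also have "(\<Prod>i\<in>(UNIV::'n set). \<Prod>j\<in>UNIV. \<bar>d j\<bar>) = \<bar>det A\<bar> ^ CARD('n)"
    unfolding AP using abs_det_svd[OF P Q d] by simp
  finally show ?thesis unfolding 1 by (simp add: diag)
qed

lemma nn_integral_lborel_matrix_mult_left:
  fixes f :: "real^'p^'n \<Rightarrow> ennreal"
  assumes A: "invertible A" and [measurable]: "f \<in> borel_measurable borel"
  shows "(\<integral>\<^sup>+Y. f Y \<partial>lborel) = ennreal (\<bar>det A\<bar> ^ CARD('p)) * (\<integral>\<^sup>+Y. f (A ** Y) \<partial>lborel)"
proof -
  obtain P Q d where P: "orthogonal_matrix P" and Q: "orthogonal_matrix Q" and d: "\<And>i. d i > 0"
    and AP: "A = P ** diag_matrix d ** Q" using singular_value_decomposition[OF A] by blast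
  have diag: "diag_matrix d ** Y = (\<chi> i j. d i * Y $ i $ j)" for Y :: "real^'p^'n"
    by (simp add: diag_matrix_def matrix_matrix_mult_def vec_eq_iff if_distrib[of "\<lambda>x. x * _"] cong: if_cong)
  have "(\<integral>\<^sup>+Y. f (A ** Y) \<partial>lborel) = (\<integral>\<^sup>+Y. f (P ** (diag_matrix d ** (Q ** Y))) \<partial>lborel)"
    by (simp add: AP matrix_mul_assoc)
  also have "\<dots> = (\<integral>\<^sup>+Y. f (P ** (diag_matrix d ** Y)) \<partial>lborel)"
    by (rule nn_integral_lborel_isometry[where f = "\<lambda>Y. f (P ** (diag_matrix d ** Y))"
      and L = "\<lambda>Y. Q ** Y", OF linear_matrix_mult_left norm_matrix_mult_orthogonal_left[OF Q]]) simp
  finally have 1: "(\<integral>\<^sup>+Y. f (A ** Y) \<partial>lborel) = (\<integral>\<^sup>+Y. f (P ** (diag_matrix d ** Y)) \<partial>lborel)" .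
  have "(\<integral>\<^sup>+Y. f Y \<partial>lborel) = (\<integral>\<^sup>+Y. f (P ** Y) \<partial>lborel)"
    by (rule nn_integral_lborel_isometry[where f = f and L = "\<lambda>Y. P ** Y", symmetric,
      OF linear_matrix_mult_left norm_matrix_mult_orthogonal_left[OF P]]) simp
  also have "\<dots> = ennreal (\<Prod>i\<in>UNIV. \<Prod>j\<in>(UNIV::'p set). \<bar>d i\<bar>) * (\<integral>\<^sup>+Y. f (P ** (\<chi> i j. d i * Y $ i $ j)) \<partial>lborel)"
    using d by (intro nn_integral_lborel_matrix_scale[where f = "\<lambda>Y. f (P ** Y)" and c = "\<lambda>i j. d i"]) (auto simp: less_imp_neq[symmetric])
  also have "(\<Prod>i\<in>UNIV. \<Prod>j\<in>(UNIV::'p set). \<bar>d i\<bar>) = \<bar>det A\<bar> ^ CARD('p)"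
    unfolding AP using abs_det_svd[OF P Q d] by (simp add: prod_power_distrib)
  finally show ?thesis unfolding 1 by (simp add: diag)
qed

subsection \<open>Gram determinants and the standard normal matrix\<close>

text \<open>The squared volume of the parallelepiped spanned by the columns of \<open>Y\<close>;
  nonzero exactly for full column rank.\<close>

definition gram_det :: "real^'p^'n \<Rightarrow> real" where
  "gram_det Y = det (transpose Y ** Y)"

lemma borel_measurable_gram_det [measurable (raw)]:
  fixes f :: "'a \<Rightarrow> real^'p^'n"
  assumes [measurable]: "f \<in> borel_measurable M"
  shows "(\<lambda>x. gram_det (f x)) \<in> borel_measurable M"
  unfolding gram_det_def by measurable

lemma det_eq_0_kernel:
  fixes A :: "real^'n^'n"
  assumes "det A = 0"
  obtains x where "x \<noteq> 0" "A *v x = 0"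
proof -
  have "\<not> invertible A" using assms by (simp add: invertible_det_nz)
  then have "\<not> (\<forall>x. A *v x = 0 \<longrightarrow> x = 0)"
    by (simp only: invertible_left_inverse matrix_left_invertible_ker not_False_eq_True)
  with that show thesis by blast
qed

text \<open>The determinant is a polynomial in \<open>s\<close>. It is not the zero polynomial,
  because \<open>C + s I\<close> is injective as soon as \<open>s\<close> exceeds an operator bound
  \<open>K\<close> of \<open>C\<close>; hence the evaluation at \<open>K + 1\<close>.\<close>

lemma finite_negative_eigenvalues:
  fixes C :: "real^'n^'n"
  shows "finite {s. det (C + s *\<^sub>R mat 1) = 0}"
proof -
  define P where "P = (\<Sum>\<pi>\<in>{\<pi>. \<pi> permutes (UNIV::'n set)}.
    smult (of_int (sign \<pi>)) (\<Prod>i\<in>UNIV. [:C $ i $ \<pi> i, if i = \<pi> i then 1 else 0:]))"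
  have P: "poly P s = det (C + s *\<^sub>R mat 1)" for s
    by (simp add: P_def det_def poly_sum poly_prod mat_def if_distrib[of "\<lambda>x. s * x"] cong: if_cong)
  obtain K where K: "K > 0" "\<And>x. norm (C *v x) \<le> K * norm x"
    using linear_bounded_pos[of "(*v) C"] matrix_vector_mul_linear[of C] by blast
  have "poly P (K + 1) \<noteq> 0"
  proof
    assume "poly P (K + 1) = 0"
    then obtain x where x: "x \<noteq> 0" "(C + (K + 1) *\<^sub>R mat 1) *v x = 0"
      unfolding P using det_eq_0_kernel by blast
    have "C *v x = - ((K + 1) *\<^sub>R x)"
      using x(2) by (simp add: matrix_vector_mult_add_rdistrib eq_neg_iff_add_eq_0 flip: scaleR_matrix_vector_assoc)
    then have "(K + 1) * norm x \<le> K * norm x" using K(2)[of x] K(1) by simp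
    then show False using x(1) by simp
  qed
  then have "P \<noteq> 0" by auto
  then have "finite {s. poly P s = 0}" by (rule poly_roots_finite)
  then show ?thesis by (simp add: P)
qed

text \<open>If \<open>E\<close> has orthonormal columns, then the Gram determinant of \<open>Y + s E\<close> vanishes only when
  \<open>- s\<close> is an eigenvalue of \<open>E\<^sup>T Y\<close>. By Fubini, almost every translate of the rank-deficient set,
  hence the set itself, is null.\<close>

lemma AE_gram_det_nonzero:
  assumes le: "CARD('p) \<le> CARD('n)"
  shows "AE Y in (lborel :: (real^'p^'n) measure). gram_det Y \<noteq> 0"
proof -
  obtain h :: "'p \<Rightarrow> 'n" where h: "inj h"
    using card_le_inj[of "UNIV::'p set" "UNIV::'n set"] le by auto
  define E :: "real^'p^'n" where "E = (\<chi> i j. if i = h j then 1 else 0)"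
  have "(\<Sum>k\<in>UNIV. (if k = h i then 1 else 0) * (if k = h j then 1 else 0)) = (if i = j then 1 else (0::real))" for i j
  proof -
    have "(\<Sum>k\<in>UNIV. (if k = h i then 1 else 0) * (if k = h j then 1 else (0::real)))
      = (\<Sum>k\<in>UNIV. if k = h i then (if h i = h j then 1 else 0) else 0)"
      by (intro sum.cong) auto
    then show ?thesis using h by (simp add: inj_eq)
  qed
  then have E: "transpose E ** E = mat 1"
    by (simp add: E_def transpose_def matrix_matrix_mult_def mat_def vec_eq_iff)
  define N where "N = {Y :: real^'p^'n. gram_det Y = 0}"
  have N[measurable]: "N \<in> sets borel" unfolding N_def by measurable
  have sub: "{s. s *\<^sub>R E + Y \<in> N} \<subseteq> {s. det (transpose E ** Y + s *\<^sub>R mat 1) = 0}" for Y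
  proof safe
    fix s assume "s *\<^sub>R E + Y \<in> N"
    then obtain x where x: "x \<noteq> 0" and "(transpose (s *\<^sub>R E + Y) ** (s *\<^sub>R E + Y)) *v x = 0"
      unfolding N_def gram_det_def using det_eq_0_kernel by blast
    then have "(s *\<^sub>R E + Y) *v x = 0" using gram_eq[of x "s *\<^sub>R E + Y" x] by simp
    then have "transpose E *v (s *\<^sub>R (E *v x) + Y *v x) = 0"
      by (simp only: matrix_vector_mult_add_rdistrib scaleR_matrix_vector_assoc[symmetric] matrix_vector_mult_0_right)
    then have "s *\<^sub>R ((transpose E ** E) *v x) + (transpose E ** Y) *v x = 0"
      by (simp only: matrix_vector_right_distrib matrix_vector_mult_scaleR matrix_vector_mul_assoc)
    then have z: "(transpose E ** Y + s *\<^sub>R mat 1) *v x = 0"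
      by (simp add: E matrix_vector_mult_add_rdistrib add.commute flip: scaleR_matrix_vector_assoc)
    show "det (transpose E ** Y + s *\<^sub>R mat 1) = 0"
    proof (rule ccontr)
      assume "det (transpose E ** Y + s *\<^sub>R mat 1) \<noteq> 0"
      then obtain B where "B ** (transpose E ** Y + s *\<^sub>R mat 1) = mat 1"
        using invertible_det_nz invertible_def by metis
      then have "x = B *v ((transpose E ** Y + s *\<^sub>R mat 1) *v x)"
        by (metis matrix_vector_mul_assoc matrix_vector_mul_lid)
      then show False using x z by simp
    qed
  qed
  have 0: "(\<integral>\<^sup>+s. indicator N (s *\<^sub>R E + Y) \<partial>lborel) = 0" for Y
  proof -
    have "finite {s. s *\<^sub>R E + Y \<in> N}" using sub finite_negative_eigenvalues finite_subset by blast
    then have "{s. s *\<^sub>R E + Y \<in> N} \<in> null_sets lborel" by (rule finite_imp_null_set_lborel)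
    moreover have "(\<integral>\<^sup>+s. indicator N (s *\<^sub>R E + Y) \<partial>lborel) = (\<integral>\<^sup>+s. indicator {s. s *\<^sub>R E + Y \<in> N} s \<partial>lborel)"
      by (simp add: indicator_def)
    ultimately show ?thesis by (simp add: null_setsD1 null_setsD2)
  qed
  \<comment> \<open>The line has infinite length, so a constant integrates to 0 over it only if it
    is 0.\<close>
  have "emeasure lborel N * \<infinity> = (\<integral>\<^sup>+(s::real). emeasure lborel N \<partial>lborel)" by simp
  also have "\<dots> = (\<integral>\<^sup>+(s::real). (\<integral>\<^sup>+Y. indicator N (s *\<^sub>R E + Y) \<partial>lborel) \<partial>lborel)"
    by (subst nn_integral_lborel_translate) auto
  also have "\<dots> = (\<integral>\<^sup>+Y. (\<integral>\<^sup>+s. indicator N (s *\<^sub>R E + Y) \<partial>lborel) \<partial>lborel)"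
    by (rule lborel_pair.Fubini') measurable
  also have "\<dots> = 0" by (simp add: 0)
  finally have "emeasure lborel N = 0" by (simp add: ennreal_mult_eq_top_iff)
  then have "N \<in> null_sets lborel" by auto
  then show ?thesis by (subst AE_iff_null) (auto simp: N_def)
qed

section \<open>Lebesgue density of the standard normal matrix\<close>

lemma PiM_std_normal_eq_density:
  "(\<Pi>\<^sub>M k\<in>(UNIV::'i::finite set). std_normal_distribution)
    = density (\<Pi>\<^sub>M k\<in>UNIV. lborel) (\<lambda>z. \<Prod>k\<in>UNIV. ennreal (std_normal_density (z k)))"
    (is "?L = ?R")
proof -
  interpret L: product_sigma_finite "\<lambda>_::'i. lborel :: real measure" by standard
  interpret P: prob_space std_normal_distribution by (rule prob_space_normal_density) simp
  interpret S: product_sigma_finite "\<lambda>_::'i. std_normal_distribution" by standard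
  have "?R = ?L"
  proof (rule S.PiM_eqI)
    show "sets ?R = sets ?L"
      by (simp cong: sets_PiM_cong)
  next
    fix A :: "'i \<Rightarrow> real set" assume "\<And>i. i \<in> UNIV \<Longrightarrow> A i \<in> sets std_normal_distribution"
    then have A[measurable]: "A i \<in> sets borel" for i by simp
    have "emeasure ?R (Pi\<^sub>E UNIV A)
      = (\<integral>\<^sup>+z. (\<Prod>k\<in>UNIV. ennreal (std_normal_density (z k))) * indicator (Pi\<^sub>E UNIV A) z \<partial>(\<Pi>\<^sub>M k\<in>UNIV. lborel))"
      by (rule emeasure_density) (auto intro!: sets_PiM_I_finite)
    also have "\<dots> = (\<integral>\<^sup>+z. (\<Prod>k\<in>UNIV. ennreal (std_normal_density (z k)) * indicator (A k) (z k)) \<partial>(\<Pi>\<^sub>M k\<in>UNIV. lborel))"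
    proof (rule nn_integral_cong)
      fix z :: "'i \<Rightarrow> real"
      have "(indicator (Pi\<^sub>E UNIV A) z :: ennreal) = (\<Prod>k\<in>UNIV. indicator (A k) (z k))"
      proof (cases "z \<in> Pi\<^sub>E UNIV A")
        case False
        then obtain k where "z k \<notin> A k" by auto
        then have "(\<Prod>k\<in>UNIV. indicator (A k) (z k)) = (0::ennreal)"
          by (intro prod_zero bexI[of _ k]) auto
        with False show ?thesis by simp
      next
        case True
        then have "indicator (A k) (z k) = (1::ennreal)" for k by (auto simp: PiE_iff)
        with True show ?thesis by simp
      qed
      then show "(\<Prod>k\<in>UNIV. ennreal (std_normal_density (z k))) * indicator (Pi\<^sub>E UNIV A) z
        = (\<Prod>k\<in>UNIV. ennreal (std_normal_density (z k)) * indicator (A k) (z k))"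
        by (simp add: prod.distrib)
    qed
    also have "\<dots> = (\<Prod>k\<in>UNIV. \<integral>\<^sup>+x. ennreal (std_normal_density x) * indicator (A k) x \<partial>lborel)"
      by (rule L.product_nn_integral_prod) auto
    also have "\<dots> = (\<Prod>k\<in>UNIV. emeasure std_normal_distribution (A k))"
      by (intro prod.cong refl) (simp add: emeasure_density)
    finally show "emeasure ?R (Pi\<^sub>E UNIV A) = (\<Prod>k\<in>UNIV. emeasure std_normal_distribution (A k))" .
  qed simp
  then show ?thesis by simp
qed

lemma measurable_matrix_of_family [measurable]:
  "(\<lambda>z. \<chi> i j. z (i, j)) \<in> (\<Pi>\<^sub>M k\<in>(UNIV::('n \<times> 'p) set). lborel) \<rightarrow>\<^sub>M (borel :: (real^'p^'n) measure)"
proof (subst borel_measurable_euclidean_space, safe)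
  fix b :: "real^'p^'n" assume "b \<in> Basis"
  then obtain i j where b: "b = axis i (axis j 1)" by (auto simp: Basis_vec_def)
  show "(\<lambda>z. (\<chi> i j. z (i, j)) \<bullet> b) \<in> borel_measurable (\<Pi>\<^sub>M k\<in>(UNIV::('n \<times> 'p) set). lborel)"
    unfolding b inner_matrix_Basis by simp
qed

text \<open>Bridge from the product over entries, by which \<open>std_normal_matrix\<close> is
  defined, to Lebesgue measure on the matrix space, for which the substitution rules are stated.
  Agreement on boxes suffices.\<close>

lemma lborel_matrix_eq_distr_PiM:
  "(lborel :: (real^'p^'n) measure)
    = distr (\<Pi>\<^sub>M k\<in>(UNIV::('n \<times> 'p) set). lborel) borel (\<lambda>z. \<chi> i j. z (i, j))"
proof (rule lborel_eqI)
  interpret L: product_sigma_finite "\<lambda>_::'n \<times> 'p. lborel :: real measure" by standard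
  let ?P = "\<Pi>\<^sub>M k\<in>(UNIV::('n \<times> 'p) set). (lborel :: real measure)"
  let ?T = "(\<lambda>z. \<chi> i j. z (i, j)) :: ('n \<times> 'p \<Rightarrow> real) \<Rightarrow> real^'p^'n"
  fix l u :: "real^'p^'n" assume le: "\<And>b. b \<in> Basis \<Longrightarrow> l \<bullet> b \<le> u \<bullet> b"
  have le': "l $ i $ j \<le> u $ i $ j" for i j
    using le[of "axis i (axis j 1)"] by (simp add: inner_matrix_Basis axis_in_Basis_iff)
  have box: "?T z \<in> box l u \<longleftrightarrow> (\<forall>i j. l $ i $ j < z (i, j) \<and> z (i, j) < u $ i $ j)" for z
  proof -
    have "?T z \<in> box l u \<longleftrightarrow> (\<forall>b\<in>(\<lambda>(i, j). axis i (axis j 1)) ` UNIV. l \<bullet> b < ?T z \<bullet> b \<and> ?T z \<bullet> b < u \<bullet> b)"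
      using bij_betw_imp_surj_on[OF bij_betw_matrix_Basis[where 'n='n and 'p='p]] by (simp add: mem_box)
    then show ?thesis by (auto simp: inner_matrix_Basis)
  qed
  have "emeasure (distr ?P borel ?T) (box l u) = emeasure ?P (?T -` box l u \<inter> space ?P)"
    by (rule emeasure_distr) auto
  also have "?T -` box l u \<inter> space ?P = (\<Pi>\<^sub>E k\<in>UNIV. {l $ fst k $ snd k <..< u $ fst k $ snd k})"
    unfolding set_eq_iff vimage_eq Int_iff box by (auto simp: space_PiM PiE_iff)
  also have "emeasure ?P \<dots> = (\<Prod>k\<in>UNIV. emeasure lborel {l $ fst k $ snd k <..< u $ fst k $ snd k})"
    by (rule L.emeasure_PiM) auto
  also have "\<dots> = (\<Prod>k\<in>UNIV. ennreal (u $ fst k $ snd k - l $ fst k $ snd k))"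
    using le' by simp
  also have "\<dots> = ennreal (\<Prod>k\<in>UNIV. (u $ fst k $ snd k - l $ fst k $ snd k))"
    using le' by (intro prod_ennreal) simp
  also have "(\<Prod>k\<in>UNIV. (u $ fst k $ snd k - l $ fst k $ snd k)) = (\<Prod>b\<in>Basis. (u - l) \<bullet> b)"
    by (subst prod.reindex_bij_betw[OF bij_betw_matrix_Basis, symmetric])
      (simp add: split_def inner_matrix_Basis)
  finally show "emeasure (distr ?P borel ?T) (box l u) = (\<Prod>b\<in>Basis. (u - l) \<bullet> b)" .
qed simp

definition gauss :: "real^'p^'n \<Rightarrow> ennreal" where
  "gauss Y = ennreal (exp (- (norm Y)\<^sup>2 / 2))"

lemma borel_measurable_gauss [measurable (raw)]:
  fixes f :: "'a \<Rightarrow> real^'p^'n"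
  assumes [measurable]: "f \<in> borel_measurable M"
  shows "(\<lambda>x. gauss (f x)) \<in> borel_measurable M"
  unfolding gauss_def by measurable

text \<open>The constant is only asserted to exist: it multiplies both sides of the change of
  measure below.\<close>

lemma std_normal_matrix_eq_density:
  obtains k where "(std_normal_matrix :: (real^'p^'n) measure) = density lborel (\<lambda>Y. ennreal k * gauss Y)"
proof -
  let ?P = "\<Pi>\<^sub>M k\<in>(UNIV::('n \<times> 'p) set). (lborel :: real measure)"
  let ?T = "(\<lambda>z. \<chi> i j. z (i, j)) :: ('n \<times> 'p \<Rightarrow> real) \<Rightarrow> real^'p^'n"
  define k where "k = (1 / sqrt (2 * pi)) ^ CARD('n \<times> 'p)"
  have k: "(\<Prod>k\<in>UNIV. ennreal (std_normal_density (z k))) = ennreal k * gauss (?T z)" for z :: "'n \<times> 'p \<Rightarrow> real"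
  proof -
    have "(\<Prod>k\<in>UNIV. std_normal_density (z k)) = k * exp (\<Sum>k\<in>UNIV. - (z k)\<^sup>2 / 2)"
      by (simp add: std_normal_density_def prod_dividef exp_sum k_def power_one_over)
    also have "(\<Sum>k\<in>UNIV. - (z k)\<^sup>2 / 2) = - (\<Sum>k\<in>UNIV \<times> UNIV. (z k)\<^sup>2) / 2"
      by (simp add: sum_negf sum_divide_distrib)
    also have "(\<Sum>k\<in>UNIV \<times> UNIV. (z k)\<^sup>2) = (norm (?T z))\<^sup>2"
      by (simp add: norm_vec_def L2_set_def sum_nonneg sum.cartesian_product)
    finally have "(\<Prod>k\<in>UNIV. std_normal_density (z k)) = k * exp (- (norm (?T z))\<^sup>2 / 2)" .
    then show ?thesis
      by (simp add: prod_ennreal gauss_def ennreal_mult' k_def)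
  qed
  have "(std_normal_matrix :: (real^'p^'n) measure)
      = distr (density ?P (\<lambda>z. ennreal k * gauss (?T z))) borel ?T"
    unfolding std_normal_matrix_def PiM_std_normal_eq_density k ..
  also have "\<dots> = density (distr ?P borel ?T) (\<lambda>Y. ennreal k * gauss Y)"
    by (rule density_distr[symmetric]) auto
  finally show thesis using that by (simp add: lborel_matrix_eq_distr_PiM[symmetric])
qed

lemma prob_space_std_normal_matrix: "prob_space (std_normal_matrix :: (real^'p^'n) measure)"
proof -
  have "prob_space (\<Pi>\<^sub>M k\<in>(UNIV::('n \<times> 'p) set). std_normal_distribution)"
    by (intro prob_space_PiM prob_space_normal_density) simp
  moreover
  have "(\<lambda>z. \<chi> i j. z (i, j)) \<in> (\<Pi>\<^sub>M k\<in>(UNIV::('n \<times> 'p) set). std_normal_distribution) \<rightarrow>\<^sub>M (borel :: (real^'p^'n) measure)"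
    using measurable_matrix_of_family by (simp cong: measurable_cong_sets sets_PiM_cong)
  ultimately show ?thesis unfolding std_normal_matrix_def by (rule prob_space.prob_space_distr)
qed

subsection \<open>Averaging over the linear group\<close>

lemma matrix_inv_inverse:
  fixes A :: "real^'n^'n"
  assumes "invertible A"
  shows "A ** matrix_inv A = mat 1" "matrix_inv A ** A = mat 1"
  using assms someI_ex[of "\<lambda>B. A ** B = mat 1 \<and> B ** A = mat 1"]
  by (auto simp: invertible_def matrix_inv_def)

lemma matrix_inv_eqI:
  fixes A B :: "real^'n^'n"
  assumes "A ** B = mat 1"
  shows "matrix_inv A = B"
proof -
  have "invertible A" using assms invertible_right_inverse by blast
  then show ?thesis
    by (metis assms matrix_inv_inverse(2) matrix_mul_assoc matrix_mul_lid matrix_mul_rid)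
qed

lemma matrix_inv_mult_inv:
  fixes A B :: "real^'n^'n"
  assumes A: "invertible A" and B: "invertible B"
  shows "matrix_inv (matrix_inv A ** B) = matrix_inv B ** A"
proof (rule matrix_inv_eqI)
  have "(matrix_inv A ** B) ** (matrix_inv B ** A) = matrix_inv A ** (B ** matrix_inv B) ** A"
    by (simp only: matrix_mul_assoc)
  then show "(matrix_inv A ** B) ** (matrix_inv B ** A) = mat 1"
    using A B by (simp add: matrix_inv_inverse)
qed

lemma invertible_matrix_inv: "invertible A \<Longrightarrow> invertible (matrix_inv A)" for A :: "real^'n^'n"
  using matrix_inv_inverse invertible_def by metis

text \<open>Cramer's rule applied to the columns of the inverse: the entries are quotients of
  determinants, which yields measurability of inversion.\<close>

lemma matrix_inv_cramer:
  fixes A :: "real^'n^'n"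
  assumes "det A \<noteq> 0"
  shows "matrix_inv A = (\<chi> k j. det (\<chi> i l. if l = k then axis j 1 $ i else A $ i $ l) / det A)"
proof (rule vec_eq_iff[THEN iffD2], intro allI vec_eq_iff[THEN iffD2])
  fix k j
  have "A *v (matrix_inv A *v axis j 1) = axis j 1"
    using matrix_inv_inverse(1)[of A] assms
    by (simp only: matrix_vector_mul_assoc invertible_det_nz simp_thms matrix_vector_mul_lid)
  then have "matrix_inv A *v axis j 1 = (\<chi> k. det (\<chi> i l. if l = k then axis j 1 $ i else A $ i $ l) / det A)"
    using cramer[OF assms, of "matrix_inv A *v axis j 1" "axis j 1"] by blast
  moreover have "(matrix_inv A *v axis j 1) $ k = matrix_inv A $ k $ j"
    by (simp add: matrix_vector_mult_basis column_def)
  ultimately show "matrix_inv A $ k $ j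
      = (\<chi> k j. det (\<chi> i l. if l = k then axis j 1 $ i else A $ i $ l) / det A) $ k $ j"
    by simp
qed

lemma borel_measurable_matrix_lambda:
  fixes f :: "'a \<Rightarrow> 'n::finite \<Rightarrow> 'p::finite \<Rightarrow> real"
  assumes "\<And>i j. (\<lambda>x. f x i j) \<in> borel_measurable M"
  shows "(\<lambda>x. \<chi> i j. f x i j) \<in> borel_measurable M"
proof (subst borel_measurable_euclidean_space, safe)
  fix b :: "real^'p^'n" assume "b \<in> Basis"
  then obtain i j where b: "b = axis i (axis j 1)" by (auto simp: Basis_vec_def)
  show "(\<lambda>x. (\<chi> i j. f x i j) \<bullet> b) \<in> borel_measurable M"
    unfolding b inner_matrix_Basis using assms by simp
qed

lemma borel_measurable_matrix_inv [measurable (raw)]: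
  fixes f :: "'a \<Rightarrow> real^'n^'n"
  assumes [measurable]: "f \<in> borel_measurable M"
  shows "(\<lambda>x. matrix_inv (f x)) \<in> borel_measurable M"
proof -
  \<comment> \<open>For singular matrices \<open>matrix_inv\<close> chooses from the empty
    predicate, so it takes one and the same value at all of them.\<close>
  define C :: "real^'n^'n" where "C = (SOME B. False)"
  have C: "matrix_inv A = C" if "det A = 0" for A :: "real^'n^'n"
  proof -
    have "(\<lambda>B. A ** B = mat 1 \<and> B ** A = mat 1) = (\<lambda>B. False)"
      using that invertible_det_nz[of A] by (auto simp: invertible_def)
    then show ?thesis by (simp add: matrix_inv_def C_def)
  qed
  have [measurable]: "(\<lambda>x. \<chi> k j. det (\<chi> i l. if l = k then axis j 1 $ i else f x $ i $ l) / det (f x)) \<in> borel_measurable M"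
    by (intro borel_measurable_matrix_lambda borel_measurable_divide borel_measurable_det measurable_If) measurable
  have "(\<lambda>x. matrix_inv (f x)) = (\<lambda>x. if det (f x) = 0 then C else
      (\<chi> k j. det (\<chi> i l. if l = k then axis j 1 $ i else f x $ i $ l) / det (f x)))"
    by (auto simp: C matrix_inv_cramer fun_eq_iff)
  also have "\<dots> \<in> borel_measurable M" by measurable
  finally show ?thesis .
qed

text \<open>Singular matrices carry no mass, since \<open>inverse 0 = 0\<close>; likewise rank-deficient matrices below.\<close>

definition haar :: "(real^'p^'p) measure" where
  "haar = density lborel (\<lambda>A. ennreal (inverse (\<bar>det A\<bar> ^ CARD('p))))"

lemma sets_haar [measurable_cong, simp]: "sets haar = sets borel"
  by (simp add: haar_def)

lemma sigma_finite_haar: "sigma_finite_measure (haar :: (real^'p^'p) measure)"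
  unfolding haar_def by (subst sigma_finite_measure.sigma_finite_iff_density_finite[OF sigma_finite_lborel]) auto

lemma AE_haar_invertible: "AE A in haar. invertible A"
  unfolding haar_def by (subst AE_density) (auto simp: invertible_det_nz intro!: AE_I2)

lemma nn_integral_haar:
  fixes f :: "real^'p^'p \<Rightarrow> ennreal"
  assumes [measurable]: "f \<in> borel_measurable borel"
  shows "(\<integral>\<^sup>+A. f A \<partial>haar) = (\<integral>\<^sup>+A. ennreal (inverse (\<bar>det A\<bar> ^ CARD('p))) * f A \<partial>lborel)"
  unfolding haar_def by (rule nn_integral_density) auto

text \<open>The Jacobian of a substitution cancels the change in the density. The case
  \<open>a = 0\<close>, coming from degenerate matrices, is covered by
  \<open>inverse 0 = 0\<close>.\<close>

lemma inverse_weight_mult: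
  assumes "b > (0::real)" "a \<ge> 0"
  shows "ennreal (b ^ m) * (ennreal (inverse ((b * a) ^ m)) * x) = ennreal (inverse (a ^ m)) * x"
    "ennreal (b ^ m) * (ennreal (inverse ((a * b) ^ m)) * x) = ennreal (inverse (a ^ m)) * x"
proof -
  have "b ^ m * inverse ((b * a) ^ m) = inverse (a ^ m)"
    using assms by (simp add: power_mult_distrib field_simps)
  then show "ennreal (b ^ m) * (ennreal (inverse ((b * a) ^ m)) * x) = ennreal (inverse (a ^ m)) * x"
    using assms by (metis ennreal_mult' mult.assoc zero_le_power less_imp_le)
  then show "ennreal (b ^ m) * (ennreal (inverse ((a * b) ^ m)) * x) = ennreal (inverse (a ^ m)) * x"
    by (simp add: mult.commute)
qed

text \<open>On square matrices left and right multiplication by \<open>B\<close> have the same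
  Jacobian, the absolute determinant to the power \<open>CARD('p)\<close>, so a single density is
  invariant on both sides: the group is unimodular.\<close>

lemma nn_integral_haar_left:
  fixes f :: "real^'p^'p \<Rightarrow> ennreal"
  assumes B: "invertible B" and [measurable]: "f \<in> borel_measurable borel"
  shows "(\<integral>\<^sup>+A. f (B ** A) \<partial>haar) = (\<integral>\<^sup>+A. f A \<partial>haar)"
proof -
  have b: "\<bar>det B\<bar> > 0" using B by (simp add: invertible_det_nz)
  have "(\<integral>\<^sup>+A. f A \<partial>haar) = (\<integral>\<^sup>+A. ennreal (inverse (\<bar>det A\<bar> ^ CARD('p))) * f A \<partial>lborel)"
    by (simp add: nn_integral_haar)
  also have "\<dots> = ennreal (\<bar>det B\<bar> ^ CARD('p)) *
      (\<integral>\<^sup>+A. ennreal (inverse (\<bar>det (B ** A)\<bar> ^ CARD('p))) * f (B ** A) \<partial>lborel)"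
    by (rule nn_integral_lborel_matrix_mult_left[OF B]) simp
  also have "\<dots> = (\<integral>\<^sup>+A. ennreal (\<bar>det B\<bar> ^ CARD('p)) *
      (ennreal (inverse ((\<bar>det B\<bar> * \<bar>det A\<bar>) ^ CARD('p))) * f (B ** A)) \<partial>lborel)"
    by (simp add: nn_integral_cmult det_mul abs_mult)
  also have "\<dots> = (\<integral>\<^sup>+A. f (B ** A) \<partial>haar)"
    unfolding inverse_weight_mult(1)[OF b abs_ge_zero] by (simp add: nn_integral_haar)
  finally show ?thesis by simp
qed

lemma nn_integral_haar_right:
  fixes f :: "real^'p^'p \<Rightarrow> ennreal"
  assumes B: "invertible B" and [measurable]: "f \<in> borel_measurable borel"
  shows "(\<integral>\<^sup>+A. f (A ** B) \<partial>haar) = (\<integral>\<^sup>+A. f A \<partial>haar)"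
proof -
  have b: "\<bar>det B\<bar> > 0" using B by (simp add: invertible_det_nz)
  have "(\<integral>\<^sup>+A. f A \<partial>haar) = (\<integral>\<^sup>+A. ennreal (inverse (\<bar>det A\<bar> ^ CARD('p))) * f A \<partial>lborel)"
    by (simp add: nn_integral_haar)
  also have "\<dots> = ennreal (\<bar>det B\<bar> ^ CARD('p)) *
      (\<integral>\<^sup>+A. ennreal (inverse (\<bar>det (A ** B)\<bar> ^ CARD('p))) * f (A ** B) \<partial>lborel)"
    by (rule nn_integral_lborel_matrix_mult_right[OF B]) simp
  also have "\<dots> = (\<integral>\<^sup>+A. ennreal (\<bar>det B\<bar> ^ CARD('p)) *
      (ennreal (inverse ((\<bar>det A\<bar> * \<bar>det B\<bar>) ^ CARD('p))) * f (A ** B)) \<partial>lborel)"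
    by (simp add: nn_integral_cmult det_mul abs_mult)
  also have "\<dots> = (\<integral>\<^sup>+A. f (A ** B) \<partial>haar)"
    unfolding inverse_weight_mult(2)[OF b abs_ge_zero] by (simp add: nn_integral_haar)
  finally show ?thesis by simp
qed

lemma AE_lborel_invertible: "AE A in (lborel :: (real^'p^'p) measure). det A \<noteq> 0"
proof -
  have "AE A in (lborel :: (real^'p^'p) measure). gram_det A \<noteq> 0"
    by (rule AE_gram_det_nonzero) simp
  then show ?thesis by eventually_elim (simp add: gram_det_def det_mul)
qed

text \<open>The weight makes the integrand bounded on the unit ball.\<close>

lemma haar_unit_ball_finite_pos:
  assumes m: "CARD('p) \<le> m"
  defines "K \<equiv> \<integral>\<^sup>+A. indicator (cball 0 1) A * ennreal (\<bar>det A\<bar> ^ m) \<partial>(haar :: (real^'p^'p) measure)"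
  shows "K \<noteq> 0" "K \<noteq> \<infinity>"
proof -
  let ?f = "\<lambda>A::real^'p^'p. ennreal (inverse (\<bar>det A\<bar> ^ CARD('p))) * (indicator (cball 0 1) A * ennreal (\<bar>det A\<bar> ^ m))"
  have [measurable]: "cball (0::real^'p^'p) 1 \<in> sets borel" by simp
  have K: "K = (\<integral>\<^sup>+A. ?f A \<partial>lborel)" unfolding K_def by (rule nn_integral_haar) measurable
  have ball: "emeasure lborel (cball 0 1 :: (real^'p^'p) set) \<noteq> 0"
  proof
    assume "emeasure lborel (cball 0 1 :: (real^'p^'p) set) = 0"
    then have "measure lborel (cball 0 1 :: (real^'p^'p) set) = 0" by (simp add: measure_def)
    then show False by (simp add: content_cball_eq_0_iff)
  qed
  show "K \<noteq> 0"
  proof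
    assume "K = 0"
    then have "AE A in lborel. ?f A = 0" unfolding K by (subst (asm) nn_integral_0_iff_AE) measurable
    with AE_lborel_invertible have "AE A in lborel. A \<notin> cball (0::real^'p^'p) 1"
      by eventually_elim (auto simp: indicator_def split: if_splits)
    then have "emeasure lborel {A\<in>space lborel. A \<in> cball (0::real^'p^'p) 1} = 0"
      by (rule emeasure_eq_0_AE)
    then show False using ball by (simp only: space_lborel space_borel UNIV_I simp_thms Collect_mem_eq)
  qed
  have "compact ((\<lambda>A::real^'p^'p. \<bar>det A\<bar>) ` cball 0 1)"
    by (intro compact_continuous_image continuous_intros continuous_on_det) simp
  then obtain b where b: "\<And>A::real^'p^'p. A \<in> cball 0 1 \<Longrightarrow> \<bar>det A\<bar> \<le> b"
    by (force dest!: compact_imp_bounded simp: bounded_iff)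
  have "?f A \<le> ennreal (b ^ (m - CARD('p))) * indicator (cball 0 1) A" for A
  proof (cases "A \<in> cball 0 1 \<and> det A \<noteq> 0")
    case True
    have "inverse (\<bar>det A\<bar> ^ CARD('p)) * \<bar>det A\<bar> ^ m = \<bar>det A\<bar> ^ (m - CARD('p))"
      using True m by (simp add: power_diff field_simps)
    also have "\<dots> \<le> b ^ (m - CARD('p))" using b True by (intro power_mono) auto
    finally show ?thesis using True by (simp add: ennreal_mult'[symmetric] ennreal_leI)
  next
    case False
    have "m > 0" using m zero_less_card_finite[where 'a='p] by linarith
    with False show ?thesis by (auto simp: indicator_def zero_power)
  qed
  then have "K \<le> (\<integral>\<^sup>+A. ennreal (b ^ (m - CARD('p))) * indicator (cball 0 1) A \<partial>(lborel :: (real^'p^'p) measure))"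
    unfolding K by (rule nn_integral_mono)
  also have "\<dots> = ennreal (b ^ (m - CARD('p))) * emeasure lborel (cball 0 1 :: (real^'p^'p) set)"
    by (simp add: nn_integral_cmult)
  also have "\<dots> < \<infinity>" using emeasure_lborel_cball_finite[of "0::real^'p^'p" 1] by (simp add: ennreal_mult_less_top)
  finally show "K \<noteq> \<infinity>" by simp
qed

text \<open>Left and right invariance together imply invariance under inversion, via Fubini.\<close>

lemma nn_integral_haar_inverse:
  fixes f :: "real^'p^'p \<Rightarrow> ennreal"
  assumes [measurable]: "f \<in> borel_measurable borel"
  shows "(\<integral>\<^sup>+A. f (matrix_inv A) \<partial>haar) = (\<integral>\<^sup>+A. f A \<partial>haar)"
proof -
  interpret H: sigma_finite_measure "haar :: (real^'p^'p) measure" by (rule sigma_finite_haar)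
  interpret P: pair_sigma_finite "haar :: (real^'p^'p) measure" "haar :: (real^'p^'p) measure" ..
  have [measurable]: "cball (0::real^'p^'p) 1 \<in> sets borel" by simp
  \<comment> \<open>The power of the determinant cancels the density of \<open>haar\<close>, which
    is not integrable on the ball by itself.\<close>
  define u where "u A = indicator (cball 0 1) A * ennreal (\<bar>det A\<bar> ^ CARD('p))" for A :: "real^'p^'p"
  have [measurable]: "u \<in> borel_measurable borel" unfolding u_def by measurable
  define U where "U = (\<integral>\<^sup>+A. u A \<partial>haar)"
  have U: "U \<noteq> 0" "U \<noteq> \<infinity>" unfolding U_def u_def by (rule haar_unit_ball_finite_pos; simp)+
  have "U * (\<integral>\<^sup>+B. f (matrix_inv B) \<partial>haar) = (\<integral>\<^sup>+B. (\<integral>\<^sup>+A. u A * f (matrix_inv B) \<partial>haar) \<partial>haar)"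
    by (simp add: U_def nn_integral_multc nn_integral_cmult)
  also have "\<dots> = (\<integral>\<^sup>+B. (\<integral>\<^sup>+A. u (A ** B) * f (matrix_inv B) \<partial>haar) \<partial>haar)"
  proof (intro nn_integral_cong_AE, use AE_haar_invertible in eventually_elim)
    fix B :: "real^'p^'p" assume "invertible B"
    then show "(\<integral>\<^sup>+A. u A * f (matrix_inv B) \<partial>haar) = (\<integral>\<^sup>+A. u (A ** B) * f (matrix_inv B) \<partial>haar)"
      by (intro nn_integral_haar_right[where f = "\<lambda>A. u A * f (matrix_inv B)", symmetric]) measurable
  qed
  also have "\<dots> = (\<integral>\<^sup>+A. (\<integral>\<^sup>+B. u (A ** B) * f (matrix_inv B) \<partial>haar) \<partial>haar)"
    by (rule P.Fubini') measurable
  \<comment> \<open>Replacing \<open>B\<close> by \<open>matrix_inv A ** B\<close> frees the weight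
    from \<open>A\<close> and puts \<open>A\<close> into the argument of \<open>f\<close>, where
    left invariance can remove the inverse of \<open>B\<close>.\<close>
  also have "\<dots> = (\<integral>\<^sup>+A. (\<integral>\<^sup>+B. u B * f (matrix_inv B ** A) \<partial>haar) \<partial>haar)"
  proof (intro nn_integral_cong_AE, use AE_haar_invertible in eventually_elim)
    fix A :: "real^'p^'p" assume A: "invertible A"
    have "(\<integral>\<^sup>+B. u (A ** B) * f (matrix_inv B) \<partial>haar)
      = (\<integral>\<^sup>+B. u (A ** (matrix_inv A ** B)) * f (matrix_inv (matrix_inv A ** B)) \<partial>haar)"
      by (rule nn_integral_haar_left[OF invertible_matrix_inv[OF A], symmetric]) measurable
    also have "\<dots> = (\<integral>\<^sup>+B. u B * f (matrix_inv B ** A) \<partial>haar)"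
      by (intro nn_integral_cong_AE, use AE_haar_invertible in eventually_elim)
        (simp add: matrix_inv_mult_inv A matrix_mul_assoc matrix_inv_inverse)
    finally show "(\<integral>\<^sup>+B. u (A ** B) * f (matrix_inv B) \<partial>haar) = (\<integral>\<^sup>+B. u B * f (matrix_inv B ** A) \<partial>haar)" .
  qed
  also have "\<dots> = (\<integral>\<^sup>+B. (\<integral>\<^sup>+A. u B * f (matrix_inv B ** A) \<partial>haar) \<partial>haar)"
    by (rule P.Fubini') measurable
  also have "\<dots> = (\<integral>\<^sup>+B. u B * (\<integral>\<^sup>+A. f A \<partial>haar) \<partial>haar)"
  proof (intro nn_integral_cong_AE, use AE_haar_invertible in eventually_elim)
    fix B :: "real^'p^'p" assume B: "invertible B"
    have "(\<integral>\<^sup>+A. f (matrix_inv B ** A) \<partial>haar) = (\<integral>\<^sup>+A. f A \<partial>haar)"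
      by (rule nn_integral_haar_left[OF invertible_matrix_inv[OF B]]) measurable
    then show "(\<integral>\<^sup>+A. u B * f (matrix_inv B ** A) \<partial>haar) = u B * (\<integral>\<^sup>+A. f A \<partial>haar)"
      by (simp add: nn_integral_cmult)
  qed
  also have "\<dots> = U * (\<integral>\<^sup>+A. f A \<partial>haar)" by (simp add: U_def nn_integral_multc)
  finally show ?thesis using U by (simp add: ennreal_mult_cancel_left)
qed

section \<open>Gram determinants and integration along orbits\<close>

lemma gram_det_nonneg: "gram_det Y \<ge> 0"
  using sym_pos_def_det_pos[OF sym_pos_def_gram[of Y]] by (cases "gram_det Y = 0") (auto simp: gram_det_def)

lemma sqrt_gram_det_mult_right:
  fixes Y :: "real^'p^'n" and B :: "real^'p^'p"
  shows "sqrt (gram_det (Y ** B)) = sqrt (gram_det Y) * \<bar>det B\<bar>"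
proof -
  have "transpose (Y ** B) ** (Y ** B) = transpose B ** (transpose Y ** Y) ** B"
    by (simp only: matrix_transpose_mul matrix_mul_assoc)
  then have "gram_det (Y ** B) = gram_det Y * (det B)\<^sup>2"
    by (simp add: gram_det_def det_mul power2_eq_square)
  then show ?thesis by (simp add: real_sqrt_mult)
qed

lemma gram_det_nonzero_iff:
  fixes Y :: "real^'p^'n"
  shows "gram_det Y \<noteq> 0 \<longleftrightarrow> (\<forall>x. Y *v x = 0 \<longrightarrow> x = 0)"
proof
  assume "gram_det Y \<noteq> 0"
  then have "sym_pos_def (transpose Y ** Y)" by (simp add: gram_det_def sym_pos_def_gram)
  then show "\<forall>x. Y *v x = 0 \<longrightarrow> x = 0"
    by (metis gram_eq inner_zero_left less_irrefl sym_pos_def_def)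
next
  assume ker: "\<forall>x. Y *v x = 0 \<longrightarrow> x = 0"
  show "gram_det Y \<noteq> 0"
  proof
    assume "gram_det Y = 0"
    then obtain x where x: "x \<noteq> 0" "(transpose Y ** Y) *v x = 0"
      unfolding gram_det_def using det_eq_0_kernel by blast
    then have "Y *v x = 0" using gram_eq[of x Y x] by simp
    then show False using x ker by blast
  qed
qed

lemma gram_det_mult_left_nonzero:
  fixes Y :: "real^'p^'n"
  assumes "invertible T" "gram_det Y \<noteq> 0"
  shows "gram_det (T ** Y) \<noteq> 0"
  using assms unfolding gram_det_nonzero_iff
  by (metis invertible_def matrix_vector_mul_assoc matrix_vector_mul_lid matrix_vector_mult_0_right)

text \<open>The exponent is the one for which the density absorbs the Jacobian of right
  multiplication on matrices with \<open>CARD('n)\<close> rows, so that the group preserves this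
  measure.\<close>

definition orbit_measure :: "(real^'p^'n) measure" where
  "orbit_measure = density lborel (\<lambda>Y. ennreal (inverse (sqrt (gram_det Y) ^ CARD('n))))"

lemma sets_orbit_measure [measurable_cong, simp]: "sets orbit_measure = sets borel"
  by (simp add: orbit_measure_def)

lemma sigma_finite_orbit_measure: "sigma_finite_measure (orbit_measure :: (real^'p^'n) measure)"
  unfolding orbit_measure_def by (subst sigma_finite_measure.sigma_finite_iff_density_finite[OF sigma_finite_lborel]) auto

lemma nn_integral_orbit_measure:
  fixes f :: "real^'p^'n \<Rightarrow> ennreal"
  assumes [measurable]: "f \<in> borel_measurable borel"
  shows "(\<integral>\<^sup>+Y. f Y \<partial>orbit_measure) = (\<integral>\<^sup>+Y. ennreal (inverse (sqrt (gram_det Y) ^ CARD('n))) * f Y \<partial>lborel)"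
  unfolding orbit_measure_def by (rule nn_integral_density) auto

lemma nn_integral_orbit_measure_mult:
  fixes f :: "real^'p^'n \<Rightarrow> ennreal" and B :: "real^'p^'p"
  assumes B: "invertible B" and [measurable]: "f \<in> borel_measurable borel"
  shows "(\<integral>\<^sup>+Y. f (Y ** B) \<partial>orbit_measure) = (\<integral>\<^sup>+Y. f Y \<partial>orbit_measure)"
proof -
  have b: "\<bar>det B\<bar> > 0" using B by (simp add: invertible_det_nz)
  have "(\<integral>\<^sup>+Y. f Y \<partial>orbit_measure) = (\<integral>\<^sup>+Y. ennreal (inverse (sqrt (gram_det Y) ^ CARD('n))) * f Y \<partial>lborel)"
    by (simp add: nn_integral_orbit_measure)
  also have "\<dots> = ennreal (\<bar>det B\<bar> ^ CARD('n)) *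
      (\<integral>\<^sup>+Y. ennreal (inverse (sqrt (gram_det (Y ** B)) ^ CARD('n))) * f (Y ** B) \<partial>lborel)"
    by (rule nn_integral_lborel_matrix_mult_right[OF B]) simp
  also have "\<dots> = (\<integral>\<^sup>+Y. ennreal (\<bar>det B\<bar> ^ CARD('n)) *
      (ennreal (inverse ((sqrt (gram_det Y) * \<bar>det B\<bar>) ^ CARD('n))) * f (Y ** B)) \<partial>lborel)"
    by (simp add: nn_integral_cmult sqrt_gram_det_mult_right)
  also have "\<dots> = (\<integral>\<^sup>+Y. f (Y ** B) \<partial>orbit_measure)"
    unfolding inverse_weight_mult(2)[OF b real_sqrt_ge_zero[OF gram_det_nonneg]]
    by (simp add: nn_integral_orbit_measure)
  finally show ?thesis by simp
qed

text \<open>Substituting \<open>Y ** matrix_inv A\<close> for \<open>Y\<close> under the invariant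
  measure moves the group element from \<open>g\<close> to \<open>h\<close>; \<psi> does not notice,
  and inversion invariance of \<open>haar\<close> turns \<open>matrix_inv A\<close> back into
  \<open>A\<close>. This replaces a disintegration over the orbit space.\<close>

lemma orbit_average_exchange:
  fixes \<psi> g h :: "real^'p^'n \<Rightarrow> ennreal"
  assumes [measurable]: "\<psi> \<in> borel_measurable borel" "g \<in> borel_measurable borel" "h \<in> borel_measurable borel"
    and inv: "\<And>Y A. invertible A \<Longrightarrow> \<psi> (Y ** A) = \<psi> Y"
  shows "(\<integral>\<^sup>+Y. \<psi> Y * h Y * (\<integral>\<^sup>+A. g (Y ** A) \<partial>haar) \<partial>orbit_measure)
    = (\<integral>\<^sup>+Y. \<psi> Y * g Y * (\<integral>\<^sup>+A. h (Y ** A) \<partial>haar) \<partial>orbit_measure)"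
proof -
  interpret H: sigma_finite_measure "haar :: (real^'p^'p) measure" by (rule sigma_finite_haar)
  interpret M: sigma_finite_measure "orbit_measure :: (real^'p^'n) measure" by (rule sigma_finite_orbit_measure)
  interpret P: pair_sigma_finite "orbit_measure :: (real^'p^'n) measure" "haar :: (real^'p^'p) measure" ..
  interpret Q: pair_sigma_finite "haar :: (real^'p^'p) measure" "orbit_measure :: (real^'p^'n) measure" ..
  have "(\<integral>\<^sup>+Y. \<psi> Y * h Y * (\<integral>\<^sup>+A. g (Y ** A) \<partial>haar) \<partial>orbit_measure)
    = (\<integral>\<^sup>+Y. (\<integral>\<^sup>+A. \<psi> Y * h Y * g (Y ** A) \<partial>haar) \<partial>orbit_measure)"
    by (simp add: nn_integral_cmult)
  also have "\<dots> = (\<integral>\<^sup>+A. (\<integral>\<^sup>+Y. \<psi> Y * h Y * g (Y ** A) \<partial>orbit_measure) \<partial>haar)"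
    by (rule Q.Fubini') measurable
  also have "\<dots> = (\<integral>\<^sup>+A. (\<integral>\<^sup>+Y. \<psi> Y * g Y * h (Y ** matrix_inv A) \<partial>orbit_measure) \<partial>haar)"
  proof (intro nn_integral_cong_AE, use AE_haar_invertible in eventually_elim)
    fix A :: "real^'p^'p" assume A: "invertible A"
    have c: "Y ** matrix_inv A ** A = Y" for Y :: "real^'p^'n"
      by (metis A matrix_inv_inverse(2) matrix_mul_assoc matrix_mul_rid)
    have "(\<integral>\<^sup>+Y. \<psi> Y * h Y * g (Y ** A) \<partial>orbit_measure)
      = (\<integral>\<^sup>+Y. \<psi> (Y ** matrix_inv A) * h (Y ** matrix_inv A) * g (Y ** matrix_inv A ** A) \<partial>orbit_measure)"
      by (rule nn_integral_orbit_measure_mult[OF invertible_matrix_inv[OF A], symmetric]) measurable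
    then show "(\<integral>\<^sup>+Y. \<psi> Y * h Y * g (Y ** A) \<partial>orbit_measure)
      = (\<integral>\<^sup>+Y. \<psi> Y * g Y * h (Y ** matrix_inv A) \<partial>orbit_measure)"
      by (simp add: c inv invertible_matrix_inv[OF A] ac_simps)
  qed
  also have "\<dots> = (\<integral>\<^sup>+Y. (\<integral>\<^sup>+A. \<psi> Y * g Y * h (Y ** matrix_inv A) \<partial>haar) \<partial>orbit_measure)"
    by (rule P.Fubini') measurable
  also have "\<dots> = (\<integral>\<^sup>+Y. \<psi> Y * g Y * (\<integral>\<^sup>+A. h (Y ** A) \<partial>haar) \<partial>orbit_measure)"
  proof (rule nn_integral_cong)
    fix Y :: "real^'p^'n"
    have "(\<integral>\<^sup>+A. h (Y ** matrix_inv A) \<partial>haar) = (\<integral>\<^sup>+A. h (Y ** A) \<partial>haar)"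
      by (rule nn_integral_haar_inverse[where f = "\<lambda>A. h (Y ** A)"]) measurable
    then show "(\<integral>\<^sup>+A. \<psi> Y * g Y * h (Y ** matrix_inv A) \<partial>haar) = \<psi> Y * g Y * (\<integral>\<^sup>+A. h (Y ** A) \<partial>haar)"
      by (simp add: nn_integral_cmult)
  qed
  finally show ?thesis .
qed

text \<open>The squared Frobenius norm of \<open>W ** A\<close> is the trace of
  \<open>A^T (W^T W) A\<close>. The numbers of rows may differ, so a rectangular \<open>W\<close>
  can be traded for the square root of its Gram matrix.\<close>

lemma norm_matrix_mult_cong:
  fixes W :: "real^'p^'n" and R :: "real^'p^'m"
  assumes "transpose W ** W = transpose R ** R"
  shows "norm (W ** A) = norm (R ** A)"
proof -
  have "(norm (transpose (W ** A)))\<^sup>2 = (\<Sum>k\<in>UNIV. (transpose A ** (transpose W ** W) ** A) $ k $ k)" for W :: "real^'p^'l"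
  proof -
    have "transpose A ** (transpose W ** W) ** A = transpose (W ** A) ** (W ** A)"
      by (simp only: matrix_transpose_mul matrix_mul_assoc)
    then show ?thesis
      by (simp add: norm_matrix_sq norm_vec_def L2_set_def sum_nonneg)
        (simp add: matrix_matrix_mult_def transpose_def power2_eq_square)
  qed
  from this[of W] this[of R] have "(norm (transpose (W ** A)))\<^sup>2 = (norm (transpose (R ** A)))\<^sup>2"
    using assms by simp
  then show ?thesis by (simp add: norm_matrix_transpose)
qed

text \<open>Since \<open>W\<close> enters only through its Gram matrix, it may be replaced by the
  invertible root \<open>R\<close>, which left invariance then absorbs. What remains is a power of
  \<open>det R\<close>, the square root of the Gram determinant.\<close>

lemma haar_integral_norm:
  fixes W :: "real^'p^'n" and G :: "real \<Rightarrow> ennreal"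
  assumes [measurable]: "G \<in> borel_measurable borel" and W: "gram_det W \<noteq> 0"
  shows "(\<integral>\<^sup>+A. G (norm (W ** A)) * ennreal (\<bar>det A\<bar> ^ m) \<partial>haar)
    = ennreal (inverse (sqrt (gram_det W) ^ m)) * (\<integral>\<^sup>+A. G (norm (A::real^'p^'p)) * ennreal (\<bar>det A\<bar> ^ m) \<partial>haar)"
proof -
  have S: "sym_pos_def (transpose W ** W)" using W by (simp add: gram_det_def sym_pos_def_gram)
  define R where "R = matrix_sqrt (transpose W ** W)"
  have R: "sym_pos_def R" "R ** R = transpose W ** W" using matrix_sqrt[OF S] by (auto simp: R_def)
  have n: "norm (W ** A) = norm (R ** A)" for A
    using R by (intro norm_matrix_mult_cong) (simp add: sym_pos_def_def)
  have pos: "det R > 0" using R(1) by (rule sym_pos_def_det_pos)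
  have "gram_det W = (det R)\<^sup>2" by (simp add: gram_det_def R(2)[symmetric] det_mul power2_eq_square)
  then have dR: "sqrt (gram_det W) = det R" using pos by simp
  have "(\<integral>\<^sup>+A. G (norm (A::real^'p^'p)) * ennreal (\<bar>det A\<bar> ^ m) \<partial>haar)
    = (\<integral>\<^sup>+A. G (norm (R ** A)) * ennreal (\<bar>det (R ** A)\<bar> ^ m) \<partial>haar)"
    by (rule nn_integral_haar_left[OF sym_pos_def_invertible[OF R(1)], symmetric]) measurable
  also have "\<dots> = (\<integral>\<^sup>+A. ennreal (det R ^ m) * (G (norm (R ** A)) * ennreal (\<bar>det A\<bar> ^ m)) \<partial>haar)"
    using pos by (simp add: det_mul abs_mult power_mult_distrib ennreal_mult ac_simps)
  also have "\<dots> = ennreal (det R ^ m) * (\<integral>\<^sup>+A. G (norm (W ** A)) * ennreal (\<bar>det A\<bar> ^ m) \<partial>haar)"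
    by (simp add: nn_integral_cmult n)
  finally have "ennreal (inverse (det R ^ m)) * (\<integral>\<^sup>+A. G (norm (A::real^'p^'p)) * ennreal (\<bar>det A\<bar> ^ m) \<partial>haar)
    = ennreal (inverse (det R ^ m)) * ennreal (det R ^ m) * (\<integral>\<^sup>+A. G (norm (W ** A)) * ennreal (\<bar>det A\<bar> ^ m) \<partial>haar)"
    by (simp add: mult.assoc)
  also have "ennreal (inverse (det R ^ m)) * ennreal (det R ^ m) = 1"
    using pos by (simp add: ennreal_mult'[symmetric])
  finally show ?thesis by (simp add: dR)
qed

text \<open>Trades the Gaussian for the ball by \<open>orbit_average_exchange\<close>. On full-rank
  \<open>Y\<close> the average of \<open>g\<close> is the constant \<open>?K1\<close>, whereas that
  of \<open>h\<close> is \<open>?K\<close> times a ratio of volumes; this ratio is all that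
  remembers \<open>T\<close>. The factor \<open>w\<close> converts between Lebesgue measure and
  \<open>orbit_measure\<close>.\<close>

lemma gauss_average:
  fixes \<psi> :: "real^'p^'n \<Rightarrow> ennreal" and T :: "real^'n^'n"
  assumes le: "CARD('p) \<le> CARD('n)" and T: "invertible T"
    and [measurable]: "\<psi> \<in> borel_measurable borel"
    and inv: "\<And>Y A. invertible A \<Longrightarrow> \<psi> (Y ** A) = \<psi> Y"
  shows "(\<integral>\<^sup>+A. indicator (cball 0 1) A * ennreal (\<bar>det A\<bar> ^ CARD('n)) \<partial>(haar :: (real^'p^'p) measure)) *
      (\<integral>\<^sup>+Y. \<psi> Y * gauss (T ** Y) \<partial>lborel)
    = (\<integral>\<^sup>+A. gauss A * ennreal (\<bar>det A\<bar> ^ CARD('n)) \<partial>(haar :: (real^'p^'p) measure)) *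
      (\<integral>\<^sup>+Y. \<psi> Y * ennreal ((sqrt (gram_det Y) / sqrt (gram_det (T ** Y))) ^ CARD('n)) * indicator (cball 0 1) Y \<partial>lborel)"
    (is "?K1 * _ = ?K * _")
proof -
  define w where "w Y = sqrt (gram_det Y) ^ CARD('n)" for Y :: "real^'p^'n"
  have w0: "w Y \<ge> 0" for Y by (simp add: w_def gram_det_nonneg)
  have [measurable]: "w \<in> borel_measurable borel" unfolding w_def by measurable
  have [measurable]: "cball (0::real^'p^'n) 1 \<in> sets borel" "cball (0::real^'p^'p) 1 \<in> sets borel" by simp_all
  define h where "h Y = gauss (T ** Y) * ennreal (w Y)" for Y
  define g where "g Y = indicator (cball 0 1) Y * ennreal (w Y)" for Y :: "real^'p^'n"
  have [measurable]: "h \<in> borel_measurable borel" "g \<in> borel_measurable borel"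
    unfolding h_def g_def by measurable
  have wr: "ennreal (w (Y ** A)) = ennreal (w Y) * ennreal (\<bar>det A\<bar> ^ CARD('n))" for Y :: "real^'p^'n" and A :: "real^'p^'p"
    by (simp add: w_def sqrt_gram_det_mult_right power_mult_distrib ennreal_mult' gram_det_nonneg)
  have winv: "ennreal (inverse (w Y)) * ennreal (w Y) = 1" if "gram_det Y \<noteq> 0" for Y
    using that w0[of Y] by (simp add: ennreal_mult'[symmetric] w_def gram_det_nonneg)
  have g_avg: "(\<integral>\<^sup>+A. g (Y ** A) \<partial>haar) = ?K1" if Y: "gram_det Y \<noteq> 0" for Y
  proof -
    have ind: "indicator (cball 0 1) X = (indicator {..1} (norm X) :: ennreal)" for X :: "real^'q^'m"
      by (simp add: indicator_def)
    have "(\<integral>\<^sup>+A. g (Y ** A) \<partial>haar)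
      = ennreal (w Y) * (\<integral>\<^sup>+A. indicator {..1} (norm (Y ** A)) * ennreal (\<bar>det A\<bar> ^ CARD('n)) \<partial>haar)"
      by (simp add: g_def wr ind nn_integral_cmult[symmetric] mult_ac)
    also have "\<dots> = ennreal (w Y) * (ennreal (inverse (w Y)) * ?K1)"
      by (subst haar_integral_norm[OF _ Y]) (auto simp: w_def ind)
    also have "\<dots> = (ennreal (inverse (w Y)) * ennreal (w Y)) * ?K1" by (simp only: mult_ac)
    finally show ?thesis using winv[OF Y] by simp
  qed
  have h_avg: "(\<integral>\<^sup>+A. h (Y ** A) \<partial>haar) = ennreal (w Y / w (T ** Y)) * ?K" if Y: "gram_det Y \<noteq> 0" for Y
  proof -
    have TY: "gram_det (T ** Y) \<noteq> 0" using gram_det_mult_left_nonzero[OF T Y] .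
    have "(\<integral>\<^sup>+A. h (Y ** A) \<partial>haar)
      = ennreal (w Y) * (\<integral>\<^sup>+A. ennreal (exp (- (norm (T ** Y ** A))\<^sup>2 / 2)) * ennreal (\<bar>det A\<bar> ^ CARD('n)) \<partial>haar)"
      by (simp add: h_def wr gauss_def matrix_mul_assoc nn_integral_cmult[symmetric] mult_ac)
    also have "\<dots> = ennreal (w Y) * (ennreal (inverse (w (T ** Y))) * ?K)"
      by (subst haar_integral_norm[where G = "\<lambda>r. ennreal (exp (- r\<^sup>2 / 2))", OF _ TY]) (auto simp: w_def gauss_def)
    also have "\<dots> = ennreal (w Y / w (T ** Y)) * ?K"
      using w0 by (simp add: divide_inverse ennreal_mult mult.assoc)
    finally show ?thesis .
  qed
  have AE: "AE Y in (lborel :: (real^'p^'n) measure). gram_det Y \<noteq> 0" by (rule AE_gram_det_nonzero[OF le])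
  have "?K1 * (\<integral>\<^sup>+Y. \<psi> Y * gauss (T ** Y) \<partial>lborel) = (\<integral>\<^sup>+Y. ?K1 * (\<psi> Y * gauss (T ** Y)) \<partial>lborel)"
    by (simp add: nn_integral_cmult)
  also have "\<dots> = (\<integral>\<^sup>+Y. ennreal (inverse (w Y)) * (\<psi> Y * h Y * (\<integral>\<^sup>+A. g (Y ** A) \<partial>haar)) \<partial>lborel)"
  proof (intro nn_integral_cong_AE, use AE in eventually_elim)
    fix Y :: "real^'p^'n" assume Y: "gram_det Y \<noteq> 0"
    have "ennreal (inverse (w Y)) * (\<psi> Y * h Y * ?K1)
      = (ennreal (inverse (w Y)) * ennreal (w Y)) * (?K1 * (\<psi> Y * gauss (T ** Y)))"
      by (simp only: h_def mult_ac)
    then show "?K1 * (\<psi> Y * gauss (T ** Y)) = ennreal (inverse (w Y)) * (\<psi> Y * h Y * (\<integral>\<^sup>+A. g (Y ** A) \<partial>haar))"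
      by (simp only: g_avg[OF Y] winv[OF Y] mult_1)
  qed
  also have "\<dots> = (\<integral>\<^sup>+Y. \<psi> Y * h Y * (\<integral>\<^sup>+A. g (Y ** A) \<partial>haar) \<partial>orbit_measure)"
  proof -
    interpret H: sigma_finite_measure "haar :: (real^'p^'p) measure" by (rule sigma_finite_haar)
    show ?thesis by (subst nn_integral_orbit_measure) (auto simp: w_def)
  qed
  also have "\<dots> = (\<integral>\<^sup>+Y. \<psi> Y * g Y * (\<integral>\<^sup>+A. h (Y ** A) \<partial>haar) \<partial>orbit_measure)"
    by (rule orbit_average_exchange) (auto intro: inv)
  also have "\<dots> = (\<integral>\<^sup>+Y. ennreal (inverse (w Y)) * (\<psi> Y * g Y * (\<integral>\<^sup>+A. h (Y ** A) \<partial>haar)) \<partial>lborel)"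
  proof -
    interpret H: sigma_finite_measure "haar :: (real^'p^'p) measure" by (rule sigma_finite_haar)
    show ?thesis by (subst nn_integral_orbit_measure) (auto simp: w_def)
  qed
  also have "\<dots> = (\<integral>\<^sup>+Y. ?K * (\<psi> Y * ennreal (w Y / w (T ** Y)) * indicator (cball 0 1) Y) \<partial>lborel)"
  proof (intro nn_integral_cong_AE, use AE in eventually_elim)
    fix Y :: "real^'p^'n" assume Y: "gram_det Y \<noteq> 0"
    have "ennreal (inverse (w Y)) * (\<psi> Y * g Y * (ennreal (w Y / w (T ** Y)) * ?K))
      = (ennreal (inverse (w Y)) * ennreal (w Y)) * (?K * (\<psi> Y * ennreal (w Y / w (T ** Y)) * indicator (cball 0 1) Y))"
      by (simp only: g_def mult_ac)
    then show "ennreal (inverse (w Y)) * (\<psi> Y * g Y * (\<integral>\<^sup>+A. h (Y ** A) \<partial>haar))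
      = ?K * (\<psi> Y * ennreal (w Y / w (T ** Y)) * indicator (cball 0 1) Y)"
      by (simp only: h_avg[OF Y] winv[OF Y] mult_1)
  qed
  also have "\<dots> = ?K * (\<integral>\<^sup>+Y. \<psi> Y * ennreal (w Y / w (T ** Y)) * indicator (cball 0 1) Y \<partial>lborel)"
    by (rule nn_integral_cmult) measurable
  finally show ?thesis by (simp add: w_def power_divide)
qed

text \<open>Averaging over the group turns both Gaussian weights into the same integral over the unit ball.\<close>

lemma nn_integral_invariant_gauss:
  fixes \<psi> :: "real^'p^'n \<Rightarrow> ennreal" and T :: "real^'n^'n"
  assumes le: "CARD('p) \<le> CARD('n)" and T: "invertible T"
    and \<psi>[measurable]: "\<psi> \<in> borel_measurable borel"
    and inv: "\<And>Y A. invertible A \<Longrightarrow> \<psi> (Y ** A) = \<psi> Y"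
  shows "(\<integral>\<^sup>+Y. \<psi> Y * gauss (T ** Y) \<partial>lborel)
    = (\<integral>\<^sup>+Y. \<psi> Y * ennreal ((sqrt (gram_det Y) / sqrt (gram_det (T ** Y))) ^ CARD('n)) * gauss Y \<partial>lborel)"
proof -
  define \<psi>' where "\<psi>' Y = \<psi> Y * ennreal ((sqrt (gram_det Y) / sqrt (gram_det (T ** Y))) ^ CARD('n))" for Y
  have [measurable]: "\<psi>' \<in> borel_measurable borel" unfolding \<psi>'_def by measurable
  have inv': "\<psi>' (Y ** A) = \<psi>' Y" if A: "invertible A" for Y A
  proof -
    have "det A \<noteq> 0" using A by (simp add: invertible_det_nz)
    then show ?thesis
      using inv[OF A] by (simp add: \<psi>'_def matrix_mul_assoc sqrt_gram_det_mult_right)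
  qed
  let ?K1 = "\<integral>\<^sup>+A. indicator (cball 0 1) A * ennreal (\<bar>det A\<bar> ^ CARD('n)) \<partial>(haar :: (real^'p^'p) measure)"
  let ?K = "\<integral>\<^sup>+A. gauss A * ennreal (\<bar>det A\<bar> ^ CARD('n)) \<partial>(haar :: (real^'p^'p) measure)"
  have "?K1 * (\<integral>\<^sup>+Y. \<psi> Y * gauss (T ** Y) \<partial>lborel) = ?K * (\<integral>\<^sup>+Y. \<psi>' Y * indicator (cball 0 1) Y \<partial>lborel)"
    unfolding \<psi>'_def by (rule gauss_average[OF le T \<psi> inv])
  \<comment> \<open>Prepares the second use of \<open>gauss_average\<close>, with
    \<open>mat 1\<close> for \<open>T\<close> and the volume ratio as part of the invariant
    function. The new ratio is 1 except at rank-deficient \<open>Y\<close>, where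
    \<open>\<psi>'\<close> already vanishes.\<close>
  also have "(\<integral>\<^sup>+Y. \<psi>' Y * indicator (cball 0 1) Y \<partial>lborel)
    = (\<integral>\<^sup>+Y. \<psi>' Y * ennreal ((sqrt (gram_det Y) / sqrt (gram_det (mat 1 ** Y))) ^ CARD('n)) * indicator (cball 0 1) Y \<partial>lborel)"
  proof (rule nn_integral_cong)
    fix Y
    show "\<psi>' Y * indicator (cball 0 1) Y
      = \<psi>' Y * ennreal ((sqrt (gram_det Y) / sqrt (gram_det (mat 1 ** Y))) ^ CARD('n)) * indicator (cball 0 1) Y"
      by (cases "gram_det Y = 0") (auto simp: \<psi>'_def zero_power)
  qed
  also have "?K * (\<integral>\<^sup>+Y. \<psi>' Y * ennreal ((sqrt (gram_det Y) / sqrt (gram_det (mat 1 ** Y))) ^ CARD('n)) * indicator (cball 0 1) Y \<partial>lborel)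
     = ?K1 * (\<integral>\<^sup>+Y. \<psi>' Y * gauss (mat 1 ** Y) \<partial>lborel)"
    by (rule gauss_average[OF le _ _ inv', symmetric]) (auto simp: invertible_det_nz)
  finally show ?thesis
    using haar_unit_ball_finite_pos[OF le] by (simp add: ennreal_mult_cancel_left \<psi>'_def)
qed

subsection \<open>Rank-one perturbations and the test statistic\<close>

definition outer :: "real^'n \<Rightarrow> real^'m \<Rightarrow> real^'m^'n" where
  "outer u v = (\<chi> i j. u $ i * v $ j)"

lemma outer_mult_vector: "outer u v *v x = (v \<bullet> x) *\<^sub>R u"
  by (simp add: outer_def matrix_vector_mult_def vec_eq_iff inner_vec_def sum_distrib_left mult_ac)

lemma matrix_mult_outer: "A ** outer u v = outer (A *v u) v" for A :: "real^'n^'k"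
  by (simp add: outer_def matrix_vector_mult_def matrix_matrix_mult_def vec_eq_iff sum_distrib_left mult_ac)

lemma outer_mult_matrix: "outer u v ** A = outer u (transpose A *v v)" for A :: "real^'k^'m"
  by (simp add: outer_def matrix_vector_mult_def matrix_matrix_mult_def transpose_def vec_eq_iff sum_distrib_left mult_ac)

lemma matrix_mult_add_distrib_right: "(A + B) ** C = A ** C + B ** C" for A B :: "real^'k^'m"
  by (simp add: matrix_matrix_mult_def vec_eq_iff distrib_right sum.distrib)

text \<open>Conjugation by a matrix with \<open>k\<close>-th column \<open>u\<close> reduces to the case \<open>u = e\<^sub>k\<close>.\<close>

lemma det_rank_one_update:
  fixes u v :: "real^'n"
  shows "det (mat 1 + outer u v) = 1 + u \<bullet> v"
proof (cases "u = 0")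
  case True
  then have "outer u v = 0" by (simp add: outer_def vec_eq_iff)
  with True show ?thesis by simp
next
  case False
  then obtain k where k: "u $ k \<noteq> 0" by (auto simp: vec_eq_iff)
  have axis_case: "det (mat 1 + outer (axis k 1) z) = 1 + z $ k" for z :: "real^'n"
  proof -
    \<comment> \<open>Transposed, the matrix is the identity with its \<open>k\<close>-th column
      replaced by \<open>axis k 1 + z\<close>, the shape that \<open>cramer_lemma\<close>
      evaluates.\<close>
    have "det (mat 1 + outer (axis k 1) z) = det (transpose (mat 1 + outer (axis k 1) z))" by simp
    also have "transpose (mat 1 + outer (axis k 1) z)
      = (\<chi> i j. if j = k then (mat 1 *v (axis k 1 + z)) $ i else mat 1 $ i $ j)"
      by (simp only: matrix_vector_mul_lid) (auto simp: transpose_def outer_def vec_eq_iff mat_def axis_def)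
    also have "det \<dots> = 1 + z $ k" by (subst cramer_lemma) (simp add: axis_def)
    finally show ?thesis .
  qed
  define Q where "Q = (\<chi> i j. if j = k then (mat 1 *v u) $ i else mat 1 $ i $ j)"
  have dQ: "det Q = u $ k" unfolding Q_def by (subst cramer_lemma) simp
  have Qk: "Q *v axis k 1 = u" by (simp add: matrix_vector_mult_basis column_def Q_def vec_eq_iff)
  have "(mat 1 + outer u v) ** Q = Q ** (mat 1 + outer (axis k 1) (transpose Q *v v))"
    by (simp only: matrix_add_ldistrib matrix_mult_outer Qk matrix_mul_rid
        matrix_mult_add_distrib_right outer_mult_matrix matrix_mul_lid)
  then have "det (mat 1 + outer u v) * det Q = det Q * (1 + (transpose Q *v v) $ k)"
    by (metis axis_case det_mul)
  moreover have "(transpose Q *v v) $ k = u \<bullet> v"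
  proof -
    have "(transpose Q *v v) $ k = (transpose Q *v v) \<bullet> axis k 1" by (simp only: inner_axis inner_real_def mult_1_right)
    also have "\<dots> = u \<bullet> v" by (simp only: inner_transpose_mult Qk inner_commute[of v u] inner_commute[of "axis k 1"])
    finally show ?thesis .
  qed
  ultimately show ?thesis using k by (simp add: dQ)
qed

text \<open>For a unit vector \<open>c\<close>: eigenvalue \<open>s\<close> on the line of
  \<open>c\<close> and 1 on its orthogonal complement. One family thus contains the covariance, its
  square root and the inverses of both, with products given by multiplying the parameters.\<close>

definition spike :: "real^'n \<Rightarrow> real \<Rightarrow> real^'n^'n" where
  "spike c s = mat 1 + (s - 1) *\<^sub>R outer c c"

lemma spike_eq: "spike c s = mat 1 + outer ((s - 1) *\<^sub>R c) c"
  by (simp add: spike_def outer_def vec_eq_iff)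

lemma spike_mult_vector: "spike c s *v x = x + ((s - 1) * (c \<bullet> x)) *\<^sub>R c"
  by (simp add: spike_eq matrix_vector_mult_add_rdistrib outer_mult_vector mult.commute)

lemma transpose_spike: "transpose (spike c s) = spike c s"
  by (auto simp: spike_def outer_def transpose_def mat_def vec_eq_iff)

section \<open>Spikes along a unit vector and the statistic\<close>

locale unit_vector =
  fixes c :: "real^'n"
  assumes c: "norm c = 1"
begin

lemma inner_c: "c \<bullet> c = 1"
  using c by (simp add: dot_square_norm)

lemma spike_mult: "spike c s ** spike c t = spike c (s * t)"
proof (rule matrix_eq[THEN iffD2], rule allI)
  fix x
  show "spike c s ** spike c t *v x = spike c (s * t) *v x"
    by (simp only: matrix_vector_mul_assoc[symmetric] spike_mult_vector inner_add_right inner_scaleR_right inner_c)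
      (simp add: algebra_simps)
qed

lemma det_spike: "det (spike c s) = s"
  by (simp add: spike_eq det_rank_one_update inner_c)

lemma sym_pos_def_spike:
  assumes "s > 0"
  shows "sym_pos_def (spike c s)"
proof -
  have "0 < x \<bullet> (spike c s *v x)" if "x \<noteq> 0" for x
  proof -
    have eq: "x \<bullet> (spike c s *v x) = (x \<bullet> x - (c \<bullet> x)\<^sup>2) + s * (c \<bullet> x)\<^sup>2"
      by (simp add: spike_mult_vector inner_add_right inner_commute power2_eq_square algebra_simps)
    have "(c \<bullet> x)\<^sup>2 \<le> x \<bullet> x" using Cauchy_Schwarz_ineq[of c x] by (simp add: inner_c)
    moreover have "x \<bullet> x > 0" using that by simp
    ultimately show ?thesis unfolding eq using assms
      by (cases "c \<bullet> x = 0") (auto intro: add_nonneg_pos)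
  qed
  then show ?thesis by (simp add: sym_pos_def_def transpose_spike)
qed

lemma spiked_cov_eq: "spiked_cov c \<omega> = spike c (1 + \<omega>)"
  by (simp add: spiked_cov_def spike_def outer_def add.commute)

lemma matrix_sqrt_spiked_cov:
  assumes "\<omega> > -1"
  shows "matrix_sqrt (spiked_cov c \<omega>) = spike c (sqrt (1 + \<omega>))"
  using assms by (intro matrix_sqrt_unique sym_pos_def_spike) (simp_all add: spike_mult spiked_cov_eq)

text \<open>For full-rank \<open>Y\<close> this is the squared length of the orthogonal projection
  of \<open>c\<close> onto the column space of \<open>Y\<close>.\<close>

definition proj_sq :: "real^'p^'n \<Rightarrow> real" where
  "proj_sq Y = c \<bullet> ((orth_factor Y ** transpose (orth_factor Y)) *v c)"

lemma proj_sq_eq_0: "gram_det Y = 0 \<Longrightarrow> proj_sq Y = 0"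
proof -
  assume "gram_det Y = 0"
  then have "orth_factor Y = 0" by (simp add: orth_factor_def gram_det_def invertible_det_nz)
  then show ?thesis by (simp add: proj_sq_def matrix_matrix_mult_def matrix_vector_mult_def inner_vec_def)
qed

text \<open>Eliminates the matrix root: if \<open>x\<close> solves the normal equations, then
  \<open>U^T c = R x\<close>, and the squared length of this vector needs only
  \<open>R ** R\<close>. Later computations of the statistic merely exhibit such an
  \<open>x\<close>.\<close>

lemma proj_sq_eq:
  fixes Y :: "real^'p^'n"
  assumes Y: "gram_det Y \<noteq> 0" and x: "(transpose Y ** Y) *v x = transpose Y *v c"
  shows "proj_sq Y = (transpose Y *v c) \<bullet> x"
proof -
  let ?S = "transpose Y ** Y"
  have S: "sym_pos_def ?S" using Y by (simp add: gram_det_def sym_pos_def_gram)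
  define R where "R = matrix_sqrt ?S"
  have R: "sym_pos_def R" "R ** R = ?S" using matrix_sqrt[OF S] by (auto simp: R_def)
  have tR: "transpose R = R" using R by (simp add: sym_pos_def_def)
  let ?Ri = "matrix_inv R"
  have Ri: "R ** ?Ri = mat 1" "?Ri ** R = mat 1"
    using matrix_inv_inverse[OF sym_pos_def_invertible[OF R(1)]] by auto
  have tRi: "transpose ?Ri = ?Ri"
    by (rule matrix_inv_eqI[symmetric]) (metis Ri(2) matrix_transpose_mul tR transpose_mat)
  have U: "orth_factor Y = Y ** ?Ri"
    using Y by (simp add: orth_factor_def gram_det_def invertible_det_nz R_def Let_def)
  have tU: "transpose (orth_factor Y) *v c = R *v x"
  proof -
    have "transpose (orth_factor Y) *v c = ?Ri *v (transpose Y *v c)"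
      by (simp only: U matrix_transpose_mul tRi matrix_vector_mul_assoc)
    also have "\<dots> = (?Ri ** R) *v (R *v x)"
      by (simp only: x[symmetric] R(2)[symmetric] matrix_vector_mul_assoc matrix_mul_assoc)
    finally show ?thesis by (simp add: Ri)
  qed
  have "proj_sq Y = (transpose (orth_factor Y) *v c) \<bullet> (transpose (orth_factor Y) *v c)"
    by (simp only: proj_sq_def matrix_vector_mul_assoc[symmetric] inner_transpose_mult)
  also have "\<dots> = x \<bullet> (R *v (R *v x))"
    unfolding tU using inner_transpose_mult[of R x "R *v x"] by (simp only: tR)
  also have "\<dots> = (transpose Y *v c) \<bullet> x"
    by (simp only: matrix_vector_mul_assoc R(2) x inner_commute)
  finally show ?thesis .
qed

lemma normal_equation_solution:
  fixes Y :: "real^'p^'n"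
  assumes "gram_det Y \<noteq> 0"
  shows "(transpose Y ** Y) *v (matrix_inv (transpose Y ** Y) *v (transpose Y *v c)) = transpose Y *v c"
proof -
  have "invertible (transpose Y ** Y)" using assms by (simp add: gram_det_def invertible_det_nz)
  then show ?thesis by (simp only: matrix_vector_mul_assoc[of "transpose Y ** Y"] matrix_inv_inverse matrix_vector_mul_lid)
qed

text \<open>The formula through the normal equations involves \<open>matrix_inv\<close> but no
  \<open>matrix_sqrt\<close>, so measurability of the root never has to be established.\<close>

lemma borel_measurable_proj_sq [measurable]: "proj_sq \<in> borel_measurable (borel :: (real^'p^'n) measure)"
proof -
  have "proj_sq = (\<lambda>Y :: real^'p^'n. if gram_det Y \<noteq> 0
      then (transpose Y *v c) \<bullet> (matrix_inv (transpose Y ** Y) *v (transpose Y *v c)) else 0)"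
  proof
    fix Y :: "real^'p^'n"
    show "proj_sq Y = (if gram_det Y \<noteq> 0
      then (transpose Y *v c) \<bullet> (matrix_inv (transpose Y ** Y) *v (transpose Y *v c)) else 0)"
      using proj_sq_eq[OF _ normal_equation_solution, of Y] proj_sq_eq_0[of Y] by simp
  qed
  also have "\<dots> \<in> borel_measurable borel" by measurable
  finally show ?thesis .
qed

text \<open>With \<open>x\<close> from the normal equations, the statistic equals both
  \<open>c \<bullet> (Y *v x)\<close> and the squared norm of \<open>Y *v x\<close>; Cauchy-Schwarz
  then bounds that norm by 1.\<close>

lemma proj_sq_bounds:
  fixes Y :: "real^'p^'n"
  shows "0 \<le> proj_sq Y" "proj_sq Y \<le> 1"
proof -
  have "0 \<le> proj_sq Y \<and> proj_sq Y \<le> 1"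
  proof (cases "gram_det Y = 0")
    case False
    define x where "x = matrix_inv (transpose Y ** Y) *v (transpose Y *v c)"
    have x: "(transpose Y ** Y) *v x = transpose Y *v c"
      unfolding x_def by (rule normal_equation_solution[OF False])
    have t: "proj_sq Y = (transpose Y *v c) \<bullet> x" by (rule proj_sq_eq[OF False x])
    have t1: "proj_sq Y = c \<bullet> (Y *v x)" unfolding t by (rule inner_transpose_mult)
    have t2: "proj_sq Y = (norm (Y *v x))\<^sup>2"
      unfolding t x[symmetric] inner_commute[of _ x] gram_eq by (simp add: dot_square_norm)
    have "proj_sq Y \<le> norm (Y *v x)" unfolding t1 using norm_cauchy_schwarz[of c "Y *v x"] c by simp
    then have "norm (Y *v x) * norm (Y *v x) \<le> norm (Y *v x) * 1" by (simp add: t2 power2_eq_square)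
    then have "norm (Y *v x) \<le> 1" by (cases "norm (Y *v x) = 0") (auto simp: mult_le_cancel_left)
    then show ?thesis unfolding t2 by (simp add: power_le_one)
  qed (simp add: proj_sq_eq_0)
  then show "0 \<le> proj_sq Y" "proj_sq Y \<le> 1" by auto
qed

text \<open>The column space is unchanged; the solution of the normal equations becomes
  \<open>matrix_inv A *v x\<close>.\<close>

lemma proj_sq_mult_right:
  fixes Y :: "real^'p^'n" and A :: "real^'p^'p"
  assumes A: "invertible A"
  shows "proj_sq (Y ** A) = proj_sq Y"
proof (cases "gram_det Y = 0")
  case True
  then have "gram_det (Y ** A) = 0" using sqrt_gram_det_mult_right[of Y A] by simp
  with True show ?thesis by (simp add: proj_sq_eq_0)
next
  case False
  have "det A \<noteq> 0" using A by (simp add: invertible_det_nz)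
  then have YA: "gram_det (Y ** A) \<noteq> 0" using False sqrt_gram_det_mult_right[of Y A] by auto
  define x where "x = matrix_inv (transpose Y ** Y) *v (transpose Y *v c)"
  have x: "(transpose Y ** Y) *v x = transpose Y *v c"
    unfolding x_def by (rule normal_equation_solution[OF False])
  have Ax: "A *v (matrix_inv A *v x) = x"
    by (simp only: matrix_vector_mul_assoc matrix_inv_inverse[OF A] matrix_vector_mul_lid)
  have v: "transpose (Y ** A) *v c = transpose A *v (transpose Y *v c)"
    by (simp only: matrix_transpose_mul matrix_vector_mul_assoc)
  have "(transpose (Y ** A) ** (Y ** A)) *v (matrix_inv A *v x)
    = transpose A *v ((transpose Y ** Y) *v (A *v (matrix_inv A *v x)))"
    by (simp only: matrix_transpose_mul matrix_vector_mul_assoc matrix_mul_assoc)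
  then have "(transpose (Y ** A) ** (Y ** A)) *v (matrix_inv A *v x) = transpose (Y ** A) *v c"
    by (simp only: Ax x v)
  from proj_sq_eq[OF YA this] have "proj_sq (Y ** A) = (transpose Y *v c) \<bullet> x"
    by (simp only: v inner_transpose_mult Ax)
  then show ?thesis using proj_sq_eq[OF False x] by simp
qed

lemma spike_gram:
  fixes Y :: "real^'p^'n"
  shows "transpose (spike c s ** Y) ** (spike c s ** Y)
    = transpose Y ** Y + (s\<^sup>2 - 1) *\<^sub>R outer (transpose Y *v c) (transpose Y *v c)"
proof -
  have "transpose (spike c s ** Y) ** (spike c s ** Y) = transpose Y ** (spike c s ** spike c s) ** Y"
    by (simp only: matrix_transpose_mul transpose_spike matrix_mul_assoc)
  also have "\<dots> = transpose Y ** (mat 1 + outer ((s\<^sup>2 - 1) *\<^sub>R c) c) ** Y"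
    by (simp only: spike_mult) (simp only: spike_eq power2_eq_square)
  also have "\<dots> = (transpose Y + outer (transpose Y *v ((s\<^sup>2 - 1) *\<^sub>R c)) c) ** Y"
    by (simp only: matrix_add_ldistrib matrix_mul_rid matrix_mult_outer)
  also have "\<dots> = transpose Y ** Y + outer (transpose Y *v ((s\<^sup>2 - 1) *\<^sub>R c)) c ** Y"
    by (rule matrix_mult_add_distrib_right)
  also have "\<dots> = transpose Y ** Y + (s\<^sup>2 - 1) *\<^sub>R outer (transpose Y *v c) (transpose Y *v c)"
    by (simp only: outer_mult_matrix matrix_vector_mult_scaleR) (simp add: outer_def vec_eq_iff)
  finally show ?thesis .
qed

text \<open>With the Gram matrix of \<open>Y\<close> factored out, the rank-one change turns into an
  update of the identity, because \<open>x\<close> solves the normal equations.\<close>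

lemma gram_det_spike:
  fixes Y :: "real^'p^'n"
  assumes Y: "gram_det Y \<noteq> 0"
  shows "gram_det (spike c s ** Y) = gram_det Y * (1 + (s\<^sup>2 - 1) * proj_sq Y)"
proof -
  define x where "x = matrix_inv (transpose Y ** Y) *v (transpose Y *v c)"
  have x: "(transpose Y ** Y) *v x = transpose Y *v c"
    unfolding x_def by (rule normal_equation_solution[OF Y])
  let ?v = "transpose Y *v c"
  have "transpose (spike c s ** Y) ** (spike c s ** Y) = (transpose Y ** Y) ** (mat 1 + outer ((s\<^sup>2 - 1) *\<^sub>R x) ?v)"
    by (simp only: spike_gram matrix_add_ldistrib matrix_mul_rid matrix_mult_outer matrix_vector_mult_scaleR x)
      (simp add: outer_def vec_eq_iff)
  then have "gram_det (spike c s ** Y) = gram_det Y * (1 + ((s\<^sup>2 - 1) *\<^sub>R x) \<bullet> ?v)"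
    by (simp only: gram_det_def det_mul det_rank_one_update)
  also have "((s\<^sup>2 - 1) *\<^sub>R x) \<bullet> ?v = (s\<^sup>2 - 1) * proj_sq Y"
    unfolding proj_sq_eq[OF Y x] by (simp only: inner_scaleR_left inner_commute[of x])
  finally show ?thesis .
qed

lemma proj_sq_denominator_pos:
  assumes "a > 0"
  shows "1 + (a - 1) * proj_sq Y > 0"
proof -
  have "1 + (a - 1) * proj_sq Y = (1 - proj_sq Y) + a * proj_sq Y" by (simp add: algebra_simps)
  moreover have "proj_sq Y = 0 \<or> a * proj_sq Y > 0" using assms proj_sq_bounds(1)[of Y] by (auto simp: zero_less_mult_iff)
  ultimately show ?thesis using proj_sq_bounds[of Y] by (elim disjE) (simp, linarith)
qed

lemma proj_sq_spike:
  fixes Y :: "real^'p^'n"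
  assumes s: "s > 0"
  shows "proj_sq (spike c s ** Y) = s\<^sup>2 * proj_sq Y / (1 + (s\<^sup>2 - 1) * proj_sq Y)"
proof (cases "gram_det Y = 0")
  case True
  have "gram_det (spike c s ** Y) = 0"
  proof (rule ccontr)
    assume "gram_det (spike c s ** Y) \<noteq> 0"
    from gram_det_mult_left_nonzero[OF _ this, of "spike c (inverse s)"] s
    have "gram_det (spike c (inverse s) ** (spike c s ** Y)) \<noteq> 0"
      by (simp add: invertible_det_nz det_spike)
    moreover have "spike c (inverse s) ** (spike c s ** Y) = Y"
      using s by (simp only: matrix_mul_assoc spike_mult) (simp add: spike_def)
    ultimately show False using True by simp
  qed
  with True show ?thesis by (simp add: proj_sq_eq_0)
next
  case False
  define x where "x = matrix_inv (transpose Y ** Y) *v (transpose Y *v c)"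
  have x: "(transpose Y ** Y) *v x = transpose Y *v c"
    unfolding x_def by (rule normal_equation_solution[OF False])
  let ?v = "transpose Y *v c"
  have t: "?v \<bullet> x = proj_sq Y" using proj_sq_eq[OF False x] by simp
  define d where "d = 1 + (s\<^sup>2 - 1) * proj_sq Y"
  have d: "d > 0" unfolding d_def using s by (intro proj_sq_denominator_pos) simp
  have PY: "gram_det (spike c s ** Y) \<noteq> 0"
    using s False by (intro gram_det_mult_left_nonzero) (auto simp: invertible_det_nz det_spike)
  have v': "transpose (spike c s ** Y) *v c = s *\<^sub>R ?v"
  proof -
    have "spike c s *v c = s *\<^sub>R c" by (simp add: spike_mult_vector inner_c algebra_simps)
    then show ?thesis
      by (simp only: matrix_transpose_mul transpose_spike matrix_vector_mul_assoc[symmetric] matrix_vector_mult_scaleR)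
  qed
  \<comment> \<open>The new Gram matrix sends \<open>x\<close> to \<open>d\<close> times
    \<open>?v\<close>, while the new right-hand side is \<open>s\<close> times \<open>?v\<close>;
    hence the factor \<open>s / d\<close>.\<close>
  have "(transpose (spike c s ** Y) ** (spike c s ** Y)) *v ((s / d) *\<^sub>R x)
      = (s / d) *\<^sub>R (?v + ((s\<^sup>2 - 1) * proj_sq Y) *\<^sub>R ?v)"
    by (simp only: spike_gram matrix_vector_mult_scaleR matrix_vector_mult_add_rdistrib x
        scaleR_matrix_vector_assoc[symmetric] outer_mult_vector t scaleR_scaleR)
  also have "?v + ((s\<^sup>2 - 1) * proj_sq Y) *\<^sub>R ?v = d *\<^sub>R ?v" by (simp only: d_def scaleR_add_left scaleR_one)
  also have "(s / d) *\<^sub>R (d *\<^sub>R ?v) = ((s / d) * d) *\<^sub>R ?v" by (simp only: scaleR_scaleR)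
  finally have "(transpose (spike c s ** Y) ** (spike c s ** Y)) *v ((s / d) *\<^sub>R x) = transpose (spike c s ** Y) *v c"
    using d by (simp only: v') simp
  from proj_sq_eq[OF PY this] show ?thesis
    by (simp only: v' inner_scaleR_left inner_scaleR_right t) (simp add: d_def power2_eq_square)
qed

end

text \<open>Ratio at \<open>t = c\<^sup>T U U\<^sup>T c\<close> of the densities of the orbit of \<open>Y\<close> under \<open>1 + \<omega> = a\<close> and under
  \<open>\<omega> = 0\<close>.\<close>

definition likelihood_ratio :: "nat \<Rightarrow> nat \<Rightarrow> real \<Rightarrow> real \<Rightarrow> real" where
  "likelihood_ratio p n a t = inverse (sqrt a) ^ p * inverse (sqrt (1 + (1 / a - 1) * t)) ^ n"

lemma borel_measurable_likelihood_ratio [measurable]: "likelihood_ratio p n a \<in> borel_measurable borel"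
  unfolding likelihood_ratio_def by measurable

context unit_vector
begin

text \<open>Change of measure: the spike moves from the argument of \<psi> into a density.
  Substituting the spike by left multiplication gives the power of \<open>sqrt a\<close>, and
  \<open>nn_integral_invariant_gauss\<close> for the inverse spike gives the factor depending on the
  statistic.\<close>

lemma nn_integral_std_normal_spike:
  fixes \<psi> :: "real^'p^'n \<Rightarrow> ennreal"
  assumes le: "CARD('p) \<le> CARD('n)" and a: "a > 0"
    and [measurable]: "\<psi> \<in> borel_measurable borel"
    and inv: "\<And>Y A. invertible A \<Longrightarrow> \<psi> (Y ** A) = \<psi> Y"
  shows "(\<integral>\<^sup>+Z. \<psi> (spike c (sqrt a) ** Z) \<partial>std_normal_matrix)
    = (\<integral>\<^sup>+Z. \<psi> Z * ennreal (likelihood_ratio CARD('p) CARD('n) a (proj_sq Z)) \<partial>std_normal_matrix)"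
proof -
  obtain k where k: "(std_normal_matrix :: (real^'p^'n) measure) = density lborel (\<lambda>Y. ennreal k * gauss Y)"
    by (rule std_normal_matrix_eq_density)
  let ?P = "spike c (sqrt a)" and ?T = "spike c (inverse (sqrt a))"
  have sa: "sqrt a > 0" using a by simp
  have T: "invertible ?T" "invertible ?P" using sa by (simp_all add: invertible_det_nz det_spike)
  have TP: "?T ** (?P ** Y) = Y" for Y :: "real^'p^'n"
    using sa by (simp only: matrix_mul_assoc spike_mult) (simp add: spike_def)
  have TP': "?T ** ?P ** Y = Y" for Y :: "real^'p^'n" using TP by (simp only: matrix_mul_assoc)
  have "(\<integral>\<^sup>+Y. \<psi> Y * gauss (?T ** Y) \<partial>lborel)
    = ennreal (sqrt a ^ CARD('p)) * (\<integral>\<^sup>+Y. \<psi> (?P ** Y) * gauss (?T ** (?P ** Y)) \<partial>lborel)"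
    using nn_integral_lborel_matrix_mult_left[OF T(2), of "\<lambda>Y. \<psi> Y * gauss (?T ** Y)"] a by (simp add: det_spike)
  then have "ennreal (inverse (sqrt a) ^ CARD('p)) * (\<integral>\<^sup>+Y. \<psi> Y * gauss (?T ** Y) \<partial>lborel)
    = (ennreal (inverse (sqrt a) ^ CARD('p)) * ennreal (sqrt a ^ CARD('p))) * (\<integral>\<^sup>+Y. \<psi> (?P ** Y) * gauss Y \<partial>lborel)"
    by (simp only: TP mult.assoc)
  also have "ennreal (inverse (sqrt a) ^ CARD('p)) * ennreal (sqrt a ^ CARD('p)) = 1"
    using sa by (simp add: ennreal_mult'[symmetric] power_mult_distrib[symmetric])
  finally have 1: "(\<integral>\<^sup>+Y. \<psi> (?P ** Y) * gauss Y \<partial>lborel)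
    = ennreal (inverse (sqrt a) ^ CARD('p)) * (\<integral>\<^sup>+Y. \<psi> Y * gauss (?T ** Y) \<partial>lborel)" by simp
  have "(\<integral>\<^sup>+Y. \<psi> Y * gauss (?T ** Y) \<partial>lborel)
    = (\<integral>\<^sup>+Y. \<psi> Y * ennreal ((sqrt (gram_det Y) / sqrt (gram_det (?T ** Y))) ^ CARD('n)) * gauss Y \<partial>lborel)"
    by (rule nn_integral_invariant_gauss[OF le T(1) _ inv]) auto
  also have "\<dots> = (\<integral>\<^sup>+Y. \<psi> Y * ennreal (inverse (sqrt (1 + (1 / a - 1) * proj_sq Y)) ^ CARD('n)) * gauss Y \<partial>lborel)"
  proof (intro nn_integral_cong_AE, use AE_gram_det_nonzero[OF le] in eventually_elim)
    fix Y :: "real^'p^'n" assume Y: "gram_det Y \<noteq> 0"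
    have "(inverse (sqrt a))\<^sup>2 = 1 / a" using a by (simp add: power_inverse field_simps)
    then have "gram_det (?T ** Y) = gram_det Y * (1 + (1 / a - 1) * proj_sq Y)"
      by (simp only: gram_det_spike[OF Y])
    then have "sqrt (gram_det Y) / sqrt (gram_det (?T ** Y)) = inverse (sqrt (1 + (1 / a - 1) * proj_sq Y))"
      using Y by (simp only: real_sqrt_mult) (simp add: divide_inverse)
    then show "\<psi> Y * ennreal ((sqrt (gram_det Y) / sqrt (gram_det (?T ** Y))) ^ CARD('n)) * gauss Y
      = \<psi> Y * ennreal (inverse (sqrt (1 + (1 / a - 1) * proj_sq Y)) ^ CARD('n)) * gauss Y" by simp
  qed
  finally have 2: "(\<integral>\<^sup>+Y. \<psi> (?P ** Y) * gauss Y \<partial>lborel)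
    = ennreal (inverse (sqrt a) ^ CARD('p)) * (\<integral>\<^sup>+Y. \<psi> Y * ennreal (inverse (sqrt (1 + (1 / a - 1) * proj_sq Y)) ^ CARD('n)) * gauss Y \<partial>lborel)"
    unfolding 1 by simp
  have "(\<integral>\<^sup>+Z. \<psi> (?P ** Z) \<partial>std_normal_matrix) = (\<integral>\<^sup>+Z. ennreal k * (\<psi> (?P ** Z) * gauss Z) \<partial>lborel)"
    unfolding k by (subst nn_integral_density) (auto intro!: nn_integral_cong simp: mult_ac)
  also have "\<dots> = ennreal k * (\<integral>\<^sup>+Z. \<psi> (?P ** Z) * gauss Z \<partial>lborel)"
    by (rule nn_integral_cmult) measurable
  also have "\<dots> = (\<integral>\<^sup>+Z. ennreal k * (ennreal (inverse (sqrt a) ^ CARD('p)) *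
      (\<psi> Z * ennreal (inverse (sqrt (1 + (1 / a - 1) * proj_sq Z)) ^ CARD('n)) * gauss Z)) \<partial>lborel)"
    unfolding 2 by (subst nn_integral_cmult[symmetric], measurable)+
  also have "\<dots> = (\<integral>\<^sup>+Z. ennreal k * gauss Z * (\<psi> Z * ennreal (likelihood_ratio CARD('p) CARD('n) a (proj_sq Z))) \<partial>lborel)"
  proof (rule nn_integral_cong)
    fix Z :: "real^'p^'n"
    have "ennreal (likelihood_ratio CARD('p) CARD('n) a (proj_sq Z))
      = ennreal (inverse (sqrt a) ^ CARD('p)) * ennreal (inverse (sqrt (1 + (1 / a - 1) * proj_sq Z)) ^ CARD('n))"
      unfolding likelihood_ratio_def using sa by (intro ennreal_mult') simp
    then show "ennreal k * (ennreal (inverse (sqrt a) ^ CARD('p)) *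
        (\<psi> Z * ennreal (inverse (sqrt (1 + (1 / a - 1) * proj_sq Z)) ^ CARD('n)) * gauss Z))
      = ennreal k * gauss Z * (\<psi> Z * ennreal (likelihood_ratio CARD('p) CARD('n) a (proj_sq Z)))"
      by (simp only: mult_ac)
  qed
  also have "\<dots> = (\<integral>\<^sup>+Z. \<psi> Z * ennreal (likelihood_ratio CARD('p) CARD('n) a (proj_sq Z)) \<partial>std_normal_matrix)"
    unfolding k by (subst nn_integral_density) auto
  finally show ?thesis .
qed

lemma sets_std_normal_matrix [measurable_cong, simp]: "sets (std_normal_matrix :: (real^'p^'m) measure) = sets borel"
  by (simp add: std_normal_matrix_def)

lemma nn_integral_proj_sq_spike:
  fixes f :: "real \<Rightarrow> ennreal"
  assumes le: "CARD('p) \<le> CARD('n)" and a: "a > 0" and [measurable]: "f \<in> borel_measurable borel"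
  shows "(\<integral>\<^sup>+t. f (a * t / (1 + (a - 1) * t)) \<partial>distr std_normal_matrix borel (proj_sq :: real^'p^'n \<Rightarrow> real))
    = (\<integral>\<^sup>+t. f t * ennreal (likelihood_ratio CARD('p) CARD('n) a t) \<partial>distr std_normal_matrix borel (proj_sq :: real^'p^'n \<Rightarrow> real))"
proof -
  have "(\<integral>\<^sup>+t. f (a * t / (1 + (a - 1) * t)) \<partial>distr std_normal_matrix borel (proj_sq :: real^'p^'n \<Rightarrow> real))
    = (\<integral>\<^sup>+Z. f (proj_sq (spike c (sqrt a) ** (Z :: real^'p^'n))) \<partial>std_normal_matrix)"
    using a by (subst nn_integral_distr) (auto simp: proj_sq_spike)
  also have "\<dots> = (\<integral>\<^sup>+Z. f (proj_sq (Z :: real^'p^'n)) * ennreal (likelihood_ratio CARD('p) CARD('n) a (proj_sq Z)) \<partial>std_normal_matrix)"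
    by (rule nn_integral_std_normal_spike[OF le a]) (auto simp: proj_sq_mult_right)
  also have "\<dots> = (\<integral>\<^sup>+t. f t * ennreal (likelihood_ratio CARD('p) CARD('n) a t) \<partial>distr std_normal_matrix borel (proj_sq :: real^'p^'n \<Rightarrow> real))"
    by (subst nn_integral_distr) auto
  finally show ?thesis .
qed

end

subsection \<open>The beta distribution\<close>

definition logistic :: "real \<Rightarrow> real" where
  "logistic x = 1 / (1 + exp (- x))"

definition logit :: "real \<Rightarrow> real" where
  "logit u = ln (u / (1 - u))"

lemma logistic_bounds: "0 < logistic x" "logistic x < 1"
  by (simp_all add: logistic_def add_pos_pos)

lemma borel_measurable_logistic [measurable]: "logistic \<in> borel_measurable borel"
  unfolding logistic_def by measurable

lemma borel_measurable_logit [measurable]: "logit \<in> borel_measurable borel"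
  unfolding logit_def by measurable

lemma logistic_logit: "0 < u \<Longrightarrow> u < 1 \<Longrightarrow> logistic (logit u) = u"
  by (simp add: logistic_def logit_def exp_minus field_simps)

lemma logistic_altdef: "logistic x = exp x / (1 + exp x)" "1 - logistic x = 1 / (1 + exp x)"
proof -
  have "1 + exp x \<noteq> 0" using exp_gt_zero[of x] by linarith
  then show "logistic x = exp x / (1 + exp x)" "1 - logistic x = 1 / (1 + exp x)"
    by (simp_all add: logistic_def exp_minus field_simps)
qed

lemma logit_logistic: "logit (logistic x) = x"
proof -
  have "1 + exp x \<noteq> 0" using exp_gt_zero[of x] by linarith
  then have "logistic x / (1 - logistic x) = exp x" unfolding logistic_altdef(2) unfolding logistic_altdef(1) by simp
  then show ?thesis by (simp add: logit_def)
qed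

lemma logistic_less_iff: "logistic x < logistic y \<longleftrightarrow> x < y"
  unfolding logistic_def inverse_eq_divide[symmetric]
  by (subst inverse_less_iff_less) (auto simp: add_pos_pos)

lemma DERIV_logit:
  assumes "0 < u" "u < 1"
  shows "DERIV logit u :> 1 / (u * (1 - u))"
proof -
  have "u * (1 - u)\<^sup>2 > 0" using assms by simp
  then have "u + u * (u * u) \<noteq> u * (u * 2)" by (simp add: power2_eq_square algebra_simps)
  then have "DERIV (\<lambda>u. ln (u / (1 - u))) u :> 1 / (u * (1 - u))"
    using assms by (auto intro!: derivative_eq_intros simp: field_simps power2_eq_square)
  then show ?thesis by (simp add: logit_def[abs_def])
qed

text \<open>The substitution with \<open>dx = du / (u (1 - u))\<close> as an identity of measures,
  so that intervals suffice and the fundamental theorem of calculus settles them.\<close>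

lemma lborel_eq_distr_logit:
  "lborel = distr (density lborel (\<lambda>u. ennreal (indicator {0<..<1} u / (u * (1 - u))))) borel logit"
    (is "_ = distr ?D _ _")
proof (rule lborel_eqI)
  fix l r :: real assume lr: "\<And>b. b \<in> Basis \<Longrightarrow> l \<bullet> b \<le> r \<bullet> b"
  then have lr: "l \<le> r" by simp
  define w :: "real \<Rightarrow> real" where "w u = indicator {0<..<1} u / (u * (1 - u))" for u
  have [measurable]: "w \<in> borel_measurable borel" unfolding w_def by measurable
  have "emeasure (distr ?D borel logit) (box l r) = emeasure ?D (logit -` {l<..<r})"
    by (subst emeasure_distr) (auto simp: box_real)
  also have "\<dots> = (\<integral>\<^sup>+u. ennreal (w u) * indicator (logit -` {l<..<r}) u \<partial>lborel)"
    by (subst emeasure_density) (auto simp: w_def intro!: measurable_sets_borel[OF borel_measurable_logit])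
  also have "\<dots> = (\<integral>\<^sup>+u. ennreal (w u) * indicator {logistic l..logistic r} u \<partial>lborel)"
  \<comment> \<open>The fundamental theorem is applied on a closed interval, hence the two excluded
    endpoints. Outside the unit interval the values of \<open>logit\<close> are meaningless, but
    there \<open>w\<close> vanishes.\<close>
  proof (intro nn_integral_cong_AE, use AE_lborel_singleton[of "logistic l"] AE_lborel_singleton[of "logistic r"] in eventually_elim)
    fix u assume u: "u \<noteq> logistic l" "u \<noteq> logistic r"
    show "ennreal (w u) * indicator (logit -` {l<..<r}) u = ennreal (w u) * indicator {logistic l..logistic r} u"
    proof (cases "0 < u \<and> u < 1")
      case True
      then have "u = logistic (logit u)" by (simp add: logistic_logit)
      then have "l < logit u \<longleftrightarrow> logistic l < u" "logit u < r \<longleftrightarrow> u < logistic r"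
        using logistic_less_iff by metis+
      then show ?thesis using u by (auto simp: indicator_def)
    qed (auto simp: w_def)
  qed
  also have "\<dots> = ennreal (logit (logistic r) - logit (logistic l))"
  proof (rule nn_integral_FTC_Icc)
    fix x assume "x \<in> {logistic l..logistic r}"
    then have x: "0 < x" "x < 1" using logistic_bounds(1)[of l] logistic_bounds(2)[of r] by auto
    show "DERIV logit x :> w x" using DERIV_logit[OF x] x by (simp add: w_def)
    show "0 \<le> w x" using x by (simp add: w_def)
  next
    show "logistic l \<le> logistic r" using logistic_less_iff[of r l] lr by (meson not_less)
  qed measurable
  also have "\<dots> = ennreal (\<Prod>b\<in>Basis. (r - l) \<bullet> b)" by (simp add: logit_logistic)
  finally show "emeasure (distr ?D borel logit) (box l r) = ennreal (\<Prod>b\<in>Basis. (r - l) \<bullet> b)" .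
qed simp

lemma nn_integral_logistic:
  assumes [measurable]: "f \<in> borel_measurable borel"
  shows "(\<integral>\<^sup>+x. f (logistic x) \<partial>lborel)
    = (\<integral>\<^sup>+u. ennreal (indicator {0<..<1} u / (u * (1 - u))) * f u \<partial>lborel)"
proof -
  have "(\<integral>\<^sup>+x. f (logistic x) \<partial>lborel)
    = (\<integral>\<^sup>+x. f (logistic x) \<partial>distr (density lborel (\<lambda>u. ennreal (indicator {0<..<1} u / (u * (1 - u))))) borel logit)"
    by (rule arg_cong[OF lborel_eq_distr_logit])
  also have "\<dots> = (\<integral>\<^sup>+u. ennreal (indicator {0<..<1} u / (u * (1 - u))) * f (logistic (logit u)) \<partial>lborel)"
    by (simp add: nn_integral_distr nn_integral_density)
  also have "\<dots> = (\<integral>\<^sup>+u. ennreal (indicator {0<..<1} u / (u * (1 - u))) * f u \<partial>lborel)"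
    by (intro nn_integral_cong) (auto simp: indicator_def logistic_logit)
  finally show ?thesis .
qed

lemma nn_integral_beta_kernel:
  assumes "x > 0" "y > 0"
  shows "(\<integral>\<^sup>+u. ennreal (indicator {0<..<1} u * u powr (x - 1) * (1 - u) powr (y - 1)) \<partial>lborel) = ennreal (Beta x y)"
proof -
  have "((\<lambda>u. u powr (x - 1) * (1 - u) powr (y - 1)) has_integral Beta x y) {0..1}"
    using has_integral_Beta_real[OF assms] .
  then have "(\<integral>\<^sup>+u. ennreal (indicator {0..1} u * (u powr (x - 1) * (1 - u) powr (y - 1))) \<partial>lborel) = ennreal (Beta x y)"
    by (intro nn_integral_has_integral_lebesgue) auto
  also have "(\<integral>\<^sup>+u. ennreal (indicator {0..1} u * (u powr (x - 1) * (1 - u) powr (y - 1))) \<partial>lborel)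
    = (\<integral>\<^sup>+u. ennreal (indicator {0<..<1} u * u powr (x - 1) * (1 - u) powr (y - 1)) \<partial>lborel)"
    by (intro nn_integral_cong_AE, use AE_lborel_singleton[of "0::real"] AE_lborel_singleton[of "1::real"] in eventually_elim)
      (auto simp: indicator_def)
  finally show ?thesis .
qed

text \<open>The unnormalized beta density on the logit scale: the extra factor
  \<open>u (1 - u)\<close> from the substitution removes the usual \<open>- 1\<close> from both
  exponents.\<close>

definition beta_weight :: "nat \<Rightarrow> nat \<Rightarrow> real \<Rightarrow> real" where
  "beta_weight p n u = u powr (real p / 2) * (1 - u) powr ((real n - real p) / 2)"

lemma borel_measurable_beta_weight [measurable]: "beta_weight p n \<in> borel_measurable borel"
  unfolding beta_weight_def by measurable

lemma beta_weight_pos: "0 < u \<Longrightarrow> u < 1 \<Longrightarrow> beta_weight p n u > 0"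
  by (simp add: beta_weight_def)

lemma inverse_sqrt_power: "x > 0 \<Longrightarrow> inverse (sqrt x) ^ m = exp (- (real m / 2) * ln x)"
proof -
  assume x: "x > 0"
  have "inverse (sqrt x) = exp (- (ln x / 2))"
    using x by (simp add: exp_minus ln_sqrt[symmetric])
  then show ?thesis by (simp add: exp_of_nat_mult[symmetric])
qed

text \<open>The logarithm of the weight at \<open>logistic y\<close> is a linear term minus
  \<open>n / 2\<close> times \<open>ln (E y)\<close>. In the quotient the linear terms and the
  powers of \<open>E\<close> combine to exactly the two factors of the likelihood ratio.\<close>

lemma likelihood_ratio_logistic:
  "likelihood_ratio p n (exp x) (logistic l) = beta_weight p n (logistic (l - x)) / beta_weight p n (logistic l)"
proof -
  define E where "E y = 1 + exp (- y)" for y :: real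
  have E: "E y > 0" for y by (simp add: E_def add_pos_pos)
  have W: "beta_weight p n (logistic y) = exp (- (y * (real n - real p) / 2) - real n / 2 * ln (E y))" for y
  proof -
    have "ln (logistic y) = - ln (E y)" using E[of y] by (simp add: logistic_def E_def[symmetric] ln_div)
    moreover have "1 - logistic y = exp (- y) / E y" using E[of y] by (simp add: logistic_def E_def field_simps)
    then have "ln (1 - logistic y) = - y - ln (E y)" using E[of y] by (simp add: ln_div)
    ultimately have "beta_weight p n (logistic y)
      = exp (real p / 2 * - ln (E y) + (real n - real p) / 2 * (- y - ln (E y)))"
      using logistic_bounds[of y] by (simp only: beta_weight_def powr_def exp_add) simp
    then show ?thesis by (simp add: field_simps)
  qed
  have "exp (- x) * E (l - x) = exp (- x) + (E l - 1)"
    by (simp add: E_def algebra_simps exp_add[symmetric])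
  moreover have "1 + (1 / exp x - 1) * (1 / E l) = (exp (- x) + (E l - 1)) / E l"
    using E[of l] by (simp add: field_simps exp_minus)
  ultimately have "1 + (1 / exp x - 1) * logistic l = exp (- x) * E (l - x) / E l"
    by (simp only: logistic_def E_def[symmetric])
  moreover have "ln (exp (- x) * E (l - x) / E l) = - x + ln (E (l - x)) - ln (E l)"
    using E[of l] E[of "l - x"] by (simp add: ln_div ln_mult)
  moreover have "exp (- x) * E (l - x) / E l > 0" using E by simp
  ultimately have "likelihood_ratio p n (exp x) (logistic l)
    = exp (- (real p / 2) * x) * exp (- (real n / 2) * (- x + ln (E (l - x)) - ln (E l)))"
    unfolding likelihood_ratio_def by (simp add: inverse_sqrt_power)
  also have "\<dots> = exp (- ((l - x) * (real n - real p) / 2) - real n / 2 * ln (E (l - x))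
      - (- (l * (real n - real p) / 2) - real n / 2 * ln (E l)))"
    by (simp add: exp_add[symmetric] algebra_simps diff_divide_distrib add_divide_distrib)
  also have "\<dots> = beta_weight p n (logistic (l - x)) / beta_weight p n (logistic l)"
    unfolding W by (rule exp_diff)
  finally show ?thesis .
qed

text \<open>The map multiplies the odds \<open>t / (1 - t)\<close> by \<open>exp x\<close>, so it
  shifts the logit by \<open>x\<close>.\<close>

lemma logistic_scale:
  "exp x * logistic l / (1 + (exp x - 1) * logistic l) = logistic (x + l)"
proof -
  have l: "1 + exp l \<noteq> 0" using exp_gt_zero[of l] by linarith
  have "1 + (exp x - 1) * (exp l / (1 + exp l)) = (1 + exp x * exp l) / (1 + exp l)"
    using l by (simp add: field_simps)
  then show ?thesis using l by (simp add: logistic_altdef(1) exp_add)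
qed

text \<open>On the logit scale the hypothesis says that the law of \<open>logit t\<close>, divided by the weight, is
  translation invariant, hence proportional to Lebesgue measure. Integrating it over \<open>a = e\<^sup>x\<close> makes
  this explicit.\<close>

lemma quasi_invariant_imp_beta:
  fixes \<nu> :: "real measure"
  assumes \<nu>: "prob_space \<nu>" and sets[measurable_cong, simp]: "sets \<nu> = sets borel"
    and bounds: "AE t in \<nu>. 0 \<le> t \<and> t \<le> 1"
    and p: "0 < p" "p < n"
    and quasi: "\<And>a f. a > 0 \<Longrightarrow> f \<in> borel_measurable borel \<Longrightarrow>
      (\<integral>\<^sup>+t. f (a * t / (1 + (a - 1) * t)) \<partial>\<nu>) = (\<integral>\<^sup>+t. f t * ennreal (likelihood_ratio p n a t) \<partial>\<nu>)"
  shows "\<nu> = beta_distribution (real p / 2) ((real n - real p) / 2)"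
proof -
  interpret N: prob_space \<nu> by fact
  interpret PP: pair_sigma_finite "lborel :: real measure" \<nu> ..
  interpret PP': pair_sigma_finite \<nu> "lborel :: real measure" ..
  \<comment> \<open>Atoms at 0 and 1 must be excluded before taking logits. Both points are fixed by
    the map, so their mass equals itself times the ratio there, which is not 1. The choice
    \<open>a = 4\<close> only keeps the square roots rational.\<close>
  have point: "emeasure \<nu> {z} = emeasure \<nu> {z} * ennreal (likelihood_ratio p n 4 z)"
    if z: "z = 0 \<or> z = 1" for z
  proof -
    have "emeasure \<nu> {z} = (\<integral>\<^sup>+t. indicator {z} t \<partial>\<nu>)" by simp
    also have "\<dots> = (\<integral>\<^sup>+t. indicator {z} (4 * t / (1 + (4 - 1) * t)) \<partial>\<nu>)"
      by (intro nn_integral_cong_AE, use bounds in eventually_elim)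
        (use z in \<open>auto simp: indicator_def field_simps\<close>)
    also have "\<dots> = (\<integral>\<^sup>+t. indicator {z} t * ennreal (likelihood_ratio p n 4 t) \<partial>\<nu>)"
      by (rule quasi) auto
    also have "\<dots> = (\<integral>\<^sup>+t. ennreal (likelihood_ratio p n 4 z) * indicator {z} t \<partial>\<nu>)"
      by (intro nn_integral_cong) (auto simp: indicator_def)
    also have "\<dots> = ennreal (likelihood_ratio p n 4 z) * emeasure \<nu> {z}"
      by (simp add: nn_integral_cmult)
    finally show ?thesis by (simp add: mult.commute)
  qed
  have point_null: "emeasure \<nu> {z} = 0" if z: "z = 0 \<or> z = 1" and ne: "likelihood_ratio p n 4 z \<noteq> 1"
    and nn: "likelihood_ratio p n 4 z \<ge> 0" for z
  proof -
    have "measure \<nu> {z} = measure \<nu> {z} * likelihood_ratio p n 4 z"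
      using point[OF z] nn by (simp add: N.emeasure_eq_measure ennreal_mult'[symmetric])
    then have "measure \<nu> {z} = 0" using ne by simp
    then show ?thesis by (simp add: N.emeasure_eq_measure)
  qed
  have "likelihood_ratio p n 4 0 = (1 / 2) ^ p" by (simp add: likelihood_ratio_def inverse_eq_divide)
  moreover have "(1 / 2 :: real) ^ p < 1" using p by (simp add: power_less_one_iff)
  ultimately have null0: "emeasure \<nu> {0} = 0" by (intro point_null) auto
  have "sqrt (1 / 4) = 1 / 2" by (simp add: real_sqrt_divide)
  moreover have "1 + (1 / 4 - 1) * 1 = (1 / 4 :: real)" by simp
  ultimately have "likelihood_ratio p n 4 1 = inverse 2 ^ p * inverse (1 / 2) ^ n"
    by (simp only: likelihood_ratio_def real_sqrt_four)
  also have "\<dots> = 2 ^ n / 2 ^ p" by (simp add: power_one_over inverse_eq_divide)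
  finally have "likelihood_ratio p n 4 1 = 2 ^ n / 2 ^ p" .
  \<comment> \<open>Here \<open>p < n\<close> is essential: for \<open>p = n\<close> the column
    space is almost surely everything and the statistic sits at 1.\<close>
  moreover have "(2::real) ^ p < 2 ^ n" using p by simp
  ultimately have null1: "emeasure \<nu> {1} = 0" by (intro point_null) auto
  have "AE t in \<nu>. t \<noteq> 0" "AE t in \<nu>. t \<noteq> 1"
    by (rule AE_I[OF _ null0], auto) (rule AE_I[OF _ null1], auto)
  with bounds have interior: "AE t in \<nu>. 0 < t \<and> t < 1" by eventually_elim auto
  define W where "W = beta_weight p n"
  have [measurable]: "W \<in> borel_measurable borel" unfolding W_def by measurable
  define B where "B = (\<integral>\<^sup>+x. ennreal (W (logistic x)) \<partial>lborel)"
  have key: "(\<integral>\<^sup>+x. g (logistic x) * ennreal (W (logistic x)) \<partial>lborel) = B * (\<integral>\<^sup>+t. g t \<partial>\<nu>)"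
    if [measurable]: "g \<in> borel_measurable borel" for g
  proof -
    let ?f = "\<lambda>u. g u * ennreal (W u)"
    \<comment> \<open>The left side is a constant, so it may be integrated over the probability
      measure \<open>\<nu>\<close>; this makes room for a translation by
      \<open>logit t\<close>.\<close>
    have "(\<integral>\<^sup>+x. ?f (logistic x) \<partial>lborel) = (\<integral>\<^sup>+t. (\<integral>\<^sup>+x. ?f (logistic x) \<partial>lborel) \<partial>\<nu>)"
      by (simp add: N.emeasure_space_1)
    also have "\<dots> = (\<integral>\<^sup>+t. (\<integral>\<^sup>+x. ?f (logistic (logit t + x)) \<partial>lborel) \<partial>\<nu>)"
      by (subst nn_integral_lborel_translate[where f = "\<lambda>x. ?f (logistic x)"]) auto
    also have "\<dots> = (\<integral>\<^sup>+x. (\<integral>\<^sup>+t. ?f (logistic (logit t + x)) \<partial>\<nu>) \<partial>lborel)"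
      by (rule PP.Fubini') measurable
    also have "\<dots> = (\<integral>\<^sup>+x. (\<integral>\<^sup>+t. ?f (exp x * t / (1 + (exp x - 1) * t)) \<partial>\<nu>) \<partial>lborel)"
    proof (rule nn_integral_cong, rule nn_integral_cong_AE, use interior in eventually_elim)
      fix x t :: real assume t: "0 < t \<and> t < 1"
      have "logistic (logit t + x) = exp x * t / (1 + (exp x - 1) * t)"
        using logistic_scale[of x "logit t"] t by (simp add: logistic_logit add.commute)
      then show "?f (logistic (logit t + x)) = ?f (exp x * t / (1 + (exp x - 1) * t))" by simp
    qed
    also have "\<dots> = (\<integral>\<^sup>+x. (\<integral>\<^sup>+t. ?f t * ennreal (likelihood_ratio p n (exp x) t) \<partial>\<nu>) \<partial>lborel)"
      by (intro nn_integral_cong quasi[where f = ?f]) auto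
    \<comment> \<open>The denominator of the likelihood ratio cancels the factor \<open>W t\<close>
      put into \<open>?f\<close>; what is left depends on \<open>x\<close> only through a translated
      weight.\<close>
    also have "\<dots> = (\<integral>\<^sup>+x. (\<integral>\<^sup>+t. g t * ennreal (W (logistic (logit t - x))) \<partial>\<nu>) \<partial>lborel)"
    proof (rule nn_integral_cong, rule nn_integral_cong_AE, use interior in eventually_elim)
      fix x t :: real assume t: "0 < t \<and> t < 1"
      have "likelihood_ratio p n (exp x) t = W (logistic (logit t - x)) / W t"
        using likelihood_ratio_logistic[of p n x "logit t"] t by (simp add: logistic_logit W_def)
      moreover have "W t > 0" using t by (simp add: W_def beta_weight_pos)
      ultimately have "ennreal (W t) * ennreal (likelihood_ratio p n (exp x) t) = ennreal (W (logistic (logit t - x)))"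
        by (simp add: ennreal_mult'[symmetric])
      then show "?f t * ennreal (likelihood_ratio p n (exp x) t) = g t * ennreal (W (logistic (logit t - x)))"
        by (simp add: mult.assoc)
    qed
    also have "\<dots> = (\<integral>\<^sup>+t. (\<integral>\<^sup>+x. g t * ennreal (W (logistic (logit t - x))) \<partial>lborel) \<partial>\<nu>)"
      by (rule PP'.Fubini') measurable
    also have "\<dots> = (\<integral>\<^sup>+t. g t * B \<partial>\<nu>)"
    proof (rule nn_integral_cong)
      fix t
      have "(\<integral>\<^sup>+x. ennreal (W (logistic (logit t - x))) \<partial>lborel)
        = (\<integral>\<^sup>+x. ennreal (W (logistic (logit t + x))) \<partial>lborel)"
        using nn_integral_lborel_isometry[of "uminus :: real \<Rightarrow> real" "\<lambda>x. ennreal (W (logistic (logit t + x)))"]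
        by (simp add: linear_iff)
      also have "\<dots> = B"
        unfolding B_def by (rule nn_integral_lborel_translate[where f = "\<lambda>x. ennreal (W (logistic x))"]) measurable
      finally show "(\<integral>\<^sup>+x. g t * ennreal (W (logistic (logit t - x))) \<partial>lborel) = g t * B"
        by (simp add: nn_integral_cmult)
    qed
    also have "\<dots> = B * (\<integral>\<^sup>+t. g t \<partial>\<nu>)" by (subst nn_integral_multc) (auto simp: mult.commute)
    finally show ?thesis .
  qed
  define kern :: "real \<Rightarrow> real" where
    "kern u = indicator {0<..<1} u * u powr (real p / 2 - 1) * (1 - u) powr ((real n - real p) / 2 - 1)" for u
  have [measurable]: "kern \<in> borel_measurable borel" unfolding kern_def by measurable
  have kern: "ennreal (indicator {0<..<1} u / (u * (1 - u))) * ennreal (W u) = ennreal (kern u)" for u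
  proof (cases "0 < u \<and> u < 1")
    case True
    have "x powr (k - 1) = x powr k / x" if "x > 0" for x k :: real
      using that by (simp add: powr_diff)
    then have "kern u = u powr (real p / 2) / u * ((1 - u) powr ((real n - real p) / 2) / (1 - u))"
      using True by (simp only: kern_def) simp
    then have "1 / (u * (1 - u)) * W u = kern u"
      by (simp add: W_def beta_weight_def)
    then show ?thesis using True by (simp add: ennreal_mult'[symmetric])
  qed (auto simp: kern_def)
  define be where "be = Beta (real p / 2) ((real n - real p) / 2)"
  have be: "be > 0" unfolding be_def Beta_def using p
    by (intro divide_pos_pos mult_pos_pos Gamma_real_pos add_pos_pos) auto
  \<comment> \<open>\<open>key\<close> would also hold for infinite \<open>B\<close>; its value
    shows that it is positive and finite, so that it can be cancelled and serves as the normalizing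
    constant.\<close>
  have B: "B = ennreal be"
  proof -
    have "B = (\<integral>\<^sup>+u. ennreal (kern u) \<partial>lborel)"
      unfolding B_def by (subst nn_integral_logistic[where f = "\<lambda>u. ennreal (W u)"]) (auto simp: kern)
    also have "\<dots> = ennreal be"
      unfolding kern_def be_def using p by (intro nn_integral_beta_kernel) auto
    finally show ?thesis .
  qed
  show ?thesis
  proof (rule measure_eqI)
    show "sets \<nu> = sets (beta_distribution (real p / 2) ((real n - real p) / 2))"
      by (simp add: beta_distribution_def)
    fix A assume "A \<in> sets \<nu>"
    then have [measurable]: "A \<in> sets borel" by simp
    have "ennreal be * emeasure \<nu> A = (\<integral>\<^sup>+x. indicator A (logistic x) * ennreal (W (logistic x)) \<partial>lborel)"
      using key[of "indicator A"] by (simp add: B)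
    also have "\<dots> = (\<integral>\<^sup>+u. ennreal (indicator {0<..<1} u / (u * (1 - u))) * (indicator A u * ennreal (W u)) \<partial>lborel)"
      by (rule nn_integral_logistic) measurable
    also have "\<dots> = (\<integral>\<^sup>+u. ennreal be * (ennreal (kern u / be) * indicator A u) \<partial>lborel)"
    proof (rule nn_integral_cong)
      fix u
      have k: "ennreal (kern u) = ennreal be * ennreal (kern u / be)"
        using be by (simp add: ennreal_mult'[symmetric])
      have "ennreal (indicator {0<..<1} u / (u * (1 - u))) * (indicator A u * ennreal (W u))
        = (ennreal (indicator {0<..<1} u / (u * (1 - u))) * ennreal (W u)) * indicator A u"
        by (simp only: mult_ac)
      then show "ennreal (indicator {0<..<1} u / (u * (1 - u))) * (indicator A u * ennreal (W u))
        = ennreal be * (ennreal (kern u / be) * indicator A u)"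
        by (simp only: kern k mult.assoc)
    qed
    also have "\<dots> = ennreal be * (\<integral>\<^sup>+u. ennreal (kern u / be) * indicator A u \<partial>lborel)"
      by (rule nn_integral_cmult) measurable
    also have "(\<integral>\<^sup>+u. ennreal (kern u / be) * indicator A u \<partial>lborel)
      = emeasure (beta_distribution (real p / 2) ((real n - real p) / 2)) A"
      unfolding beta_distribution_def be_def kern_def by (rule emeasure_density[symmetric]) measurable
    finally show "emeasure \<nu> A = emeasure (beta_distribution (real p / 2) ((real n - real p) / 2)) A"
      using be by (simp add: ennreal_mult_cancel_left)
  qed
qed

section \<open>Support, atoms and quantiles\<close>

lemma AE_beta_distribution: "AE t in beta_distribution x y. 0 < t \<and> t < 1"
  unfolding beta_distribution_def by (subst AE_density) (auto simp: indicator_def)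

lemma emeasure_beta_distribution_point: "emeasure (beta_distribution x y) {t} = 0"
proof -
  have "emeasure (beta_distribution x y) {t} = (\<integral>\<^sup>+u. ennreal (indicator {0<..<1} u * u powr (x - 1) *
      (1 - u) powr (y - 1) / Beta x y) * indicator {t} u \<partial>lborel)"
    unfolding beta_distribution_def by (rule emeasure_density) auto
  also have "\<dots> = (\<integral>\<^sup>+(u::real). 0 \<partial>lborel)"
    by (intro nn_integral_cong_AE, use AE_lborel_singleton[of t] in eventually_elim) simp
  finally show ?thesis by simp
qed

text \<open>Without atoms the distribution function is continuous: it attains \<open>s\<close>, and
  the closed set defining the quantile contains its infimum. The level of the test is therefore
  exact, with no randomization.\<close>

lemma cdf_quantile:
  assumes "real_distribution M" and point: "\<And>x. measure M {x} = 0" and s: "0 < s" "s < 1"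
  shows "cdf M (quantile M s) = s"
proof -
  interpret real_distribution M by fact
  have cont: "isCont (cdf M) x" for x using point by (simp add: isCont_cdf)
  have "eventually (\<lambda>x. cdf M x < s) at_bot" using cdf_lim_at_bot s(1) by (rule order_tendstoD)
  then obtain a where a: "cdf M a < s" by (auto simp: eventually_at_bot_linorder)
  have "eventually (\<lambda>x. s < cdf M x) at_top" using cdf_lim_at_top_prob s(2) by (rule order_tendstoD)
  then obtain b where b: "s < cdf M b" by (auto simp: eventually_at_top_linorder)
  have "a \<le> b" using a b cdf_nondecreasing[of b a] by linarith
  then obtain x where x: "cdf M x = s"
    using IVT[of "cdf M" a s b] a b cont by (auto simp: less_imp_le)
  let ?S = "{x. s \<le> cdf M x}"
  have "closed ?S" by (intro closed_Collect_le continuous_on_const continuous_at_imp_continuous_on) (simp add: cont)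
  moreover have bdd: "bdd_below ?S"
  proof (rule bdd_belowI)
    fix y assume "y \<in> ?S"
    then show "a \<le> y" using a cdf_nondecreasing[of y a] by (cases "a \<le> y") auto
  qed
  moreover have "?S \<noteq> {}" using x by auto
  ultimately have "Inf ?S \<in> ?S" by (intro closed_contains_Inf)
  moreover have "Inf ?S \<le> x" using bdd x by (intro cInf_lower) auto
  then have "cdf M (Inf ?S) \<le> s" using cdf_nondecreasing x by metis
  ultimately show ?thesis by (simp add: quantile_def)
qed

subsection \<open>The most powerful invariant test\<close>

lemma likelihood_ratio_denominator_pos:
  assumes "a > 0" "0 \<le> t" "t \<le> (1::real)"
  shows "1 + (1 / a - 1) * t > 0"
proof (cases "t = 0")
  case False
  have "1 + (1 / a - 1) * t = (1 - t) + t / a" by (simp add: algebra_simps)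
  moreover have "t / a > 0" using False assms by simp
  ultimately show ?thesis using assms by linarith
qed simp

lemma likelihood_ratio_nonneg:
  assumes "a > 0" "0 \<le> t" "t \<le> 1"
  shows "likelihood_ratio p n a t \<ge> 0"
  using likelihood_ratio_denominator_pos[OF assms] assms by (simp add: likelihood_ratio_def)

text \<open>For \<open>a \<ge> 1\<close> the coefficient \<open>1 / a - 1\<close> is at most 0, so
  the quantity under the inverse root decreases in the statistic.\<close>

lemma likelihood_ratio_mono:
  assumes a: "a \<ge> 1" and t: "0 \<le> s" "s \<le> t" "t \<le> 1"
  shows "likelihood_ratio p n a s \<le> likelihood_ratio p n a t"
proof -
  have "(1 / a - 1) * t \<le> (1 / a - 1) * s" using a t by (intro mult_left_mono_neg) (auto simp: divide_le_eq)
  then have "inverse (sqrt (1 + (1 / a - 1) * s)) \<le> inverse (sqrt (1 + (1 / a - 1) * t))"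
    using likelihood_ratio_denominator_pos[of a t] a t by (intro le_imp_inverse_le) auto
  moreover have "0 \<le> inverse (sqrt (1 + (1 / a - 1) * s))"
    using likelihood_ratio_denominator_pos[of a s] a t by simp
  ultimately show ?thesis
    unfolding likelihood_ratio_def using a by (intro mult_left_mono power_mono) auto
qed

context unit_vector
begin

lemma distr_proj_sq:
  assumes "CARD('p) < CARD('n)"
  shows "distr std_normal_matrix borel (proj_sq :: real^'p^'n \<Rightarrow> real)
    = beta_distribution (real CARD('p) / 2) ((real CARD('n) - real CARD('p)) / 2)"
proof (rule quasi_invariant_imp_beta)
  show "prob_space (distr std_normal_matrix borel (proj_sq :: real^'p^'n \<Rightarrow> real))"
    by (intro prob_space.prob_space_distr prob_space_std_normal_matrix) simp
  show "AE t in distr std_normal_matrix borel (proj_sq :: real^'p^'n \<Rightarrow> real). 0 \<le> t \<and> t \<le> 1"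
    by (subst AE_distr_iff) (auto simp: proj_sq_bounds)
  show "0 < CARD('p)" by simp
  show "CARD('p) < CARD('n)" by fact
qed (use assms in \<open>auto intro!: nn_integral_proj_sq_spike\<close>)

lemma invariant_test_mult:
  fixes A :: "real^'p^'p"
  assumes "invariant_test \<psi>" "invertible A"
  shows "\<psi> (Y ** A) = \<psi> Y"
proof -
  have "invertible (transpose A)" using assms(2) by (simp add: invertible_det_nz)
  then have "\<psi> (Y ** transpose (transpose A)) = \<psi> Y"
    using assms(1) unfolding invariant_test_def by blast
  then show ?thesis by simp
qed

text \<open>\<Sigma> enters only as right multiplication by its invertible root, which an invariant
  test ignores.\<close>

lemma power_fun_eq:
  fixes \<psi> :: "real^'p^'n \<Rightarrow> real"
  assumes \<psi>: "invariant_test \<psi>" and \<Sigma>: "sym_pos_def \<Sigma>" and \<omega>: "\<omega> \<ge> 0"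
  shows "power_fun c \<psi> \<Sigma> \<omega> = (\<integral>Z. \<psi> (spike c (sqrt (1 + \<omega>)) ** Z) \<partial>std_normal_matrix)"
proof -
  have [measurable]: "\<psi> \<in> borel_measurable borel" using \<psi> by (simp add: invariant_test_def)
  have "invertible (matrix_sqrt \<Sigma>)" using matrix_sqrt(1)[OF \<Sigma>] by (rule sym_pos_def_invertible)
  then show ?thesis
    using \<omega> unfolding power_fun_def spiked_model_def matrix_normal_def
    by (subst integral_distr) (auto simp: invariant_test_mult[OF \<psi>] matrix_sqrt_spiked_cov)
qed

text \<open>Passes from nonnegative to Bochner integrals. The ratio is bounded by its value at 1,
  where it is largest, and tests are bounded by 1, so everything is integrable.\<close>

lemma power_fun_likelihood_ratio:
  fixes \<psi> :: "real^'p^'n \<Rightarrow> real"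
  assumes lt: "CARD('p) < CARD('n)" and \<psi>: "invariant_test \<psi>" and \<Sigma>: "sym_pos_def \<Sigma>" and \<omega>: "\<omega> \<ge> 0"
  shows "integrable std_normal_matrix (\<lambda>Z. \<psi> Z * likelihood_ratio CARD('p) CARD('n) (1 + \<omega>) (proj_sq Z))"
    and "power_fun c \<psi> \<Sigma> \<omega>
      = (\<integral>Z. \<psi> Z * likelihood_ratio CARD('p) CARD('n) (1 + \<omega>) (proj_sq Z) \<partial>std_normal_matrix)"
proof -
  interpret prob_space "std_normal_matrix :: (real^'p^'n) measure" by (rule prob_space_std_normal_matrix)
  have [measurable]: "\<psi> \<in> borel_measurable borel" and b: "\<And>Y. 0 \<le> \<psi> Y" "\<And>Y. \<psi> Y \<le> 1"
    using \<psi> by (auto simp: invariant_test_def)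
  let ?L = "\<lambda>Z :: real^'p^'n. likelihood_ratio CARD('p) CARD('n) (1 + \<omega>) (proj_sq Z)"
  have L0: "?L Z \<ge> 0" for Z using \<omega> proj_sq_bounds[of Z] by (intro likelihood_ratio_nonneg) auto
  have L1: "?L Z \<le> likelihood_ratio CARD('p) CARD('n) (1 + \<omega>) 1" for Z
    using \<omega> proj_sq_bounds[of Z] by (intro likelihood_ratio_mono) auto
  show "integrable std_normal_matrix (\<lambda>Z. \<psi> Z * ?L Z)"
  proof (rule integrable_const_bound)
    show "AE Z in std_normal_matrix. norm (\<psi> Z * ?L Z) \<le> likelihood_ratio CARD('p) CARD('n) (1 + \<omega>) 1"
    proof (rule AE_I2)
      fix Z :: "real^'p^'n"
      have "\<psi> Z * ?L Z \<le> 1 * ?L Z" using b L0 by (intro mult_right_mono)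
      then show "norm (\<psi> Z * ?L Z) \<le> likelihood_ratio CARD('p) CARD('n) (1 + \<omega>) 1"
        using b L0 L1[of Z] by (simp add: abs_mult)
    qed
  qed measurable
  have "(\<integral>Z. \<psi> (spike c (sqrt (1 + \<omega>)) ** Z) \<partial>std_normal_matrix)
    = enn2real (\<integral>\<^sup>+Z. ennreal (\<psi> (spike c (sqrt (1 + \<omega>)) ** Z)) \<partial>std_normal_matrix)"
    using b by (intro integral_eq_nn_integral) auto
  also have "(\<integral>\<^sup>+Z. ennreal (\<psi> (spike c (sqrt (1 + \<omega>)) ** Z)) \<partial>std_normal_matrix)
    = (\<integral>\<^sup>+Z. ennreal (\<psi> Z) * ennreal (?L Z) \<partial>std_normal_matrix)"
    using lt \<omega> by (intro nn_integral_std_normal_spike[where \<psi> = "\<lambda>Y. ennreal (\<psi> Y)"])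
      (auto simp: invariant_test_mult[OF \<psi>])
  also have "\<dots> = (\<integral>\<^sup>+Z. ennreal (\<psi> Z * ?L Z) \<partial>std_normal_matrix)"
    using b by (simp add: ennreal_mult')
  also have "enn2real \<dots> = (\<integral>Z. \<psi> Z * ?L Z \<partial>std_normal_matrix)"
    using b L0 by (intro integral_eq_nn_integral[symmetric]) auto
  finally show "power_fun c \<psi> \<Sigma> \<omega> = (\<integral>Z. \<psi> Z * ?L Z \<partial>std_normal_matrix)"
    by (simp add: power_fun_eq[OF \<psi> \<Sigma> \<omega>])
qed

definition threshold_test :: "real \<Rightarrow> real^'p^'n \<Rightarrow> real" where
  "threshold_test q Y = (if proj_sq Y > q then 1 else 0)"

lemma invariant_test_threshold: "invariant_test (threshold_test q :: real^'p^'n \<Rightarrow> real)"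
proof -
  have "(threshold_test q :: real^'p^'n \<Rightarrow> real) \<in> borel_measurable borel"
    unfolding threshold_test_def by measurable
  moreover have "threshold_test q (Y ** transpose A) = threshold_test q Y" if "invertible A" for Y :: "real^'p^'n" and A :: "real^'p^'p"
    using that proj_sq_mult_right[of "transpose A" Y] by (simp add: threshold_test_def invertible_det_nz)
  ultimately show ?thesis by (simp add: invariant_test_def threshold_test_def)
qed

lemma power_fun_threshold:
  fixes \<Sigma> :: "real^'p^'p"
  assumes lt: "CARD('p) < CARD('n)" and \<Sigma>: "sym_pos_def \<Sigma>" and \<omega>: "\<omega> \<ge> 0"
  defines "B \<equiv> beta_distribution (real CARD('p) / 2) ((real CARD('n) - real CARD('p)) / 2)"
  shows "power_fun c (threshold_test q :: real^'p^'n \<Rightarrow> real) \<Sigma> \<omega>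
    = measure B {b. (1 + \<omega>) / (1 + b * \<omega>) * b > q}"
proof -
  have B: "B = distr std_normal_matrix borel (proj_sq :: real^'p^'n \<Rightarrow> real)"
    unfolding B_def by (rule distr_proj_sq[OF lt, symmetric])
  have S[measurable]: "{b. (1 + \<omega>) / (1 + b * \<omega>) * b > q} \<in> sets borel" by measurable
  have "power_fun c (threshold_test q :: real^'p^'n \<Rightarrow> real) \<Sigma> \<omega>
    = (\<integral>Z. threshold_test q (spike c (sqrt (1 + \<omega>)) ** (Z :: real^'p^'n)) \<partial>std_normal_matrix)"
    by (rule power_fun_eq[OF invariant_test_threshold \<Sigma> \<omega>])
  also have "\<dots> = (\<integral>Z. indicator {b. (1 + \<omega>) / (1 + b * \<omega>) * b > q} (proj_sq (Z :: real^'p^'n)) \<partial>std_normal_matrix)"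
    using \<omega> by (intro Bochner_Integration.integral_cong refl)
      (simp add: threshold_test_def proj_sq_spike indicator_def mult.commute)
  also have "\<dots> = (\<integral>t. indicator {b. (1 + \<omega>) / (1 + b * \<omega>) * b > q} t \<partial>B)"
    unfolding B by (subst integral_distr) auto
  also have "\<dots> = measure B {b. (1 + \<omega>) / (1 + b * \<omega>) * b > q}"
    by (simp add: B)
  finally show ?thesis .
qed

text \<open>Neyman--Pearson: the likelihood ratio is an increasing function of the statistic.\<close>

lemma threshold_test_most_powerful:
  fixes \<psi> :: "real^'p^'n \<Rightarrow> real"
  assumes lt: "CARD('p) < CARD('n)" and \<psi>: "invariant_test \<psi>" and \<Sigma>: "sym_pos_def \<Sigma>" and \<omega>: "\<omega> \<ge> 0"
    and q: "0 \<le> q" "q \<le> 1"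
    and level: "power_fun c \<psi> \<Sigma> 0 = power_fun c (threshold_test q :: real^'p^'n \<Rightarrow> real) \<Sigma> 0"
  shows "power_fun c \<psi> \<Sigma> \<omega> \<le> power_fun c (threshold_test q :: real^'p^'n \<Rightarrow> real) \<Sigma> \<omega>"
proof -
  let ?L = "likelihood_ratio CARD('p) CARD('n) (1 + \<omega>)"
  let ?\<phi> = "threshold_test q :: real^'p^'n \<Rightarrow> real"
  note \<phi> = invariant_test_threshold[of q, where 'p = 'p]
  have L1: "likelihood_ratio p n (1 + 0) t = 1" for p n t by (simp add: likelihood_ratio_def)
  have i0: "integrable std_normal_matrix \<psi>" "integrable std_normal_matrix ?\<phi>"
    using power_fun_likelihood_ratio(1)[OF lt \<psi> \<Sigma> order_refl] power_fun_likelihood_ratio(1)[OF lt \<phi> \<Sigma> order_refl]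
    by (simp_all only: L1 mult_1_right)
  have eq0: "(\<integral>Z. \<psi> Z \<partial>std_normal_matrix) = (\<integral>Z. ?\<phi> Z \<partial>std_normal_matrix)"
    using power_fun_likelihood_ratio(2)[OF lt \<psi> \<Sigma> order_refl] power_fun_likelihood_ratio(2)[OF lt \<phi> \<Sigma> order_refl] level
    by (simp only: L1 mult_1_right)
  \<comment> \<open>The integrand is \<open>(?\<phi> - \<psi>) (?L t - ?L q)\<close>: both factors
    change sign at the threshold. Its part with the constant \<open>?L q\<close> integrates to 0
    because the levels agree.\<close>
  have "0 \<le> (\<integral>Z. ?\<phi> Z * ?L (proj_sq Z) - \<psi> Z * ?L (proj_sq Z) - ?L q * (?\<phi> Z - \<psi> Z) \<partial>std_normal_matrix)"
  proof (rule Bochner_Integration.integral_nonneg)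
    fix Z :: "real^'p^'n"
    have b: "0 \<le> \<psi> Z" "\<psi> Z \<le> 1" using \<psi> by (auto simp: invariant_test_def)
    have "0 \<le> (?\<phi> Z - \<psi> Z) * (?L (proj_sq Z) - ?L q)"
    proof (cases "proj_sq Z > q")
      case True
      then have "?L q \<le> ?L (proj_sq Z)" using \<omega> q proj_sq_bounds[of Z] by (intro likelihood_ratio_mono) auto
      then show ?thesis using True b by (simp add: threshold_test_def)
    next
      case False
      then have "?L (proj_sq Z) \<le> ?L q" using \<omega> q proj_sq_bounds[of Z] by (intro likelihood_ratio_mono) auto
      then show ?thesis using False b by (simp add: threshold_test_def mult_nonneg_nonpos)
    qed
    then show "0 \<le> ?\<phi> Z * ?L (proj_sq Z) - \<psi> Z * ?L (proj_sq Z) - ?L q * (?\<phi> Z - \<psi> Z)"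
      by (simp add: algebra_simps)
  qed
  also have "\<dots> = power_fun c ?\<phi> \<Sigma> \<omega> - power_fun c \<psi> \<Sigma> \<omega>"
    using power_fun_likelihood_ratio[OF lt \<psi> \<Sigma> \<omega>] power_fun_likelihood_ratio[OF lt \<phi> \<Sigma> \<omega>] i0 eq0
    by simp
  finally show ?thesis by simp
qed

end

lemma odds_threshold_iff:
  fixes b q \<omega> :: real
  assumes b: "0 < b" "b < 1" and q: "q < 1" and \<omega>: "\<omega> \<ge> 0"
  shows "(1 + \<omega>) / (1 + b * \<omega>) * b > q \<longleftrightarrow> b > q / (1 + \<omega> * (1 - q))"
proof -
  have "0 \<le> b * \<omega>" "0 \<le> \<omega> * (1 - q)" using b q \<omega> by auto
  then have pos: "1 + b * \<omega> > 0" "1 + \<omega> * (1 - q) > 0" by linarith+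
  have "(1 + \<omega>) / (1 + b * \<omega>) * b > q \<longleftrightarrow> q * (1 + b * \<omega>) < (1 + \<omega>) * b"
    using pos(1) by (simp add: pos_less_divide_eq)
  also have "\<dots> \<longleftrightarrow> q < b * (1 + \<omega> * (1 - q))" by (simp add: algebra_simps)
  also have "\<dots> \<longleftrightarrow> b > q / (1 + \<omega> * (1 - q))"
    using pos(2) by (simp add: pos_divide_less_eq)
  finally show ?thesis .
qed

theorem theorem3:
  fixes c :: "real^'n" and \<alpha> q :: real
    and B :: "real measure" and \<phi> :: "real^'p^'n \<Rightarrow> real"
  assumes "CARD('p) < CARD('n)"
    and "norm c = 1"
    and "0 < \<alpha>" and "\<alpha> < 1"
    and "B = beta_distribution (real CARD('p) / 2) ((real CARD('n) - real CARD('p)) / 2)"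
    and "q = quantile B (1 - \<alpha>)"
    and "\<phi> = (\<lambda>Y. let U = orth_factor Y in
                 if c \<bullet> ((U ** transpose U) *v c) > q then 1 else 0)"
  shows "UMP_invariant c \<alpha> \<phi> \<and>
    (\<forall>\<Sigma> \<omega>. sym_pos_def \<Sigma> \<longrightarrow> 0 \<le> \<omega> \<longrightarrow>
       power_fun c \<phi> \<Sigma> \<omega> = measure B {b. (1 + \<omega>) / (1 + b * \<omega>) * b > q} \<and>
       measure B {b. (1 + \<omega>) / (1 + b * \<omega>) * b > q} =
         measure B {b. b > q / (1 + \<omega> * (1 - q))})"
proof -
  interpret unit_vector c using assms(2) by unfold_locales
  note lt = assms(1)
  have \<phi>: "\<phi> = threshold_test q"
    unfolding assms(7) by (rule ext) (simp add: threshold_test_def proj_sq_def Let_def)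
  have B_distr: "B = distr std_normal_matrix borel (proj_sq :: real^'p^'n \<Rightarrow> real)"
    unfolding assms(5) by (rule distr_proj_sq[OF lt, symmetric])
  have "prob_space B"
    unfolding B_distr by (intro prob_space.prob_space_distr prob_space_std_normal_matrix) simp
  then interpret B: real_distribution B
    by (intro real_distribution.intro real_distribution_axioms.intro) (simp_all add: B_distr)
  have [measurable_cong, simp]: "sets B = sets borel" by simp
  have AE: "AE t in B. 0 < t \<and> t < 1" unfolding assms(5) by (rule AE_beta_distribution)
  have point: "measure B {x} = 0" for x
    unfolding assms(5) by (simp add: measure_def emeasure_beta_distribution_point)
  have cdf_q: "cdf B q = 1 - \<alpha>"
    unfolding assms(6) using assms(3,4) by (intro cdf_quantile B.real_distribution_axioms point) auto
  \<comment> \<open>The law lives on the open unit interval, so a threshold outside it would have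
    distribution function 0 or 1 rather than \<open>1 - \<alpha>\<close>.\<close>
  have q0: "q > 0"
  proof (rule ccontr)
    assume "\<not> q > 0"
    then have "cdf B q \<le> measure B {..0}" unfolding cdf_def2 by (intro B.finite_measure_mono) auto
    moreover have "measure B {..0} = 0"
      by (subst B.prob_eq_0) (use AE in \<open>auto elim!: eventually_mono\<close>)
    ultimately show False using cdf_q assms(4) by simp
  qed
  have q1: "q < 1"
  proof (rule ccontr)
    assume "\<not> q < 1"
    then have "measure B {..<1} \<le> cdf B q" unfolding cdf_def2 by (intro B.finite_measure_mono) auto
    moreover have "measure B {..<1} = 1"
      by (subst B.prob_eq_1) (use AE in \<open>auto elim!: eventually_mono\<close>)
    ultimately show False using cdf_q assms(3) by simp
  qed
  have power: "power_fun c \<phi> \<Sigma> \<omega> = measure B {b. (1 + \<omega>) / (1 + b * \<omega>) * b > q}"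
    if "sym_pos_def \<Sigma>" "0 \<le> \<omega>" for \<Sigma> \<omega>
    unfolding \<phi> assms(5) by (rule power_fun_threshold[OF lt that])
  have level: "power_fun c \<phi> \<Sigma> 0 = \<alpha>" if "sym_pos_def \<Sigma>" for \<Sigma>
  proof -
    have "power_fun c \<phi> \<Sigma> 0 = measure B {q<..}" using power[OF that, of 0] by (simp add: greaterThan_def)
    also have "{q<..} = space B - {..q}" by auto
    also have "measure B \<dots> = 1 - cdf B q" unfolding cdf_def2 by (rule B.prob_compl) simp
    finally show ?thesis by (simp add: cdf_q)
  qed
  have \<phi>_level: "invariant_level_test c \<alpha> \<phi>"
    unfolding invariant_level_test_def using level invariant_test_threshold[of q, where 'p = 'p] by (auto simp: \<phi>)
  have "power_fun c \<psi> \<Sigma> \<omega> \<le> power_fun c \<phi> \<Sigma> \<omega>"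
    if \<psi>: "invariant_level_test c \<alpha> \<psi>" and \<Sigma>: "sym_pos_def \<Sigma>" and \<omega>: "0 < \<omega>"
    for \<psi> :: "real^'p^'n \<Rightarrow> real" and \<Sigma> \<omega>
    unfolding \<phi>
  proof (rule threshold_test_most_powerful[OF lt _ \<Sigma>])
    show "invariant_test \<psi>" using \<psi> by (simp add: invariant_level_test_def)
    show "power_fun c \<psi> \<Sigma> 0 = power_fun c (threshold_test q :: real^'p^'n \<Rightarrow> real) \<Sigma> 0"
      using \<psi> \<Sigma> level[OF \<Sigma>] by (simp add: invariant_level_test_def \<phi>)
  qed (use \<omega> q0 q1 in auto)
  then have "UMP_invariant c \<alpha> \<phi>" using \<phi>_level by (simp add: UMP_invariant_def)
  \<comment> \<open>The two sets differ as subsets of the line, since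
    \<open>1 + b * \<omega>\<close> may be negative for \<open>b < 0\<close>; they agree on the
    support of \<open>B\<close>.\<close>
  moreover have "measure B {b. (1 + \<omega>) / (1 + b * \<omega>) * b > q} = measure B {b. b > q / (1 + \<omega> * (1 - q))}"
    if "0 \<le> \<omega>" for \<omega>
  proof (rule B.finite_measure_eq_AE)
    show "AE b in B. (b \<in> {b. (1 + \<omega>) / (1 + b * \<omega>) * b > q}) = (b \<in> {b. b > q / (1 + \<omega> * (1 - q))})"
      using AE by eventually_elim (use odds_threshold_iff[OF _ _ q1 that] in blast)
  qed measurable
  ultimately show ?thesis using power by blast
qed

end
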